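(* Let $D\ge 1$, let $\mathcal{X}=[\underline{x}_1,\overline{x}_1]\times\cdots\times[\underline{x}_D,\overline{x}_D]\subset\mathbb{R}^D$ be a hyperrectangle (with $\underline{x}_i<\overline{x}_i$), and let $\overline{N}=(N_1,\dots,N_D)$ with integers $N_i\ge 1$. Let $f:\mathcal{X}\to\mathbb{R}$ have an analytic extension (also denoted $f$) to the generalized Bernstein ellipse $B(\mathcal{X},\varrho)$ for some parameter vector $\varrho=(\varrho_1,\dots,\varrho_D)\in(1,\infty)^D$, with $|f(x)|\le V<\infty$ for all $x\in B(\mathcal{X},\varrho)$. Let $I_{\overline{N}}(f)$ be the tensorized Chebyshev interpolation of $f$ on $\mathcal{X}$. Then $$\max_{x\in\mathcal{X}}\big|f(x)-I_{\overline{N}}(f)(x)\big|\le\min\{a(\varrho,N,D),\,b(\varrho,N,D)\},$$ where, denoting by $S_D$ the symmetric group on $D$ elements, $$a(\varrho,N,D)=\min_{\sigma\in S_D}\left(\sum_{i=1}^D 4V\frac{\varrho_{\sigma(i)}^{-N_{\sigma(i)}}}{\varrho_{\sigma(i)}-1}+\sum_{k=2}^D 4V\frac{\varrho_{\sigma(k)}^{-N_{\sigma(k)}}}{\varrho_{\sigma(k)}-1}\cdot 2^{k-1}\,\frac{(k-1)+2^{k-1}-1}{\prod_{j=1}^{k-1}\big(1-\frac{1}{\varrho_{\sigma(j)}}\big)}\right),$$ $$b(\varrho,N,D)=2^{\frac{D}{2}+1}\cdot V\cdot\left(\sum_{i=1}^D\varrho_i^{-2N_i}\prod_{j=1}^D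\frac{1}{1-\varrho_j^{-2}}\right)^{\frac12}.$$
   Context: Tensorized Chebyshev interpolation on $[-1,1]^D$: $T_n$ is the $n$-th Chebyshev polynomial of the first kind, $T_n(\cos\theta)=\cos(n\theta)$. Let $J=\{(j_1,\dots,j_D)\in\mathbb{N}_0^D: j_i\le N_i \text{ for all } i\}$. For $f$ on $[-1,1]^D$, $$I_{\overline N}(f)(x)=\sum_{j\in J}c_jT_j(x),\qquad T_j(x_1,\dots,x_D)=\prod_{i=1}^DT_{j_i}(x_i),$$ $$c_j=\Big(\prod_{i=1}^D\frac{2^{\mathbf 1_{\{0<j_i<N_i\}}}}{N_i}\Big)\sum_{k_1=0}^{N_1}{}^{''}\cdots\sum_{k_D=0}^{N_D}{}^{''}f(x^{(k_1,\dots,k_D)})\prod_{i=1}^D\cos\Big(j_i\pi\frac{k_i}{N_i}\Big),$$ where $\sum''$ means that the first and last summands are halved, and the nodes are $x^{(k_1,\dots,k_D)}=(x_{k_1},\dots,x_{k_D})$ with $x_{k_i}=\cos(\pi k_i/N_i)$, $k_i=0,\dots,N_i$. For a general hyperrectangle $\mathcal{X}$, $I_{\overline N}(f)$ is obtained by transporting to $[-1,1]^D$ with the componentwise affine maps $\tau_{[\underline{x}_i,\overline{x}_i]}$: with $\tau=(\tau_{[\underline{x}_1,\overline{x}_1]},\dots,\tau_{[\underline{x}_D,\overline{x}_D]})$, $I_{\overline N}(f)=I_{\overline N}(f\circ\tau)\circ\tau^{-1}$, where $\tau_{[\underline{x},\overline{x}]}(z)=\overline{x}+\frac{\underline{x}-\overline{x}}{2}(1-z)$,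 i.e. real parts are sent to $\overline{x}+\frac{\underline{x}-\overline{x}}{2}(1-\Re z)$ and imaginary parts to $\frac{\overline{x}-\underline{x}}{2}\Im z$. Bernstein ellipses: for $r>1$, $B([-1,1],r)\subset\mathbb{C}$ is the open region bounded by the ellipse with foci $\pm1$ whose semi-axis lengths sum to $r$ (the image of $|z|=r$ under $z\mapsto(z+z^{-1})/2$). $B([\underline{x},\overline{x}],r)=\tau_{[\underline{x},\overline{x}]}(B([-1,1],r))$. The generalized Bernstein ellipse is $B(\mathcal{X},\varrho)=B([\underline{x}_1,\overline{x}_1],\varrho_1)\times\cdots\times B([\underline{x}_D,\overline{x}_D],\varrho_D)\subset\mathbb{C}^D$. *)

theory Defs
  imports "HOL-Analysis.Analysis"
begin

fun cheb_T :: "nat \<Rightarrow> 'a::comm_ring_1 \<Rightarrow> 'a" where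
  "cheb_T 0 x = 1"
| "cheb_T (Suc 0) x = x"
| "cheb_T (Suc (Suc n)) x = 2 * x * cheb_T (Suc n) x - cheb_T n x"

lemma cheb_T_cos: "cheb_T n (cos \<theta>) = cos (real n * \<theta>)"
proof (induction n rule: induct_nat_012)
  case (ge2 n)
  have "cos (real (Suc (Suc n)) * \<theta>) + cos (real n * \<theta>) = 2 * cos \<theta> * cos (real (Suc n) * \<theta>)"
  proof -
    have "cos (real (Suc (Suc n)) * \<theta>) = cos (real (Suc n) * \<theta> + \<theta>)"
      and "cos (real n * \<theta>) = cos (real (Suc n) * \<theta> - \<theta>)"
      by (simp_all add: algebra_simps)
    then show ?thesis
      by (simp only: cos_add cos_diff) simp
  qed
  with ge2 show ?case by simp
qed simp_all

definition cheb_idx :: "('d::finite \<Rightarrow> nat) \<Rightarrow> ('d \<Rightarrow> nat) set" where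
  "cheb_idx N = {j. \<forall>i. j i \<le> N i}"

definition cheb_node :: "('d::finite \<Rightarrow> nat) \<Rightarrow> ('d \<Rightarrow> nat) \<Rightarrow> real ^ 'd" where
  "cheb_node N k = (\<chi> i. cos (pi * real (k i) / real (N i)))"

text \<open>The iterated sums with halved first and last summands are written as one sum over
  multi-indices, with the halving factors collected in a product.\<close>

definition cheb_coeff :: "('d::finite \<Rightarrow> nat) \<Rightarrow> (real ^ 'd \<Rightarrow> real) \<Rightarrow> ('d \<Rightarrow> nat) \<Rightarrow> real" where
  "cheb_coeff N f j =
     (\<Prod>i\<in>UNIV. (if 0 < j i \<and> j i < N i then 2 else 1) / real (N i)) *
     (\<Sum>k\<in>cheb_idx N. (\<Prod>i\<in>UNIV. if k i = 0 \<or> k i = N i then 1 / 2 else 1) *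
        (f (cheb_node N k) * (\<Prod>i\<in>UNIV. cos (real (j i) * pi * (real (k i) / real (N i))))))"

definition cheb_interp_std :: "('d::finite \<Rightarrow> nat) \<Rightarrow> (real ^ 'd \<Rightarrow> real) \<Rightarrow> real ^ 'd \<Rightarrow> real" where
  "cheb_interp_std N f x = (\<Sum>j\<in>cheb_idx N. cheb_coeff N f j * (\<Prod>i\<in>UNIV. cheb_T (j i) (x $ i)))"

definition tau :: "real \<Rightarrow> real \<Rightarrow> 'a::real_algebra_1 \<Rightarrow> 'a" where
  "tau l u z = of_real u + of_real ((l - u) / 2) * (1 - z)"

lemma Re_tau: "Re (tau l u z) = u + (l - u) / 2 * (1 - Re z)"
  and Im_tau: "Im (tau l u z) = (u - l) / 2 * Im z"
  by (simp_all add: tau_def Re_divide_numeral Im_divide_numeral field_simps)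

definition tau_vec :: "real ^ 'd \<Rightarrow> real ^ 'd \<Rightarrow> real ^ 'd \<Rightarrow> real ^ 'd" where
  "tau_vec l u x = (\<chi> i. tau (l $ i) (u $ i) (x $ i))"

definition cheb_interp ::
    "real ^ 'd \<Rightarrow> real ^ 'd \<Rightarrow> ('d::finite \<Rightarrow> nat) \<Rightarrow> (real ^ 'd \<Rightarrow> real) \<Rightarrow> real ^ 'd \<Rightarrow> real" where
  "cheb_interp l u N f = cheb_interp_std N (f \<circ> tau_vec l u) \<circ> inv (tau_vec l u)"

definition bernstein_std :: "real \<Rightarrow> complex set" where
  "bernstein_std r = inside ((\<lambda>z. (z + inverse z) / 2) ` sphere 0 r)"

definition bernstein :: "real \<Rightarrow> real \<Rightarrow> real \<Rightarrow> complex set" where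
  "bernstein l u r = tau l u ` bernstein_std r"

definition gen_bernstein :: "real ^ 'd \<Rightarrow> real ^ 'd \<Rightarrow> real ^ 'd \<Rightarrow> (complex ^ 'd) set" where
  "gen_bernstein l u \<rho> = {z. \<forall>i. z $ i \<in> bernstein (l $ i) (u $ i) (\<rho> $ i)}"

text \<open>Analyticity in several complex variables: around every point of the set, the function
  is the sum of a power series in all variables. Summation over the multi-indices is unordered,
  that is, absolute.\<close>

definition multi_analytic_on :: "(complex ^ 'd::finite \<Rightarrow> complex) \<Rightarrow> (complex ^ 'd) set \<Rightarrow> bool" where
  "multi_analytic_on F S \<longleftrightarrow>
     (\<forall>z\<in>S. \<exists>e>0. \<exists>c :: ('d \<Rightarrow> nat) \<Rightarrow> complex. \<forall>w\<in>ball z e.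
        ((\<lambda>\<alpha>. c \<alpha> * (\<Prod>i\<in>UNIV. (w $ i - z $ i) ^ \<alpha> i)) has_sum F w) UNIV)"

text \<open>The coordinates are indexed by an unordered type \<open>'d\<close> with \<open>D = CARD('d)\<close> elements, so
  the orderings of the coordinates, i.e. the elements of the symmetric group on \<open>D\<close> elements,
  are the bijections from \<open>{1..D}\<close> to \<open>'d\<close> (extensional, which makes this set finite).\<close>

definition coord_orders :: "(nat \<Rightarrow> 'd::finite) set" where
  "coord_orders = {\<sigma> \<in> {1..CARD('d)} \<rightarrow>\<^sub>E UNIV. bij_betw \<sigma> {1..CARD('d)} UNIV}"

definition bound_a :: "real \<Rightarrow> real ^ 'd::finite \<Rightarrow> ('d \<Rightarrow> nat) \<Rightarrow> real" where
  "bound_a V \<rho> N =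
     (MIN \<sigma>\<in>coord_orders.
        (\<Sum>i = 1..CARD('d). 4 * V * (\<rho> $ \<sigma> i powi (- int (N (\<sigma> i))) / (\<rho> $ \<sigma> i - 1))) +
        (\<Sum>k = 2..CARD('d). 4 * V * (\<rho> $ \<sigma> k powi (- int (N (\<sigma> k))) / (\<rho> $ \<sigma> k - 1)) *
           2 ^ (k - 1) * (((real k - 1) + 2 ^ (k - 1) - 1) /
             (\<Prod>j = 1..k - 1. 1 - 1 / (\<rho> $ \<sigma> j)))))"

definition bound_b :: "real \<Rightarrow> real ^ 'd::finite \<Rightarrow> ('d \<Rightarrow> nat) \<Rightarrow> real" where
  "bound_b V \<rho> N =
     2 powr (real CARD('d) / 2 + 1) * V *
     sqrt (\<Sum>i\<in>UNIV. \<rho> $ i powi (- 2 * int (N i)) * (\<Prod>j\<in>UNIV. 1 / (1 - \<rho> $ j powi (- 2))))"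

end

theory Submission
  imports Defs "HOL-Complex_Analysis.Complex_Analysis"
begin

text \<open>
In one variable put \<open>r = \<rho>\<^sup>-\<^sup>2\<close>. The Cauchy formula on an ellipse and the Bessel inequality give
\<open>f(cos \<theta>) = \<Sum> a\<^sub>n cos n\<theta>\<close> with \<open>\<Sum> \<bar>a\<^sub>n\<bar>\<^sup>2 r\<^sup>-\<^sup>n \<le> 4 V\<^sup>2\<close> (up to the constant term), so by
Cauchy-Schwarz the interpolation error is controlled by the weighted square sum of
\<open>cos n\<theta> - cos n'\<theta>\<close>, \<open>n'\<close> the frequency to which \<open>n\<close> is aliased. This sum satisfies a recursion
in steps of \<open>2N\<close>, can be evaluated in closed form, and yields the error bound
\<open>4 V (r\<^sup>N\<^sup>+\<^sup>1 / (1 - r\<^sup>2))\<^sup>1\<^sup>/\<^sup>2\<close> when \<open>r\<^sup>N \<le> 1/2\<close>; for larger \<open>r\<^sup>N\<close> the same bound follows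
from the Lebesgue constant, whose square is at most \<open>N + 1/12\<close> for \<open>N \<ge> 2\<close>. Comparing the Lebesgue constant with
one plus the error bound shows that the interpolation operator has norm at most
\<open>A = (2 / (1 - r))\<^sup>1\<^sup>/\<^sup>2\<close> on functions bounded on the ellipse.

In several variables the error telescopes into \<open>\<Sum>\<^sub>k e\<^sub>k \<Prod>\<^sub>j\<^sub><\<^sub>k A\<^sub>j\<close> for any order of the coordinates.
Crude estimates of \<open>e\<^sub>k\<close> and \<open>A\<^sub>j\<close> give the first bound. For the second one,
\<open>e\<^sub>k\<^sup>2 \<le> 4 V\<^sup>2 r\<^sub>k\<^sup>N (A\<^sub>k\<^sup>2 - 1)\<close>, and after Cauchy-Schwarz the sum
\<open>\<Sum>\<^sub>k (A\<^sub>k\<^sup>2 - 1) \<Prod>\<^sub>j\<^sub><\<^sub>k A\<^sub>j\<^sup>2\<close> telescopes to \<open>\<Prod> A\<^sub>j\<^sup>2 - 1\<close>.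
\<close>

section \<open>Fourier coefficients and the Bessel inequality\<close>

text \<open>The second bound dictates the constants. It equals 2V (\<Sum> r_i^N_i)^(1/2) (\<Prod>
  2/(1 - r_j))^(1/2), so each coordinate may contribute at most a factor 2/(1 - r) to the square,
  independently of N, and the error has to stay of order (1 - r)^(-1/2) as r tends to 1. Summing
  absolute values of coefficients would lose a further factor of that size, hence the square sums.
  The norm A cannot be read off the Lebesgue constant alone, which grows like log N, nor off one
  plus the error, which is too large when N is small compared with 1/(1 - r). The former serves up
  to about N = 2/(1 - r), the latter beyond, and near the crossover both must be fairly sharp; this
  is why corrections such as pi/12 and 1/12 are carried along. Measuring functions on the ellipse
  instead of [-1,1] is compatible with tensorization because the coordinates that are not
  interpolated may stay complex.\<close>

definition unit_exp :: "int \<Rightarrow> real \<Rightarrow> complex" where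
  "unit_exp k t = exp (of_real (2 * pi * of_int k * t) * \<i>)"

lemma unit_exp_add: "unit_exp j t * unit_exp k t = unit_exp (j + k) t"
  by (simp add: unit_exp_def algebra_simps flip: exp_add)

lemma unit_exp_0 [simp]: "unit_exp 0 t = 1"
  by (simp add: unit_exp_def)

lemma norm_unit_exp [simp]: "norm (unit_exp k t) = 1"
  by (simp add: unit_exp_def)

lemma cnj_unit_exp: "cnj (unit_exp k t) = unit_exp (- k) t"
  by (simp add: unit_exp_def exp_cnj)

lemma unit_exp_nonzero [simp]: "unit_exp k t \<noteq> 0"
  by (simp add: unit_exp_def)

lemma unit_exp_power: "unit_exp k t ^ n = unit_exp (int n * k) t"
  by (simp add: unit_exp_def algebra_simps flip: exp_of_nat_mult)

lemma continuous_on_unit_exp [continuous_intros]: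
  "continuous_on A f \<Longrightarrow> continuous_on A (\<lambda>t. unit_exp k (f t))"
  unfolding unit_exp_def by (intro continuous_intros)

lemma unit_exp_has_vector_derivative:
  "(unit_exp k has_vector_derivative (2 * pi * of_int k * \<i>) * unit_exp k t) (at t within A)"
proof -
  have "((\<lambda>z. exp (2 * pi * of_int k * \<i> * z)) has_field_derivative
      (2 * pi * of_int k * \<i>) * unit_exp k t) (at (of_real t))"
    by (auto intro!: derivative_eq_intros simp: unit_exp_def mult_ac)
  from has_vector_derivative_real_field[OF this] show ?thesis
    by (simp add: unit_exp_def[abs_def] mult_ac)
qed

lemma unit_exp_has_integral:
  "(unit_exp k has_integral (if k = 0 then 1 else 0)) {0..1}"
proof (cases "k = 0")
  case True
  then show ?thesis
    using has_integral_const_real[of "1::complex" 0 1] by (simp add: unit_exp_def[abs_def])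
next
  case False
  have "((\<lambda>t. (2 * pi * of_int k * \<i>) * unit_exp k t) has_integral (unit_exp k 1 - unit_exp k 0)) {0..1}"
    by (intro fundamental_theorem_of_calculus unit_exp_has_vector_derivative) simp
  moreover have "unit_exp k 1 = unit_exp k 0"
    unfolding unit_exp_def using exp_2pi_1_int[of k] by (simp add: mult_ac)
  ultimately have "((\<lambda>t. (2 * pi * of_int k * \<i>) * unit_exp k t) has_integral 0) {0..1}"
    by simp
  from has_integral_mult_right[OF this, of "1 / (2 * pi * of_int k * \<i>)"] False
  show ?thesis by (simp add: field_simps)
qed

definition fourier_coeff :: "(real \<Rightarrow> complex) \<Rightarrow> nat \<Rightarrow> complex" where
  "fourier_coeff \<phi> n = integral {0..1} (\<lambda>t. \<phi> t * unit_exp (- int n) t)"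

text \<open>The integral of |\<phi> - S|^2 over a period is nonnegative, where S is the partial sum
  with the coefficients of \<phi>. Here |S|^2 integrates to Q and the cross term to 2Q, so Q is at
  most the mean of |\<phi>|^2.\<close>

lemma bessel_inequality:
  assumes cont: "continuous_on {0..1} \<phi>" and bound: "\<And>t. t \<in> {0..1} \<Longrightarrow> norm (\<phi> t) \<le> V"
  shows "(\<Sum>n<m. (norm (fourier_coeff \<phi> n))\<^sup>2) \<le> V\<^sup>2"
proof -
  define c where "c = fourier_coeff \<phi>"
  define S where "S t = (\<Sum>n<m. c n * unit_exp (int n) t)" for t
  define Q where "Q = (\<Sum>n<m. (norm (c n))\<^sup>2)"
  have coeff: "((\<lambda>t. \<phi> t * unit_exp (- int n) t) has_integral c n) {0..1}" for n
    unfolding c_def fourier_coeff_def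
    by (intro integrable_integral integrable_continuous_real continuous_intros cont)
  have c1: "((\<lambda>t. cnj (S t) * \<phi> t) has_integral of_real Q) {0..1}"
  proof -
    have "((\<lambda>t. \<Sum>n<m. cnj (c n) * (\<phi> t * unit_exp (- int n) t)) has_integral (\<Sum>n<m. cnj (c n) * c n)) {0..1}"
      by (intro has_integral_sum has_integral_mult_right coeff) simp
    moreover have "(\<Sum>n<m. cnj (c n) * c n) = of_real Q"
      by (simp add: Q_def complex_norm_square mult.commute del: of_real_power)
    ultimately show ?thesis
      by (simp add: S_def cnj_unit_exp sum_distrib_left sum_distrib_right mult_ac)
  qed
  have c2: "((\<lambda>t. S t * cnj (S t)) has_integral of_real Q) {0..1}"
  proof -
    have "((\<lambda>t. \<Sum>j<m. \<Sum>k<m. (c j * cnj (c k)) * unit_exp (int j - int k) t) has_integral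
        (\<Sum>j<m. \<Sum>k<m. (c j * cnj (c k)) * (if int j - int k = 0 then 1 else 0))) {0..1}"
      by (intro has_integral_sum has_integral_mult_right unit_exp_has_integral) simp_all
    moreover have "(\<Sum>j<m. \<Sum>k<m. (c j * cnj (c k)) * (if int j - int k = 0 then 1 else 0)) = of_real Q"
      by (simp add: Q_def complex_norm_square del: of_real_power add: if_distrib[of "\<lambda>x. _ * x"] sum.delta cong: if_cong)
    moreover have "S t * cnj (S t) = (\<Sum>j<m. \<Sum>k<m. (c j * cnj (c k)) * unit_exp (int j - int k) t)" for t
      by (simp add: S_def cnj_unit_exp sum_product unit_exp_add mult_ac flip: unit_exp_add[of "int _" _ "- int _", simplified])
    ultimately show ?thesis by simp
  qed
  have contS: "continuous_on {0..1} S"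
    unfolding S_def by (intro continuous_intros)
  have ip: "((\<lambda>t. (norm (\<phi> t))\<^sup>2) has_integral integral {0..1} (\<lambda>t. (norm (\<phi> t))\<^sup>2)) {0..1}"
    by (intro integrable_integral integrable_continuous_real continuous_intros cont)
  have "((\<lambda>t. (norm (\<phi> t))\<^sup>2 - 2 * Re (cnj (S t) * \<phi> t) + Re (S t * cnj (S t))) has_integral
      (integral {0..1} (\<lambda>t. (norm (\<phi> t))\<^sup>2) - 2 * Re (of_real Q) + Re (of_real Q))) {0..1}"
    by (intro has_integral_add has_integral_diff ip has_integral_mult_right
        has_integral_linear[OF c1 bounded_linear_Re, unfolded o_def]
        has_integral_linear[OF c2 bounded_linear_Re, unfolded o_def])
  moreover have "(norm (\<phi> t))\<^sup>2 - 2 * Re (cnj (S t) * \<phi> t) + Re (S t * cnj (S t)) = (norm (\<phi> t - S t))\<^sup>2" for t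
    unfolding cmod_power2 by (simp add: power2_eq_square algebra_simps)
  ultimately have "((\<lambda>t. (norm (\<phi> t - S t))\<^sup>2) has_integral
      (integral {0..1} (\<lambda>t. (norm (\<phi> t))\<^sup>2) - 2 * Re (of_real Q) + Re (of_real Q))) {0..1}"
    by (simp only:)
  from has_integral_nonneg[OF this] have "0 \<le> integral {0..1} (\<lambda>t. (norm (\<phi> t))\<^sup>2) - Q"
    by simp
  moreover have "integral {0..1} (\<lambda>t. (norm (\<phi> t))\<^sup>2) \<le> integral {0..1} (\<lambda>t::real. V\<^sup>2)"
    using ip bound by (intro integral_le) (auto intro!: power_mono)
  ultimately show ?thesis by (simp add: Q_def c_def)
qed

section \<open>Chebyshev series from the Cauchy integral formula\<close>

definition cheb_weight :: "nat \<Rightarrow> real" where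
  "cheb_weight n = (if n = 0 then 1 else 2)"

text \<open>With a = w e^(i \<theta>) and b = w e^(-i \<theta>) the terms are a^n + b^n, so two
  geometric series are added; the term n = 0 would be counted twice, which
  \<open>cheb_weight\<close> corrects.\<close>

lemma cheb_generating_function:
  fixes w :: complex
  assumes "norm w < 1"
  shows "1 - 2 * w * cos (of_real \<theta>) + w\<^sup>2 \<noteq> 0"
    and "(\<lambda>n. of_real (cheb_weight n * cos (real n * \<theta>)) * w ^ n) sums
      ((1 - w\<^sup>2) / (1 - 2 * w * cos (of_real \<theta>) + w\<^sup>2))"
proof -
  define a b where "a = w * cis \<theta>" and "b = w * cis (- \<theta>)"
  have na: "norm a < 1" and nb: "norm b < 1"
    using assms by (simp_all add: a_def b_def norm_mult)
  have ab: "a * b = w\<^sup>2"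
    by (simp add: a_def b_def power2_eq_square cis_mult mult_ac) 
  have apb: "a + b = 2 * w * cos (of_real \<theta>)"
    by (simp add: a_def b_def complex_eq_iff cos_of_real)
  have den: "1 - 2 * w * cos (of_real \<theta>) + w\<^sup>2 = (1 - a) * (1 - b)"
    unfolding ab[symmetric] apb[symmetric] by (simp add: algebra_simps)
  have ne: "1 - a \<noteq> 0" "1 - b \<noteq> 0"
    using na nb by auto
  show "1 - 2 * w * cos (of_real \<theta>) + w\<^sup>2 \<noteq> 0"
    using ne by (simp add: den)
  have "(\<lambda>n. a ^ n + b ^ n - (if n = 0 then 1 else 0)) sums (1 / (1 - a) + 1 / (1 - b) - 1)"
    by (intro sums_diff sums_add geometric_sums na nb) (use sums_single[of 0 "\<lambda>_. 1::complex"] in simp)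
  also have "1 / (1 - a) + 1 / (1 - b) - 1 = (1 - w\<^sup>2) / (1 - 2 * w * cos (of_real \<theta>) + w\<^sup>2)"
  proof -
    have "1 / (1 - a) + 1 / (1 - b) - 1 = (1 - a * b) / ((1 - a) * (1 - b))"
    proof -
      have *: "1 / A + 1 / B - 1 = (B + A - A * B) / (A * B)" if "A \<noteq> 0" "B \<noteq> 0" for A B :: complex
        using that by (simp add: field_simps)
      have h: "(1 - b) + (1 - a) - (1 - a) * (1 - b) = 1 - a * b"
        by (simp add: algebra_simps)
      show ?thesis
        using *[OF ne] unfolding h .
    qed
    then show ?thesis by (simp only: den ab)
  qed
  also have "(\<lambda>n. a ^ n + b ^ n - (if n = 0 then 1 else 0)) =
      (\<lambda>n. of_real (cheb_weight n * cos (real n * \<theta>)) * w ^ n)"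
  proof
    fix n
    show "a ^ n + b ^ n - (if n = 0 then 1 else 0) = of_real (cheb_weight n * cos (real n * \<theta>)) * w ^ n"
    proof (cases "n = 0")
      case False
      have "a ^ n + b ^ n = (cis (real n * \<theta>) + cis (- (real n * \<theta>))) * w ^ n"
        by (simp add: a_def b_def power_mult_distrib Complex.DeMoivre algebra_simps)
      also have "cis (real n * \<theta>) + cis (- (real n * \<theta>)) = of_real (2 * cos (real n * \<theta>))"
        by (simp add: complex_eq_iff)
      finally show ?thesis using False by (simp add: cheb_weight_def)
    qed (simp add: cheb_weight_def)
  qed
  finally show "(\<lambda>n. of_real (cheb_weight n * cos (real n * \<theta>)) * w ^ n) sums
      ((1 - w\<^sup>2) / (1 - 2 * w * cos (of_real \<theta>) + w\<^sup>2))" .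
qed

text \<open>The power w^n of the generating function is a character divided by R^n, so it extracts
  the n-th Fourier coefficient. Since |w| = 1/R < 1, the expansion converges uniformly in t and may
  be integrated termwise.\<close>

lemma fourier_coeff_series:
  fixes R \<theta> :: real
  assumes cont: "continuous_on {0..1} \<phi>" and R: "R > 1"
  defines "w \<equiv> \<lambda>t. unit_exp (- 1) t / of_real R"
  shows "(\<lambda>n. of_real (cheb_weight n * cos (real n * \<theta>) / R ^ n) * fourier_coeff \<phi> n) sums
    integral {0..1} (\<lambda>t. \<phi> t * ((1 - (w t)\<^sup>2) / (1 - 2 * w t * cos (of_real \<theta>) + (w t)\<^sup>2)))"
proof -
  have "compact (\<phi> ` {0..1})"
    by (intro compact_continuous_image cont) simp
  then obtain B where B: "norm (\<phi> t) \<le> B" if "t \<in> {0..1}" for t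
    by (meson bounded_iff compact_imp_bounded imageI)
  then have B0: "0 \<le> B"
    by (meson atLeastAtMost_iff norm_ge_zero order_trans zero_le_one order_refl)
  define F where "F n t = \<phi> t * (of_real (cheb_weight n * cos (real n * \<theta>)) * w t ^ n)" for n t
  have nw: "norm (w t) < 1" for t
    using R by (simp add: w_def norm_divide)
  have Fsums: "(\<lambda>n. F n t) sums (\<phi> t * ((1 - (w t)\<^sup>2) / (1 - 2 * w t * cos (of_real \<theta>) + (w t)\<^sup>2)))" for t
    unfolding F_def by (intro sums_mult cheb_generating_function nw)
  have ul: "uniform_limit {0..1} (\<lambda>m t. \<Sum>n<m. F n t) (\<lambda>t. suminf (\<lambda>n. F n t)) sequentially"
  proof (rule Weierstrass_m_test)
    show "norm (F n t) \<le> B * (2 * (1 / R) ^ n)" if "t \<in> {0..1}" for n t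
    proof -
      have "norm (F n t) = norm (\<phi> t) * (\<bar>cheb_weight n\<bar> * \<bar>cos (real n * \<theta>)\<bar> * (1 / R) ^ n)"
        using R by (simp add: F_def w_def norm_mult norm_power norm_divide abs_mult)
      also have "\<dots> \<le> B * ((2 * 1) * (1 / R) ^ n)"
        using R B[OF that] B0 by (intro mult_mono) (auto simp: cheb_weight_def)
      finally show ?thesis by simp
    qed
    show "summable (\<lambda>n. B * (2 * (1 / R) ^ n))"
      using R by (intro summable_mult summable_geometric) auto
  qed
  have cF: "continuous_on {0..1} (\<lambda>t. \<Sum>n<m. F n t)" for m
    unfolding F_def w_def using R by (intro continuous_intros cont) auto
  obtain I L where I: "\<And>m. ((\<lambda>t. \<Sum>n<m. F n t) has_integral I m) {0..1}"
      and L: "((\<lambda>t. suminf (\<lambda>n. F n t)) has_integral L) {0..1}" and lim: "I \<longlonglongrightarrow> L"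
    using uniform_limit_integral[OF ul cF sequentially_bot] by blast
  have I_eq: "I m = (\<Sum>n<m. of_real (cheb_weight n * cos (real n * \<theta>) / R ^ n) * fourier_coeff \<phi> n)" for m
  proof (rule has_integral_unique[OF I])
    have "((\<lambda>t. \<phi> t * unit_exp (- int n) t) has_integral fourier_coeff \<phi> n) {0..1}" for n
      unfolding fourier_coeff_def
      by (intro integrable_integral integrable_continuous_real continuous_intros cont)
    then have "((\<lambda>t. \<Sum>n<m. of_real (cheb_weight n * cos (real n * \<theta>) / R ^ n) * (\<phi> t * unit_exp (- int n) t))
        has_integral (\<Sum>n<m. of_real (cheb_weight n * cos (real n * \<theta>) / R ^ n) * fourier_coeff \<phi> n)) {0..1}"
      by (intro has_integral_sum has_integral_mult_right) auto
    moreover have "of_real (cheb_weight n * cos (real n * \<theta>) / R ^ n) * (\<phi> t * unit_exp (- int n) t) = F n t" for n t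
      using R by (simp add: F_def w_def power_divide unit_exp_power)
    ultimately show "((\<lambda>t. \<Sum>n<m. F n t) has_integral
        (\<Sum>n<m. of_real (cheb_weight n * cos (real n * \<theta>) / R ^ n) * fourier_coeff \<phi> n)) {0..1}"
      by simp
  qed
  have L_eq: "L = integral {0..1} (\<lambda>t. \<phi> t * ((1 - (w t)\<^sup>2) / (1 - 2 * w t * cos (of_real \<theta>) + (w t)\<^sup>2)))"
    using integral_unique[OF L] sums_unique[OF Fsums] by simp
  show ?thesis
    using lim unfolding sums_def L_eq I_eq[abs_def, symmetric] by simp
qed

section \<open>The Cauchy kernel on a confocal ellipse\<close>

definition ellipse_path :: "real \<Rightarrow> real \<Rightarrow> complex" where
  "ellipse_path R t = (of_real R * unit_exp 1 t + unit_exp (- 1) t / of_real R) / 2"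

lemma ellipse_path_has_vector_derivative:
  "(ellipse_path R has_vector_derivative
     2 * pi * \<i> * ((of_real R * unit_exp 1 t - unit_exp (- 1) t / of_real R) / 2)) (at t within A)"
proof -
  have "((\<lambda>t. (of_real R / 2) * unit_exp 1 t + (1 / (2 * of_real R)) * unit_exp (- 1) t) has_vector_derivative
      (of_real R / 2) * ((2 * pi * of_int 1 * \<i>) * unit_exp 1 t) +
      (1 / (2 * of_real R)) * ((2 * pi * of_int (- 1) * \<i>) * unit_exp (- 1) t)) (at t within A)"
    by (intro has_vector_derivative_add has_vector_derivative_mult_right unit_exp_has_vector_derivative)
  moreover have "(\<lambda>t. (of_real R / 2) * unit_exp 1 t + (1 / (2 * of_real R)) * unit_exp (- 1) t) = ellipse_path R"
    by (simp add: ellipse_path_def fun_eq_iff add_divide_distrib)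
  moreover have "(of_real R / 2) * ((2 * pi * of_int 1 * \<i>) * unit_exp 1 t) +
      (1 / (2 * of_real R)) * ((2 * pi * of_int (- 1) * \<i>) * unit_exp (- 1) t) =
      2 * pi * \<i> * ((of_real R * unit_exp 1 t - unit_exp (- 1) t / of_real R) / 2)"
    by (simp add: diff_divide_distrib right_diff_distrib mult_ac)
  ultimately show ?thesis
    by simp
qed

lemma continuous_on_ellipse_path [continuous_intros]:
  "R \<noteq> 0 \<Longrightarrow> continuous_on A (ellipse_path R)"
  unfolding ellipse_path_def[abs_def] by (intro continuous_intros) auto

lemma valid_path_ellipse_path:
  assumes "R \<noteq> 0" shows "valid_path (ellipse_path R)"
proof -
  have "continuous_on {0..1}
      (\<lambda>t. 2 * pi * \<i> * ((of_real R * unit_exp 1 t - unit_exp (- 1) t / of_real R) / 2))"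
    using assms by (intro continuous_intros) auto
  then show ?thesis
    unfolding valid_path_def
    by (intro C1_differentiable_imp_piecewise)
      (auto simp: C1_differentiable_on_def intro!: ellipse_path_has_vector_derivative
        exI[of _ "\<lambda>t. 2 * pi * \<i> * ((of_real R * unit_exp 1 t - unit_exp (- 1) t / of_real R) / 2)"])
qed

text \<open>The point on the ellipse is (z + w)/2 with z = R e^(2 pi i t) and w = 1/z. In this
  parametrization the Cauchy kernel is 2 pi i times the generating function of the Chebyshev
  polynomials, which is why Cauchy's formula yields a Chebyshev series.\<close>

lemma cauchy_kernel_ellipse:
  fixes R \<theta> t :: real
  assumes R: "R > 1"
  defines "w \<equiv> unit_exp (- 1) t / of_real R"
  shows "ellipse_path R t \<noteq> cos (of_real \<theta>)"
    and "vector_derivative (ellipse_path R) (at t) / (ellipse_path R t - cos (of_real \<theta>)) =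
      2 * pi * \<i> * ((1 - w\<^sup>2) / (1 - 2 * w * cos (of_real \<theta>) + w\<^sup>2))"
proof -
  define z where "z = of_real R * unit_exp 1 t"
  have z: "z \<noteq> 0" and zw: "z * w = 1"
    using R by (auto simp: z_def w_def unit_exp_add)
  have nw: "norm w < 1"
    using R by (simp add: w_def norm_divide)
  note d = cheb_generating_function(1)[OF nw, of \<theta>]
  have e: "ellipse_path R t = (z + w) / 2"
    by (simp add: ellipse_path_def z_def w_def)
  have zww: "z * w\<^sup>2 = w" using zw by (simp add: power2_eq_square flip: mult.assoc)
  have diff: "ellipse_path R t - cos (of_real \<theta>) = z / 2 * (1 - 2 * w * cos (of_real \<theta>) + w\<^sup>2)"
    using zw zww by (simp add: e field_simps)
  show "ellipse_path R t \<noteq> cos (of_real \<theta>)"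
    using diff z d by auto
  have num: "z - w = z * (1 - w\<^sup>2)"
    using zww by (simp add: algebra_simps)
  have vd: "vector_derivative (ellipse_path R) (at t) = 2 * pi * \<i> * ((z - w) / 2)"
    unfolding z_def w_def by (intro vector_derivative_at ellipse_path_has_vector_derivative)
  have "c * (z * p / 2) / (z / 2 * D) = c * (p / D)" for c p D
    using z by (cases "D = 0") (simp_all add: field_simps)
  then show "vector_derivative (ellipse_path R) (at t) / (ellipse_path R t - cos (of_real \<theta>)) =
      2 * pi * \<i> * ((1 - w\<^sup>2) / (1 - 2 * w * cos (of_real \<theta>) + w\<^sup>2))"
    unfolding vd diff num by simp
qed

lemma fourier_coeff_1: "fourier_coeff (\<lambda>_. 1) n = (if n = 0 then 1 else 0)"
  using integral_unique[OF unit_exp_has_integral[of "- int n"]] by (simp add: fourier_coeff_def)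

lemma chebyshev_series:
  fixes R \<theta> :: real
  assumes S: "open S" "convex S" and g: "g holomorphic_on S" and R: "R > 1"
    and path: "\<And>t. ellipse_path R t \<in> S" and x: "cos (of_real \<theta>) \<in> S"
  shows "(\<lambda>n. of_real (cheb_weight n * cos (real n * \<theta>) / R ^ n) *
      fourier_coeff (\<lambda>t. g (ellipse_path R t)) n) sums g (cos (of_real \<theta>))"
proof -
  define w where "w = (\<lambda>t. unit_exp (- 1) t / of_real R)"
  define \<kappa> where "\<kappa> t = (1 - (w t)\<^sup>2) / (1 - 2 * w t * cos (of_real \<theta>) + (w t)\<^sup>2)" for t
  have cauchy: "integral {0..1} (\<lambda>t. h (ellipse_path R t) * \<kappa> t) =
      winding_number (ellipse_path R) (cos (of_real \<theta>)) * h (cos (of_real \<theta>))"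
    if h: "h holomorphic_on S" for h
  proof -
    have "((\<lambda>z. h z / (z - cos (of_real \<theta>))) has_contour_integral
        (2 * pi * \<i> * winding_number (ellipse_path R) (cos (of_real \<theta>)) * h (cos (of_real \<theta>)))) (ellipse_path R)"
      using S R path x cauchy_kernel_ellipse(1)[OF R]
      by (intro Cauchy_integral_formula_convex_simple[OF S(2) h] valid_path_ellipse_path)
        (auto simp: interior_open path_image_def pathfinish_def pathstart_def ellipse_path_def
          unit_exp_def exp_minus)
    then have "((\<lambda>t. h (ellipse_path R t) / (ellipse_path R t - cos (of_real \<theta>)) *
          vector_derivative (ellipse_path R) (at t)) has_integral
        (2 * pi * \<i> * winding_number (ellipse_path R) (cos (of_real \<theta>)) * h (cos (of_real \<theta>)))) {0..1}"
      by (simp add: has_contour_integral)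
    moreover have "h (ellipse_path R t) / (ellipse_path R t - cos (of_real \<theta>)) *
          vector_derivative (ellipse_path R) (at t) = (2 * pi * \<i>) * (h (ellipse_path R t) * \<kappa> t)" for t
    proof -
      have "h (ellipse_path R t) / (ellipse_path R t - cos (of_real \<theta>)) *
          vector_derivative (ellipse_path R) (at t) = h (ellipse_path R t) *
          (vector_derivative (ellipse_path R) (at t) / (ellipse_path R t - cos (of_real \<theta>)))"
        by simp
      also have "\<dots> = (2 * pi * \<i>) * (h (ellipse_path R t) * \<kappa> t)"
        unfolding cauchy_kernel_ellipse(2)[OF R] by (simp only: \<kappa>_def w_def mult_ac)
      finally show ?thesis .
    qed
    ultimately have "((\<lambda>t. (2 * pi * \<i>) * (h (ellipse_path R t) * \<kappa> t)) has_integral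
        (2 * pi * \<i> * winding_number (ellipse_path R) (cos (of_real \<theta>)) * h (cos (of_real \<theta>)))) {0..1}"
      by simp
    from has_integral_mult_right[OF this, of "1 / (2 * pi * \<i>)"] show ?thesis
      by (intro integral_unique) (simp add: field_simps)
  qed
  \<comment> \<open>The winding number is not found geometrically: for the constant 1 the kernel
    integral is known from the Fourier coefficients, and Cauchy's formula for the same function
    identifies it with the winding number.\<close>
  have "(\<lambda>n. of_real (cheb_weight n * cos (real n * \<theta>) / R ^ n) * fourier_coeff (\<lambda>_. 1) n) sums
      integral {0..1} (\<lambda>t. 1 * \<kappa> t)"
    unfolding \<kappa>_def w_def by (rule fourier_coeff_series[OF _ R]) simp
  moreover have "(\<lambda>n. of_real (cheb_weight n * cos (real n * \<theta>) / R ^ n) * fourier_coeff (\<lambda>_. 1) n) =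
      (\<lambda>n. if n = 0 then 1 else 0)"
    by (auto simp: fourier_coeff_1 cheb_weight_def)
  ultimately have "integral {0..1} (\<lambda>t. 1 * \<kappa> t) = 1"
    using sums_single[of 0 "\<lambda>_. 1::complex"] sums_unique2 by fastforce
  with cauchy[of "\<lambda>_. 1"] have "winding_number (ellipse_path R) (cos (of_real \<theta>)) = 1"
    by simp
  with cauchy[OF g] have "g (cos (of_real \<theta>)) = integral {0..1} (\<lambda>t. g (ellipse_path R t) * \<kappa> t)"
    by simp
  moreover have "continuous_on {0..1} (\<lambda>t. g (ellipse_path R t))"
    using R path
    by (intro continuous_on_compose2[OF holomorphic_on_imp_continuous_on[OF g]] continuous_intros) auto
  ultimately show ?thesis
    unfolding \<kappa>_def w_def using fourier_coeff_series[OF _ R] by simp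
qed

section \<open>Geometry of the Bernstein ellipse\<close>

lemma linear_Complex_scale: "linear (\<lambda>z. Complex (a * Re z) (b * Im z))"
  by (rule linearI) (auto simp: complex_eq_iff algebra_simps)

text \<open>The image of the sphere is the frontier of a bounded convex set, the image of the closed
  ball, and the inside of such a frontier is the interior.\<close>

lemma inside_linear_image_sphere:
  fixes L :: "complex \<Rightarrow> complex"
  assumes L: "linear L" "inj L"
  shows "inside (L ` sphere 0 1) = L ` ball 0 1"
proof -
  have surj: "surj L"
    using L by (simp add: linear_injective_imp_surjective)
  have fr: "frontier (L ` cball 0 1) = L ` sphere 0 1"
  proof -
    have "L ` sphere 0 1 = L ` cball 0 1 - L ` ball 0 1"
      using L(2) by (simp add: image_set_diff[symmetric] cball_diff_sphere sphere_def) auto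
    moreover have "closure (L ` cball 0 1) = L ` cball 0 1"
      using closure_injective_linear_image[OF L, of "cball 0 1"] by simp
    moreover have "interior (L ` cball 0 1) = L ` ball 0 1"
      using interior_injective_linear_image[OF L, of "cball 0 1"] by simp
    ultimately show ?thesis by (simp add: frontier_def)
  qed
  have "inside (frontier (L ` cball 0 1)) = interior (L ` cball 0 1)"
    using L by (intro inside_frontier_eq_interior convex_linear_image bounded_linear_image)
      (auto simp: linear_conv_bounded_linear)
  then show ?thesis
    using interior_injective_linear_image[OF L, of "cball 0 1"] by (simp add: fr)
qed

text \<open>On |z| = r the map z + 1/z agrees with a real-linear one, because the inverse of a
  number of modulus one is its conjugate. So the ellipse is a linear image of the unit circle, from
  which convexity and an explicit membership condition follow.\<close>

lemma bernstein_std_eq: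
  assumes r: "r > 1"
  shows "bernstein_std r =
    (\<lambda>z. Complex ((r + 1 / r) / 2 * Re z) ((r - 1 / r) / 2 * Im z)) ` ball 0 1"
proof -
  define L where "L z = Complex ((r + 1 / r) / 2 * Re z) ((r - 1 / r) / 2 * Im z)" for z
  have pos: "r + 1 / r > 0" "r - 1 / r > 0"
    using r by (auto simp: field_simps intro: add_pos_pos) (smt (verit) mult_le_cancel_left1)
  have lin: "linear L"
    unfolding L_def by (rule linear_Complex_scale)
  have "inj L"
    using pos by (auto simp: inj_def L_def complex_eq_iff)
  have "(\<lambda>z. (z + inverse z) / 2) ` sphere 0 r = L ` sphere 0 1"
  proof -
    have "sphere 0 r = (\<lambda>z. of_real r * z) ` sphere (0::complex) 1"
    proof (intro equalityI subsetI)
      fix z :: complex assume "z \<in> sphere 0 r"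
      then have "z = of_real r * (z / of_real r)" "z / of_real r \<in> sphere 0 1"
        using r by (auto simp: norm_divide)
      then show "z \<in> (\<lambda>z. of_real r * z) ` sphere 0 1" by (rule image_eqI)
    qed (use r in \<open>auto simp: norm_mult\<close>)
    moreover have "(of_real r * z + inverse (of_real r * z)) / 2 = L z" if "norm z = 1" for z
    proof -
      have "inverse z = cnj z"
        using that complex_div_cnj[of 1 z] by (simp add: inverse_eq_divide)
      then have "inverse (of_real r * z) = of_real (1 / r) * cnj z"
        by (simp only: inverse_mult_distrib) (simp add: inverse_eq_divide)
      then have "(of_real r * z + inverse (of_real r * z)) / 2 = (of_real r * z + of_real (1 / r) * cnj z) / 2"
        by (simp only:)
      also have "\<dots> = L z"
        by (simp add: L_def complex_eq_iff distrib_right diff_divide_distrib add_divide_distrib left_diff_distrib)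
      finally show ?thesis .
    qed
    ultimately show ?thesis by (force simp: image_image)
  qed
  then show ?thesis
    using inside_linear_image_sphere[OF lin \<open>inj L\<close>] by (simp add: bernstein_std_def L_def)
qed

lemma bernstein_std_iff:
  assumes r: "r > 1"
  shows "z \<in> bernstein_std r \<longleftrightarrow> (Re z / ((r + 1 / r) / 2))\<^sup>2 + (Im z / ((r - 1 / r) / 2))\<^sup>2 < 1"
proof -
  define a b where "a = (r + 1 / r) / 2" and "b = (r - 1 / r) / 2"
  have pos: "a > 0" "b > 0"
    using r by (auto simp: a_def b_def field_simps intro: add_pos_pos) (smt (verit) mult_le_cancel_left1)
  have "z \<in> bernstein_std r \<longleftrightarrow> Complex (Re z / a) (Im z / b) \<in> ball 0 1"
    unfolding bernstein_std_eq[OF r] a_def[symmetric] b_def[symmetric] image_iff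
    using pos by (auto simp: complex_eq_iff intro!: bexI[of _ "Complex (Re z / a) (Im z / b)"])
  also have "\<dots> \<longleftrightarrow> (Re z / a)\<^sup>2 + (Im z / b)\<^sup>2 < 1"
    by (simp add: cmod_def real_sqrt_lt_1_iff)
  finally show ?thesis by (simp add: a_def b_def)
qed

lemma open_bernstein_std: "r > 1 \<Longrightarrow> open (bernstein_std r)"
  unfolding bernstein_std_def
  by (intro open_inside compact_imp_closed compact_continuous_image continuous_intros) auto

lemma convex_bernstein_std:
  assumes "r > 1"
  shows "convex (bernstein_std r)"
  unfolding bernstein_std_eq[OF assms]
  by (intro convex_linear_image convex_ball linear_Complex_scale)

lemma of_real_mem_bernstein_std:
  assumes "r > 1" "\<bar>x\<bar> \<le> 1"
  shows "of_real x \<in> bernstein_std r"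
proof -
  have "0 < (r - 1)\<^sup>2" using assms by simp
  then have "1 < (r + 1 / r) / 2"
    using assms by (simp add: field_simps power2_eq_square)
  then have "\<bar>x / ((r + 1 / r) / 2)\<bar> < 1"
    using assms by (simp add: abs_divide)
  then show ?thesis
    unfolding bernstein_std_iff[OF assms(1)] by (simp add: abs_square_less_1)
qed

lemma unit_exp_eq_cis: "unit_exp k t = cis (2 * pi * of_int k * t)"
  by (simp add: unit_exp_def cis_conv_exp mult.commute)

lemma ellipse_path_mem_bernstein_std:
  assumes "1 < R" "R < r"
  shows "ellipse_path R t \<in> bernstein_std r"
proof -
  define a b where "a = (r + 1 / r) / 2" and "b = (r - 1 / r) / 2"
  define A B where "A = (R + 1 / R) / 2" and "B = (R - 1 / R) / 2"
  define c s where "c = cos (2 * pi * t)" and "s = sin (2 * pi * t)"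
  have "ellipse_path R t = Complex (A * c) (B * s)"
    using assms by (simp add: ellipse_path_def A_def B_def c_def s_def complex_eq_iff unit_exp_eq_cis field_simps)
  have "1 / r < 1 / R" using assms by (simp add: field_simps)
  moreover have "1 / R < 1" using assms by simp
  ultimately have "0 < R - 1 / R" "R - 1 / R < r - 1 / r"
    using assms by linarith+
  then have "0 < B" "B < b"
    by (simp_all add: B_def b_def)
  have "A < a"
  proof -
    \<comment> \<open>The difference r + 1/r - R - 1/R factorizes, so the longer semi-axis increases
      as well.\<close>
    have "0 < (r - R) * (1 - 1 / (r * R))"
      using assms by (intro mult_pos_pos) (auto simp: field_simps intro: less_1_mult)
    also have "\<dots> = 2 * (a - A)"
      using assms by (simp add: a_def A_def field_simps)
    finally show ?thesis by simp
  qed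
  have "0 < A" using assms by (simp add: A_def add_pos_pos)
  have "(A * c / a)\<^sup>2 + (B * s / b)\<^sup>2 < 1"
  proof -
    have "(A / a)\<^sup>2 < 1" "(B / b)\<^sup>2 < 1"
      using \<open>0 < A\<close> \<open>A < a\<close> \<open>0 < B\<close> \<open>B < b\<close> by (simp_all add: abs_square_less_1)
    moreover have "c\<^sup>2 + s\<^sup>2 = 1" by (simp add: c_def s_def)
    ultimately have "(A / a)\<^sup>2 * c\<^sup>2 + (B / b)\<^sup>2 * s\<^sup>2 < 1"
      by (smt (verit) mult_left_le_one_le mult_less_cancel_right2 zero_le_power2 zero_eq_power2)
    then show ?thesis by (simp add: power_divide power_mult_distrib)
  qed
  then show ?thesis
    using assms \<open>ellipse_path R t = _\<close> by (subst bernstein_std_iff) (simp_all add: a_def b_def)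
qed

section \<open>The aliasing energy\<close>

text \<open>sin(m \<theta>) e^(i m \<theta>) = i/2 (1 - e^(2 i m \<theta>)), so two geometric series
  remain. The imaginary part of the sum is the energy \<Sum> r^m sin^2(m \<theta>).\<close>

lemma aliasing_kernel_sums:
  fixes r \<theta> :: real
  assumes r: "0 < r" "r < 1"
  shows "(\<lambda>m. of_real (r ^ m * sin (real m * \<theta>)) * cis (real m * \<theta>)) sums
    (\<i> / 2 * (1 / (1 - of_real r) - 1 / (1 - of_real r * cis (2 * \<theta>))))"
proof -
  define z where "z = of_real r * cis (2 * \<theta>)"
  have nz: "norm z < 1" and nr: "norm (of_real r :: complex) < 1"
    using r by (auto simp: z_def norm_mult)
  have "(\<lambda>m. \<i> / 2 * (of_real r ^ m - z ^ m)) sums (\<i> / 2 * (1 / (1 - of_real r) - 1 / (1 - z)))"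
    by (intro sums_mult sums_diff geometric_sums nz nr)
  moreover have "\<i> / 2 * (of_real r ^ m - z ^ m) = of_real (r ^ m * sin (real m * \<theta>)) * cis (real m * \<theta>)" for m
  proof -
    have "\<i> / 2 * (1 - cis (real m * (2 * \<theta>))) = of_real (sin (real m * \<theta>)) * cis (real m * \<theta>)"
      using cos_double_sin[of "real m * \<theta>"] sin_double[of "real m * \<theta>"]
      by (simp add: complex_eq_iff power2_eq_square mult_ac)
    then have "of_real r ^ m * (\<i> / 2 * (1 - cis (real m * (2 * \<theta>)))) =
        of_real r ^ m * (of_real (sin (real m * \<theta>)) * cis (real m * \<theta>))"
      by simp
    then show ?thesis
      by (simp add: z_def power_mult_distrib Complex.DeMoivre algebra_simps)
  qed
  ultimately show ?thesis by (simp add: z_def)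
qed

lemma summable_bounded_mult_power:
  fixes f :: "nat \<Rightarrow> 'a :: {banach, real_normed_algebra_1}"
  assumes "\<And>m. norm (f m) \<le> B" "0 < r" "r < 1"
  shows "summable (\<lambda>m. of_real (r ^ m) * f m)"
proof (rule summable_comparison_test')
  show "summable (\<lambda>m. r ^ m * B)"
    using assms by (intro summable_mult2 summable_geometric) auto
  show "norm (of_real (r ^ m) * f m) \<le> r ^ m * B" if "m \<ge> 0" for m
  proof -
    have "norm (of_real (r ^ m) * f m) \<le> norm (of_real (r ^ m) :: 'a) * norm (f m)"
      by (rule norm_mult_ineq)
    also have "\<dots> \<le> r ^ m * B"
      using assms by (simp add: norm_power del: of_real_power)
    finally show ?thesis .
  qed
qed

text \<open>Squaring the recursion \<open>h1\<close> leaves a cross term that is linear in h. It is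
  the imaginary part of a multiple of H = \<Sum> r^m h_m e^(i m \<theta>), and for H the recursion
  is a linear equation H = \<sigma> K + v H, because a shift by 2N brings out the factor v. Hence H,
  and then the square sum, have closed forms. The bound B ensures convergence.\<close>

lemma aliasing_energy_eq:
  fixes r \<theta> \<sigma> B :: real and h :: "nat \<Rightarrow> real" and N :: nat
  assumes r: "0 < r" "r < 1" and N: "N \<ge> 1"
    and h0: "\<And>m. m < 2 * N \<Longrightarrow> h m = \<sigma> * sin (real m * \<theta>)"
    and h1: "\<And>m. h (m + 2 * N) = h m + \<sigma> * sin (real (m + 2 * N) * \<theta>)"
    and B: "\<And>m. \<bar>h m\<bar> \<le> B"
  defines "y \<equiv> r ^ (2 * N)"
  defines "v \<equiv> of_real y * cis (2 * real N * \<theta>)"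
  defines "K \<equiv> \<i> / 2 * (1 / (1 - of_real r) - 1 / (1 - of_real r * cis (2 * \<theta>)))"
  shows "summable (\<lambda>m. r ^ m * (h m)\<^sup>2)"
    and "(1 - y) * (\<Sum>m. r ^ m * (h m)\<^sup>2) = \<sigma>\<^sup>2 * Im (K * (1 + v) / (1 - v))"
proof -
  have B0: "0 \<le> B" using B[of 0] by linarith
  define s where "s m = \<sigma> * sin (real m * \<theta>)" for m
  define e where "e m = cis (real m * \<theta>)" for m
  have e_add: "e (m + 2 * N) = e (2 * N) * e m" for m
    by (simp add: e_def cis_mult algebra_simps)
  have v: "v = of_real y * e (2 * N)" by (simp add: v_def e_def)
  have y: "0 < y" "y < 1"
    using r N by (auto simp: y_def power_less_one_iff)
  have "norm v < 1" using y by (simp add: v_def norm_mult)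
  then have v1: "1 - v \<noteq> 0" by auto
  have Ks: "(\<lambda>m. of_real (r ^ m * s m) * e m) sums (of_real \<sigma> * K)"
    using sums_mult[OF aliasing_kernel_sums[OF r, of \<theta>], of "of_real \<sigma>"]
    by (simp add: K_def s_def e_def mult_ac)
  have hb: "\<bar>(h m)\<^sup>2\<bar> \<le> B\<^sup>2" for m
    using B[of m] B0 power_mono[of "\<bar>h m\<bar>" B 2] by simp
  show sumZ: "summable (\<lambda>m. r ^ m * (h m)\<^sup>2)"
    using summable_bounded_mult_power[of "\<lambda>m. (h m)\<^sup>2" "B\<^sup>2" r] hb r by simp
  have sumH: "summable (\<lambda>m. of_real (r ^ m) * (of_real (h m) * e m))"
    using B by (intro summable_bounded_mult_power[OF _ r, of _ B]) (simp add: e_def norm_mult)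
  define H where "H = (\<Sum>m. of_real (r ^ m) * (of_real (h m) * e m))"
  have H_sums: "(\<lambda>m. of_real (r ^ m) * (of_real (h m) * e m)) sums H"
    using sumH by (simp add: H_def summable_sums)
  have H: "H = of_real \<sigma> * K + v * H"
  proof -
    have "(\<lambda>m. of_real (r ^ m * s m) * e m +
        (if m < 2 * N then 0 else of_real (r ^ m) * of_real (h (m - 2 * N)) * e m)) sums H"
    proof (rule sums_cong[THEN iffD1, OF _ H_sums])
      fix m
      show "of_real (r ^ m) * (of_real (h m) * e m) = of_real (r ^ m * s m) * e m +
        (if m < 2 * N then 0 else of_real (r ^ m) * of_real (h (m - 2 * N)) * e m)"
        using h0[of m] h1[of "m - 2 * N"] by (auto simp: s_def algebra_simps)
    qed
    from sums_diff[OF this Ks] have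
      "(\<lambda>m. if m < 2 * N then 0 else of_real (r ^ m) * of_real (h (m - 2 * N)) * e m) sums (H - of_real \<sigma> * K)"
      by simp
    from sums_split_initial_segment[OF this, of "2 * N"]
    have "(\<lambda>m. of_real (r ^ (m + 2 * N)) * of_real (h m) * e (m + 2 * N)) sums (H - of_real \<sigma> * K)"
      by simp
    moreover have "of_real (r ^ (m + 2 * N)) * of_real (h m) * e (m + 2 * N) =
        v * (of_real (r ^ m) * (of_real (h m) * e m))" for m
      unfolding v y_def e_add power_add by (simp only: of_real_mult mult_ac)
    ultimately have "(\<lambda>m. v * (of_real (r ^ m) * (of_real (h m) * e m))) sums (H - of_real \<sigma> * K)"
      by (simp only:)
    then have "H - of_real \<sigma> * K = v * H"
      using sums_mult[OF H_sums, of v] by (rule sums_unique2)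
    then show ?thesis by (simp add: algebra_simps)
  qed
  then have H_eq: "H = of_real \<sigma> * K / (1 - v)"
    using v1 by (simp add: field_simps)
  define Z where "Z = (\<Sum>m. r ^ m * (h m)\<^sup>2)"
  have Z_sums: "(\<lambda>m. r ^ m * (h m)\<^sup>2) sums Z"
    using sumZ by (simp add: Z_def summable_sums)
  have S_sums: "(\<lambda>m. r ^ m * (s m)\<^sup>2) sums (\<sigma>\<^sup>2 * Im K)"
    using sums_mult[OF sums_Im[OF Ks], of \<sigma>]
    by (simp add: s_def e_def power2_eq_square mult_ac)
  have X_sums: "(\<lambda>m. r ^ m * h m * sin (real (m + 2 * N) * \<theta>)) sums Im (e (2 * N) * H)"
    using sums_Im[OF sums_mult[OF H_sums, of "e (2 * N)"]]
    by (simp add: e_def sin_add distrib_right algebra_simps)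
  \<comment> \<open>The first 2N terms of h and s agree, so the difference of the two energies is a
    tail, to which the recursion applies.\<close>
  have "(\<lambda>m. if m < 2 * N then 0 else r ^ m * ((h m)\<^sup>2 - (s m)\<^sup>2)) sums (Z - \<sigma>\<^sup>2 * Im K)"
  proof (rule sums_cong[THEN iffD1, OF _ sums_diff[OF Z_sums S_sums]])
    fix m
    show "r ^ m * (h m)\<^sup>2 - r ^ m * (s m)\<^sup>2 = (if m < 2 * N then 0 else r ^ m * ((h m)\<^sup>2 - (s m)\<^sup>2))"
      using h0[of m] by (auto simp: s_def algebra_simps)
  qed
  from sums_split_initial_segment[OF this, of "2 * N"]
  have "(\<lambda>m. r ^ (m + 2 * N) * ((h (m + 2 * N))\<^sup>2 - (s (m + 2 * N))\<^sup>2)) sums (Z - \<sigma>\<^sup>2 * Im K)"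
    by simp
  moreover have "r ^ (m + 2 * N) * ((h (m + 2 * N))\<^sup>2 - (s (m + 2 * N))\<^sup>2) =
      y * (r ^ m * (h m)\<^sup>2) + 2 * \<sigma> * y * (r ^ m * h m * sin (real (m + 2 * N) * \<theta>))" for m
    unfolding h1 s_def y_def power_add by (simp add: power2_eq_square algebra_simps)
  moreover have "(\<lambda>m. y * (r ^ m * (h m)\<^sup>2) + 2 * \<sigma> * y * (r ^ m * h m * sin (real (m + 2 * N) * \<theta>)))
      sums (y * Z + 2 * \<sigma> * y * Im (e (2 * N) * H))"
    by (intro sums_add sums_mult Z_sums X_sums)
  ultimately have "Z - \<sigma>\<^sup>2 * Im K = y * Z + 2 * \<sigma> * y * Im (e (2 * N) * H)"
    using sums_unique2 by auto
  also have "2 * \<sigma> * y * Im (e (2 * N) * H) = 2 * \<sigma> * Im (v * H)"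
    by (simp add: v mult.assoc)
  also have "2 * \<sigma> * Im (v * H) = \<sigma>\<^sup>2 * Im (2 * v * K / (1 - v))"
  proof -
    have "v * H = of_real \<sigma> * (v * K / (1 - v))"
      unfolding H_eq by simp
    moreover have "2 * v * K / (1 - v) = of_real 2 * (v * K / (1 - v))"
      by simp
    moreover have "2 * \<sigma> * Im (of_real \<sigma> * w) = \<sigma>\<^sup>2 * Im (of_real 2 * w)" for w
      by (simp add: power2_eq_square)
    ultimately show ?thesis by (simp only:)
  qed
  finally have "(1 - y) * Z = \<sigma>\<^sup>2 * (Im K + Im (2 * v * K / (1 - v)))"
    by (simp add: algebra_simps)
  also have "Im K + Im (2 * v * K / (1 - v)) = Im (K * (1 + v) / (1 - v))"
  proof -
    have "K + 2 * v * K / (1 - v) = K * (1 + v) / (1 - v)"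
      using v1 by (simp add: field_simps)
    then show ?thesis by (metis plus_complex.sel(2))
  qed
  finally show "(1 - y) * (\<Sum>m. r ^ m * (h m)\<^sup>2) = \<sigma>\<^sup>2 * Im (K * (1 + v) / (1 - v))"
    by (simp add: Z_def)
qed


section \<open>Closed form and estimate of the aliasing kernel\<close>

lemma inverse_one_minus_cis:
  fixes r \<theta> :: real
  defines "D \<equiv> (1 - r)\<^sup>2 * (cos \<theta>)\<^sup>2 + (1 + r)\<^sup>2 * (sin \<theta>)\<^sup>2"
  shows "1 / (1 - of_real r * cis (2 * \<theta>)) =
    Complex ((1 - r * cos (2 * \<theta>)) / D) (r * sin (2 * \<theta>) / D)"
proof -
  \<comment> \<open>D is the squared modulus of 1 - r e^(2 i \<theta>), rewritten in the half angle
    as the sum of the squares of (1 - r) cos \<theta> and (1 + r) sin \<theta>.\<close>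
  have "(1 - r * cos (2 * \<theta>))\<^sup>2 + (r * sin (2 * \<theta>))\<^sup>2 = 1 + r\<^sup>2 * ((cos (2 * \<theta>))\<^sup>2 + (sin (2 * \<theta>))\<^sup>2) - 2 * r * cos (2 * \<theta>)"
    by algebra
  also have "\<dots> = (1 + r\<^sup>2) * ((cos \<theta>)\<^sup>2 + (sin \<theta>)\<^sup>2) - 2 * r * ((cos \<theta>)\<^sup>2 - (sin \<theta>)\<^sup>2)"
  proof -
    have "(cos (2 * \<theta>))\<^sup>2 + (sin (2 * \<theta>))\<^sup>2 = 1" by simp
    then show ?thesis by (simp only: cos_double[symmetric] sin_cos_squared_add2) simp
  qed
  also have "\<dots> = D"
    unfolding D_def by algebra
  finally show ?thesis
    by (simp add: complex_eq_iff Re_divide Im_divide)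
qed

lemma one_plus_over_one_minus_cis:
  fixes y \<theta> :: real
  defines "D \<equiv> (1 - y)\<^sup>2 * (cos \<theta>)\<^sup>2 + (1 + y)\<^sup>2 * (sin \<theta>)\<^sup>2"
  assumes "D \<noteq> 0"
  shows "(1 + of_real y * cis (2 * \<theta>)) / (1 - of_real y * cis (2 * \<theta>)) =
    Complex ((1 - y\<^sup>2) / D) (2 * y * sin (2 * \<theta>) / D)"
proof -
  define v where "v = of_real y * cis (2 * \<theta>)"
  have "1 - v \<noteq> 0"
  proof
    assume "1 - v = 0"
    then have "v = 1" by simp
    then have "norm v = 1" by simp
    then have "\<bar>y\<bar> = 1" "y * cos (2 * \<theta>) = 1" "y * sin (2 * \<theta>) = 0"
      using \<open>v = 1\<close> by (simp_all add: v_def complex_eq_iff norm_mult)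
    then have "y = 1 \<and> sin \<theta> = 0 \<or> y = - 1 \<and> cos \<theta> = 0"
      by (auto simp: abs_if cos_double_cos cos_double_sin cos_squared_eq split: if_splits)
        (use sin_cos_squared_add[of \<theta>] in \<open>simp del: sin_cos_squared_add\<close>)
    then show False using \<open>D \<noteq> 0\<close> by (auto simp: D_def)
  qed
  then have "(1 + v) / (1 - v) = 2 * (1 / (1 - v)) - 1"
    by (simp add: field_simps)
  also have "\<dots> = 2 * Complex ((1 - y * cos (2 * \<theta>)) / D) (y * sin (2 * \<theta>) / D) - 1"
    unfolding v_def D_def inverse_one_minus_cis ..
  also have "\<dots> = Complex ((2 * (1 - y * cos (2 * \<theta>)) - D) / D) (2 * y * sin (2 * \<theta>) / D)"
    using \<open>D \<noteq> 0\<close> by (simp add: complex_eq_iff field_simps)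
  also have "2 * (1 - y * cos (2 * \<theta>)) - D = 1 - y\<^sup>2"
  proof -
    have "D = (1 + y\<^sup>2) * ((cos \<theta>)\<^sup>2 + (sin \<theta>)\<^sup>2) - 2 * y * ((cos \<theta>)\<^sup>2 - (sin \<theta>)\<^sup>2)"
      unfolding D_def by algebra
    then show ?thesis by (simp add: cos_double)
  qed
  finally show ?thesis by (simp add: v_def)
qed

text \<open>P, Q, p, q stand for (1 + r) sin \<theta>, (1 - r) cos \<theta>, sin(N \<theta>), cos(N
  \<theta>), and y for r^(2N). The mixed term is absorbed by 2|PQ| \<le> P^2 + Q^2; then the factor
  P^2 + Q^2 separates and an inequality in p and q remains.\<close>

lemma aliasing_form_le:
  fixes y P Q p q :: real
  assumes y: "0 < y" "y \<le> 1 / 4" and pq: "p\<^sup>2 + q\<^sup>2 = 1"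
  shows "p\<^sup>2 * (P\<^sup>2 * (1 - y\<^sup>2) + 4 * y * (P * Q) * (p * q)) \<le>
    (1 - y) * (P\<^sup>2 + Q\<^sup>2) * ((1 - y)\<^sup>2 * q\<^sup>2 + (1 + y)\<^sup>2 * p\<^sup>2)"
proof -
  have p1: "p\<^sup>2 \<le> 1" using pq zero_le_power2[of q] by linarith
  have PQ: "2 * \<bar>P * Q\<bar> \<le> P\<^sup>2 + Q\<^sup>2"
    using sum_squares_bound[of "\<bar>P\<bar>" "\<bar>Q\<bar>"] by (simp add: abs_mult)
  have "4 * y * (P * Q) * (p * q) \<le> 2 * y * (2 * \<bar>P * Q\<bar>) * \<bar>p * q\<bar>"
  proof -
    have "(P * Q) * (p * q) \<le> \<bar>P * Q\<bar> * \<bar>p * q\<bar>" by (simp add: abs_mult[symmetric])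
    then show ?thesis using y by (simp add: mult.assoc)
  qed
  also have "\<dots> \<le> 2 * y * (P\<^sup>2 + Q\<^sup>2) * \<bar>p * q\<bar>"
    using PQ y by (intro mult_right_mono mult_left_mono) auto
  finally have 1: "4 * y * (P * Q) * (p * q) \<le> (P\<^sup>2 + Q\<^sup>2) * (2 * y * \<bar>p * q\<bar>)"
    by (simp only: mult_ac)
  have y2: "y\<^sup>2 \<le> (1 / 4)\<^sup>2" using y by (intro power_mono) auto
  have "P\<^sup>2 * (1 - y\<^sup>2) \<le> (P\<^sup>2 + Q\<^sup>2) * (1 - y\<^sup>2)"
    using y2 by (intro mult_right_mono) (auto simp: power2_eq_square)
  with 1 have 2: "P\<^sup>2 * (1 - y\<^sup>2) + 4 * y * (P * Q) * (p * q) \<le> (P\<^sup>2 + Q\<^sup>2) * (1 - y\<^sup>2 + 2 * y * \<bar>p * q\<bar>)"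
    by (simp add: algebra_simps)
  have key: "p\<^sup>2 * (1 - y\<^sup>2 + 2 * y * \<bar>p * q\<bar>) \<le> (1 - y) * ((1 - y)\<^sup>2 * q\<^sup>2 + (1 + y)\<^sup>2 * p\<^sup>2)"
  proof -
    have "p\<^sup>2 * (2 * y * \<bar>p * q\<bar>) \<le> 1 * (2 * y * \<bar>p * q\<bar>)"
      using p1 y by (intro mult_right_mono) auto
    also have "\<dots> = y * (2 * \<bar>p\<bar> * \<bar>q\<bar>)" by (simp add: abs_mult)
    \<comment> \<open>The weights are chosen for y \<le> 1/4: the coefficient of p^2 needs 3/4 \<le>
      1 - y^2, that of q^2 needs 4y/3 \<le> (1 - y)^3, and at y = 1/4 the latter reads 1/3 \<le>
      27/64.\<close>
    also have "\<dots> \<le> y * (3 / 4 * p\<^sup>2 + 4 / 3 * q\<^sup>2)"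
    proof -
      have "0 \<le> (3 / 4 * \<bar>p\<bar> - \<bar>q\<bar>)\<^sup>2" by simp
      then have "2 * \<bar>p\<bar> * \<bar>q\<bar> \<le> 3 / 4 * p\<^sup>2 + 4 / 3 * q\<^sup>2"
        by (simp add: power2_diff power_mult_distrib power_divide)
      then show ?thesis using y by (intro mult_left_mono) auto
    qed
    also have "\<dots> \<le> y * (1 - y\<^sup>2) * p\<^sup>2 + (1 - y) ^ 3 * q\<^sup>2"
    proof -
      have "y * (3 / 4) \<le> y * (1 - y\<^sup>2)"
        using y y2 by (intro mult_left_mono) (auto simp: power2_eq_square)
      moreover have "y * (4 / 3) \<le> (1 - y) ^ 3"
      proof -
        have "y * (4 / 3) \<le> 1 / 3" using y by simp
        also have "\<dots> \<le> (3 / 4 :: real) ^ 3" by (simp add: power3_eq_cube)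
        also have "\<dots> \<le> (1 - y) ^ 3" using y by (intro power_mono) auto
        finally show ?thesis .
      qed
      ultimately have "(y * (3 / 4)) * p\<^sup>2 + (y * (4 / 3)) * q\<^sup>2 \<le> y * (1 - y\<^sup>2) * p\<^sup>2 + (1 - y) ^ 3 * q\<^sup>2"
        by (intro add_mono mult_right_mono) auto
      then show ?thesis by (simp add: algebra_simps)
    qed
    finally have "p\<^sup>2 * (2 * y * \<bar>p * q\<bar>) \<le> y * (1 - y\<^sup>2) * p\<^sup>2 + (1 - y) ^ 3 * q\<^sup>2" .
    moreover have "(1 - y) * ((1 - y)\<^sup>2 * q\<^sup>2 + (1 + y)\<^sup>2 * p\<^sup>2) - p\<^sup>2 * (1 - y\<^sup>2) =
        y * (1 - y\<^sup>2) * p\<^sup>2 + (1 - y) ^ 3 * q\<^sup>2"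
      by (simp add: power2_eq_square power3_eq_cube algebra_simps)
    ultimately show ?thesis by (simp add: algebra_simps)
  qed
  have "p\<^sup>2 * (P\<^sup>2 * (1 - y\<^sup>2) + 4 * y * (P * Q) * (p * q)) \<le> p\<^sup>2 * ((P\<^sup>2 + Q\<^sup>2) * (1 - y\<^sup>2 + 2 * y * \<bar>p * q\<bar>))"
    using 2 by (intro mult_left_mono) auto
  also have "\<dots> = (P\<^sup>2 + Q\<^sup>2) * (p\<^sup>2 * (1 - y\<^sup>2 + 2 * y * \<bar>p * q\<bar>))"
    by (simp only: mult_ac)
  also have "\<dots> \<le> (P\<^sup>2 + Q\<^sup>2) * ((1 - y) * ((1 - y)\<^sup>2 * q\<^sup>2 + (1 + y)\<^sup>2 * p\<^sup>2))"
    using key by (intro mult_left_mono) auto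
  finally show ?thesis by (simp only: mult_ac)
qed

text \<open>The factor 4 sin^2(N \<theta>) is \<sigma>^2 for the recursion of the aliasing error,
  and 1 - y is the factor on the left of \<open>aliasing_energy_eq\<close>. It cancels and leaves
  the energy bound 4r/(1 - r^2), uniformly in \<theta>.\<close>

lemma aliasing_kernel_le:
  fixes r y \<theta> :: real and N :: nat
  assumes r: "0 < r" "r < 1" and y: "0 < y" "y \<le> 1 / 4"
  defines "v \<equiv> of_real y * cis (2 * real N * \<theta>)"
  defines "K \<equiv> \<i> / 2 * (1 / (1 - of_real r) - 1 / (1 - of_real r * cis (2 * \<theta>)))"
  shows "4 * (sin (real N * \<theta>))\<^sup>2 * Im (K * (1 + v) / (1 - v)) \<le> (1 - y) * (4 * r / (1 - r\<^sup>2))"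
proof -
  define S c p q where "S = sin \<theta>" and "c = cos \<theta>" and "p = sin (real N * \<theta>)" and "q = cos (real N * \<theta>)"
  define D where "D = (1 - r)\<^sup>2 * c\<^sup>2 + (1 + r)\<^sup>2 * S\<^sup>2"
  define D' where "D' = (1 - y)\<^sup>2 * q\<^sup>2 + (1 + y)\<^sup>2 * p\<^sup>2"
  have Sc: "S\<^sup>2 + c\<^sup>2 = 1" and pq: "p\<^sup>2 + q\<^sup>2 = 1"
    by (simp_all add: S_def c_def p_def q_def)
  have lower: "(1 - x)\<^sup>2 \<le> (1 - x)\<^sup>2 * b\<^sup>2 + (1 + x)\<^sup>2 * a\<^sup>2" if "0 < x" "a\<^sup>2 + b\<^sup>2 = 1" for x a b :: real
  proof -
    have "(1 - x)\<^sup>2 * a\<^sup>2 \<le> (1 + x)\<^sup>2 * a\<^sup>2"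
      using that by (intro mult_right_mono) (auto simp: power2_eq_square algebra_simps)
    moreover have "(1 - x)\<^sup>2 = (1 - x)\<^sup>2 * b\<^sup>2 + (1 - x)\<^sup>2 * a\<^sup>2"
      using that by (metis add.commute distrib_left mult.right_neutral)
    ultimately show ?thesis by linarith
  qed
  have "0 < (1 - r)\<^sup>2" "0 < (1 - y)\<^sup>2" using r y by auto
  then have D: "D > 0" and D': "D' > 0"
    using lower[OF r(1) Sc] lower[OF y(1) pq] unfolding D_def D'_def by (blast intro: less_le_trans)+
  define C where "C = 1 / (1 - r) - (1 - r * cos (2 * \<theta>)) / D"
  have C: "C = 2 * r * (1 + r) * S\<^sup>2 / ((1 - r) * D)"
  proof -
    have "cos (2 * \<theta>) = c\<^sup>2 - S\<^sup>2" by (simp add: cos_double S_def c_def)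
    moreover have "C = (D - (1 - r) * (1 - r * cos (2 * \<theta>))) / ((1 - r) * D)"
      using D r unfolding C_def by (simp add: field_simps)
    moreover have "D - (1 - r) * (1 - r * (c\<^sup>2 - S\<^sup>2)) = 2 * r * (1 + r) * S\<^sup>2"
      using Sc unfolding D_def by algebra
    ultimately show ?thesis by simp
  qed
  have K: "K = Complex (r * sin (2 * \<theta>) / D / 2) (C / 2)"
  proof -
    have "1 / (1 - of_real r :: complex) = Complex (1 / (1 - r)) 0"
      by (simp add: complex_eq_iff Re_divide Im_divide power2_eq_square)
    then show ?thesis
      unfolding K_def inverse_one_minus_cis C_def D_def S_def c_def by (simp add: complex_eq_iff)
  qed
  have X: "(1 + v) / (1 - v) = Complex ((1 - y\<^sup>2) / D') (2 * y * sin (2 * (real N * \<theta>)) / D')"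
    using one_plus_over_one_minus_cis[of y "real N * \<theta>"] D'
    by (simp add: v_def D'_def p_def q_def mult.assoc)
  have "Im (K * (1 + v) / (1 - v)) = Im (K * ((1 + v) / (1 - v)))" by simp
  also have "\<dots> = r * sin (2 * \<theta>) / D / 2 * (2 * y * sin (2 * (real N * \<theta>)) / D') + C / 2 * ((1 - y\<^sup>2) / D')"
    unfolding K X by simp
  also have "\<dots> = r / (1 - r\<^sup>2) * (((1 + r) * S)\<^sup>2 * (1 - y\<^sup>2) + 4 * y * (((1 + r) * S) * ((1 - r) * c)) * (p * q)) / (D * D')"
  proof -
    have s1: "sin (2 * \<theta>) = 2 * S * c" and s2: "sin (2 * (real N * \<theta>)) = 2 * p * q"
      by (simp_all add: sin_double S_def c_def p_def q_def)
    have r2: "1 - r\<^sup>2 = (1 - r) * (1 + r)" by (simp add: power2_eq_square algebra_simps)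
    have "r * (2 * S * c) / D / 2 * (2 * y * (2 * p * q) / D') + 2 * r * (1 + r) * S\<^sup>2 / ((1 - r) * D) / 2 * ((1 - y\<^sup>2) / D') =
        (4 * r * y * S * c * p * q + r * (1 + r) * S\<^sup>2 * (1 - y\<^sup>2) / (1 - r)) / (D * D')"
      using r by (simp add: add_divide_distrib, simp only: mult_ac)
    also have "4 * r * y * S * c * p * q + r * (1 + r) * S\<^sup>2 * (1 - y\<^sup>2) / (1 - r) =
        r / ((1 - r) * (1 + r)) * (((1 + r) * S)\<^sup>2 * (1 - y\<^sup>2) + 4 * y * (((1 + r) * S) * ((1 - r) * c)) * (p * q))"
    proof -
      have "4 * r * y * S * c * p * q + r * b * S\<^sup>2 * Y / a =
          r / (a * b) * ((b * S)\<^sup>2 * Y + 4 * y * ((b * S) * (a * c)) * (p * q))" if "a \<noteq> 0" "b \<noteq> 0" for a b Y :: real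
        using that by (simp add: field_simps power2_eq_square)
      then show ?thesis using r by simp
    qed
    finally show ?thesis unfolding s1 s2 C r2 .
  qed
  finally have Im_eq: "Im (K * (1 + v) / (1 - v)) =
    r / (1 - r\<^sup>2) * (((1 + r) * S)\<^sup>2 * (1 - y\<^sup>2) + 4 * y * (((1 + r) * S) * ((1 - r) * c)) * (p * q)) / (D * D')" .
  have "p\<^sup>2 * (((1 + r) * S)\<^sup>2 * (1 - y\<^sup>2) + 4 * y * (((1 + r) * S) * ((1 - r) * c)) * (p * q)) \<le> (1 - y) * D * D'"
    using aliasing_form_le[OF y pq, of "(1 + r) * S" "(1 - r) * c"]
    by (simp add: D_def D'_def power_mult_distrib add.commute)
  then have "p\<^sup>2 * (((1 + r) * S)\<^sup>2 * (1 - y\<^sup>2) + 4 * y * (((1 + r) * S) * ((1 - r) * c)) * (p * q)) / (D * D') \<le> 1 - y"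
    using D D' by (simp add: divide_le_eq mult.assoc)
  then have "4 * r / (1 - r\<^sup>2) * (p\<^sup>2 * (((1 + r) * S)\<^sup>2 * (1 - y\<^sup>2) + 4 * y * (((1 + r) * S) * ((1 - r) * c)) * (p * q)) / (D * D'))
      \<le> 4 * r / (1 - r\<^sup>2) * (1 - y)"
    using r by (intro mult_left_mono divide_nonneg_nonneg) (auto simp: power_le_one)
  moreover have "4 * p\<^sup>2 * (r / m * X / E) = 4 * r / m * (p\<^sup>2 * X / E)" for X E m :: real
    by simp
  ultimately show ?thesis
    unfolding Im_eq p_def[symmetric] by (simp only: mult.commute[of _ "1 - y"])
qed

section \<open>The Lebesgue constant\<close>

definition cheb_half :: "nat \<Rightarrow> nat \<Rightarrow> real" where
  "cheb_half N k = (if k = 0 \<or> k = N then 1 / 2 else 1)"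

definition cheb_double :: "nat \<Rightarrow> nat \<Rightarrow> real" where
  "cheb_double N j = (if 0 < j \<and> j < N then 2 else 1)"

text \<open>The modified Dirichlet kernel sin(N \<phi>) cot(\<phi>/2) / (2N), the cardinal
  trigonometric polynomial of 2N equidistant points.\<close>

definition trig_kernel :: "nat \<Rightarrow> real \<Rightarrow> real" where
  "trig_kernel N \<phi> = (\<Sum>j\<le>N. cheb_double N j * cos (real j * \<phi>)) / (2 * real N)"

lemma trig_kernel_Suc_sum:
  "(\<Sum>j\<le>Suc (Suc n). cheb_double (Suc (Suc n)) j * a j) =
    (\<Sum>j\<le>Suc n. cheb_double (Suc n) j * a j) + a (Suc n) + a (Suc (Suc n))"
proof -
  have "(\<Sum>j\<le>n. cheb_double (Suc (Suc n)) j * a j) = (\<Sum>j\<le>n. cheb_double (Suc n) j * a j)"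
    by (intro sum.cong) (auto simp: cheb_double_def)
  then show ?thesis by (simp add: cheb_double_def)
qed

text \<open>The relation is kept in product form, so that the zeros of sin(\<phi>/2) are no
  exception.\<close>

lemma trig_kernel_closed:
  assumes "N \<ge> 1"
  shows "2 * real N * trig_kernel N \<phi> * sin (\<phi> / 2) = sin (real N * \<phi>) * cos (\<phi> / 2)"
proof -
  have "(\<Sum>j\<le>Suc n. cheb_double (Suc n) j * cos (real j * \<phi>)) * sin (\<phi> / 2) =
      sin (real (Suc n) * \<phi>) * cos (\<phi> / 2)" for n
  proof (induction n)
    case 0
    have "sin \<phi> = 2 * sin (\<phi> / 2) * cos (\<phi> / 2)" "cos \<phi> = 2 * (cos (\<phi> / 2))\<^sup>2 - 1"
      using sin_double[of "\<phi> / 2"] cos_double_cos[of "\<phi> / 2"] by simp_all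
    then show ?case by (simp add: cheb_double_def power2_eq_square)
  next
    case (Suc n)
    define \<psi> where "\<psi> = (real n + 1) * \<phi> + \<phi> / 2"
    have e: "real (Suc n) * \<phi> = \<psi> - \<phi> / 2" "real (Suc (Suc n)) * \<phi> = \<psi> + \<phi> / 2"
      by (simp_all add: \<psi>_def algebra_simps)
    have "(\<Sum>j\<le>Suc (Suc n). cheb_double (Suc (Suc n)) j * cos (real j * \<phi>)) * sin (\<phi> / 2) =
        sin (real (Suc n) * \<phi>) * cos (\<phi> / 2) + (cos (real (Suc n) * \<phi>) + cos (real (Suc (Suc n)) * \<phi>)) * sin (\<phi> / 2)"
      unfolding trig_kernel_Suc_sum distrib_right Suc by simp
    also have "\<dots> = sin (real (Suc (Suc n)) * \<phi>) * cos (\<phi> / 2)"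
      unfolding e sin_add sin_diff cos_add cos_diff by (simp add: algebra_simps)
    finally show ?case .
  qed
  from this[of "N - 1"] assms show ?thesis
    by (simp add: trig_kernel_def)
qed

lemma trig_kernel_minus: "trig_kernel N (- \<phi>) = trig_kernel N \<phi>"
  by (simp add: trig_kernel_def)

lemma trig_kernel_periodic: "trig_kernel N (\<phi> + 2 * pi) = trig_kernel N \<phi>"
proof -
  have "cos (real j * (\<phi> + 2 * pi)) = cos (real j * \<phi>)" for j
    using cos_2npi[of j] sin_2npi[of j] by (simp add: distrib_left cos_add mult_ac)
  then show ?thesis by (simp add: trig_kernel_def)
qed

section \<open>Elementary estimates of the kernel\<close>

lemma cot_le:
  fixes x :: real
  assumes "0 < x" "x < pi"
  shows "cos x / sin x \<le> 1 / x - x / 3"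
proof -
  have h: "x * cos x \<le> sin x" if x: "0 \<le> x" "x \<le> pi" for x :: real
  proof -
    define g where "g x = sin x - x * cos x" for x :: real
    have "g 0 \<le> g x"
    proof (rule DERIV_nonneg_imp_nondecreasing[where f = g])
      show "0 \<le> x" by fact
      fix t assume t: "0 \<le> t" "t \<le> x"
      have "(g has_real_derivative (t * sin t)) (at t)"
        unfolding g_def by (auto intro!: derivative_eq_intros)
      moreover have "0 \<le> t * sin t"
        using t x by (intro mult_nonneg_nonneg sin_ge_zero) auto
      ultimately show "\<exists>y. (g has_real_derivative y) (at t) \<and> 0 \<le> y" by blast
    qed
    then show ?thesis by (simp add: g_def)
  qed
  \<comment> \<open>The claim keeps the first two terms of the Laurent series of the cotangent. The
    derivative of f is x/3 (sin x - x cos x), whose sign is \<open>h\<close>.\<close>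
  define f where "f x = sin x * (1 - x\<^sup>2 / 3) - x * cos x" for x :: real
  have "f 0 \<le> f x"
  proof (rule DERIV_nonneg_imp_nondecreasing[where f = f])
    show "0 \<le> x" using assms by simp
    fix t assume t: "0 \<le> t" "t \<le> x"
    have "(f has_real_derivative (t / 3 * (sin t - t * cos t))) (at t)"
      unfolding f_def by (auto intro!: derivative_eq_intros simp: field_simps power2_eq_square)
    moreover have "0 \<le> t / 3 * (sin t - t * cos t)"
      using h[of t] t assms by simp
    ultimately show "\<exists>y. (f has_real_derivative y) (at t) \<and> 0 \<le> y" by blast
  qed
  then have "x * cos x \<le> sin x * (1 - x\<^sup>2 / 3)" by (simp add: f_def)
  moreover have "0 < sin x" using assms by (simp add: sin_gt_zero)
  ultimately show ?thesis
    using assms by (simp add: field_simps power2_eq_square)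
qed

text \<open>A parabola above one arch of the sine, meeting it at 0, 1/2 and 1. With v = |y - 1/2|
  the claim is cos(pi v) \<le> 1 - 4 v^2, that is sin(pi v/2) \<ge> sqrt 2 v, and this is the
  concavity of the sine on [0, pi/4].\<close>

lemma sin_pi_le:
  fixes y :: real
  assumes "0 \<le> y" "y \<le> 1"
  shows "sin (pi * y) \<le> 4 * y * (1 - y)"
proof -
  define v where "v = \<bar>y - 1 / 2\<bar>"
  have v: "0 \<le> v" "v \<le> 1 / 2" using assms by (auto simp: v_def abs_if)
  have cv: "convex_on {0..pi/4} (\<lambda>x. - sin x)"
  proof (rule f''_ge0_imp_convex)
    show "((\<lambda>x. - sin x) has_real_derivative - cos x) (at x)" for x :: real
      by (auto intro!: derivative_eq_intros)
    show "((\<lambda>x. - cos x) has_real_derivative sin x) (at x)" for x :: real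
      by (auto intro!: derivative_eq_intros)
    show "x \<in> {0..pi/4} \<Longrightarrow> 0 \<le> sin x" for x :: real
      by (auto intro: sin_ge_zero)
  qed auto
  have "- sin ((1 - 2 * v) *\<^sub>R 0 + (2 * v) *\<^sub>R (pi / 4)) \<le> (1 - 2 * v) * (- sin 0) + (2 * v) * (- sin (pi / 4))"
    using v by (intro convex_onD[OF cv]) auto
  then have "sqrt 2 * v \<le> sin (pi * v / 2)"
    by (simp add: sin_45 mult.commute)
  then have "(sqrt 2 * v)\<^sup>2 \<le> (sin (pi * v / 2))\<^sup>2"
    using v by (intro power_mono) auto
  then have "1 - 2 * (sin (pi * v / 2))\<^sup>2 \<le> 1 - 4 * v\<^sup>2"
    by (simp add: power_mult_distrib)
  then have "cos (pi * v) \<le> 1 - 4 * v\<^sup>2"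
    using cos_double_sin[of "pi * v / 2"] by simp
  moreover have "cos (pi * v) = sin (pi * y)"
  proof -
    have "cos (pi * v) = cos (pi * y - pi / 2)"
    proof (cases "y \<ge> 1 / 2")
      case True then show ?thesis by (simp add: v_def algebra_simps)
    next
      case False
      then have "pi * v = - (pi * y - pi / 2)" by (simp add: v_def algebra_simps)
      then show ?thesis by (simp only: cos_minus)
    qed
    then show ?thesis by (simp add: cos_diff)
  qed
  moreover have "1 - 4 * v\<^sup>2 = 4 * y * (1 - y)"
    by (simp add: v_def power2_eq_square algebra_simps)
  ultimately show ?thesis by simp
qed

lemma abs_trig_kernel_le:
  assumes N: "N \<ge> 1" and t: "0 < t" "t < real N"
  shows "\<bar>trig_kernel N (t * pi / real N)\<bar> \<le> \<bar>sin (pi * t)\<bar> * (1 / (pi * t) - pi * t / (12 * (real N)\<^sup>2))"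
proof -
  define x where "x = t * pi / (2 * real N)"
  have x: "0 < x" "x < pi / 2"
    using N t by (auto simp: x_def field_simps)
  then have s: "0 < sin x" and c: "0 < cos x"
    by (auto intro: sin_gt_zero cos_gt_zero)
  have "2 * real N * trig_kernel N (t * pi / real N) * sin x = sin (pi * t) * cos x"
    using trig_kernel_closed[OF N, of "t * pi / real N"] N by (simp add: x_def mult_ac)
  then have "trig_kernel N (t * pi / real N) = sin (pi * t) * (cos x / sin x) / (2 * real N)"
    using s N by (simp add: field_simps)
  then have "\<bar>trig_kernel N (t * pi / real N)\<bar> = \<bar>sin (pi * t)\<bar> * ((cos x / sin x) / (2 * real N))"
    using s c by (simp add: abs_mult)
  also have "\<dots> \<le> \<bar>sin (pi * t)\<bar> * ((1 / x - x / 3) / (2 * real N))"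
    using cot_le[of x] x N by (intro mult_left_mono divide_right_mono) auto
  also have "(1 / x - x / 3) / (2 * real N) = 1 / (pi * t) - pi * t / (12 * (real N)\<^sup>2)"
    using N t by (simp add: x_def field_simps power2_eq_square)
  finally show ?thesis .
qed

lemma abs_sin_pi_add: "\<bar>sin (pi * (real k + y))\<bar> = \<bar>sin (pi * y)\<bar>"
  by (simp add: distrib_left sin_add abs_mult mult.commute[of pi] sin_npi cos_npi)

lemma abs_sin_pi_diff: "\<bar>sin (pi * (real k + 1 - y))\<bar> = \<bar>sin (pi * y)\<bar>"
proof -
  have "pi * (real k + 1 - y) = real (k + 1) * pi - pi * y" by (simp add: algebra_simps)
  then show ?thesis
    by (simp only: sin_diff sin_npi cos_npi) (simp add: abs_mult)
qed

lemma sum_odd: "(\<Sum>k<N. 2 * real k + 1) = (real N)\<^sup>2"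
  by (induction N) (simp_all add: power2_eq_square algebra_simps)

text \<open>At all points k + y and k + 1 - y the absolute value of sin(pi t) is the same, and
  pairing them gives the fractions on the right. The linear corrections of the cotangent add up to
  pi/12, since the first N odd numbers have the sum N^2.\<close>

lemma period_sum_le:
  fixes y :: real
  assumes N: "N \<ge> 1" and y: "0 < y" "y < 1"
  shows "(\<Sum>k<N. \<bar>trig_kernel N ((real k + y) * pi / real N)\<bar> + \<bar>trig_kernel N ((real k + 1 - y) * pi / real N)\<bar>)
    \<le> sin (pi * y) * ((\<Sum>k<N. (2 * real k + 1) / ((real k + y) * (real k + 1 - y))) / pi - pi / 12)"
proof -
  have add_le: "a + b \<le> s * (p - q)"
    if "a \<le> s * (p1 - q1)" "b \<le> s * (p2 - q2)" "p1 + p2 = p" "q1 + q2 = q" for a b s p q p1 p2 q1 q2 :: real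
    using that by (auto simp: algebra_simps)
  define s where "s = sin (pi * y)"
  have s: "0 < s" using y by (simp add: s_def sin_gt_zero)
  have "(\<Sum>k<N. \<bar>trig_kernel N ((real k + y) * pi / real N)\<bar> + \<bar>trig_kernel N ((real k + 1 - y) * pi / real N)\<bar>)
    \<le> (\<Sum>k<N. s * ((2 * real k + 1) / ((real k + y) * (real k + 1 - y)) / pi - pi * (2 * real k + 1) / (12 * (real N)\<^sup>2)))"
  proof (rule sum_mono)
    fix k assume k: "k \<in> {..<N}"
    have "\<bar>trig_kernel N ((real k + y) * pi / real N)\<bar> \<le> s * (1 / (pi * (real k + y)) - pi * (real k + y) / (12 * (real N)\<^sup>2))"
      using abs_trig_kernel_le[OF N, of "real k + y"] k y s by (simp add: abs_sin_pi_add s_def)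
    moreover have "\<bar>trig_kernel N ((real k + 1 - y) * pi / real N)\<bar> \<le> s * (1 / (pi * (real k + 1 - y)) - pi * (real k + 1 - y) / (12 * (real N)\<^sup>2))"
      using abs_trig_kernel_le[OF N, of "real k + 1 - y"] k y s by (simp add: abs_sin_pi_diff s_def)
    moreover have "1 / (pi * (real k + y)) + 1 / (pi * (real k + 1 - y)) = (2 * real k + 1) / ((real k + y) * (real k + 1 - y)) / pi"
    proof -
      have "1 / (pi * a) + 1 / (pi * b) = (a + b) / (a * b) / pi" if "a > 0" "b > 0" for a b :: real
        using that by (simp add: field_simps)
      from this[of "real k + y" "real k + 1 - y"] show ?thesis using y by simp
    qed
    moreover have "pi * (real k + y) / (12 * (real N)\<^sup>2) + pi * (real k + 1 - y) / (12 * (real N)\<^sup>2) = pi * (2 * real k + 1) / (12 * (real N)\<^sup>2)"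
      by (simp add: algebra_simps add_divide_distrib[symmetric])
    ultimately show "\<bar>trig_kernel N ((real k + y) * pi / real N)\<bar> + \<bar>trig_kernel N ((real k + 1 - y) * pi / real N)\<bar>
      \<le> s * ((2 * real k + 1) / ((real k + y) * (real k + 1 - y)) / pi - pi * (2 * real k + 1) / (12 * (real N)\<^sup>2))"
      by (rule add_le)
  qed
  also have "\<dots> = s * ((\<Sum>k<N. (2 * real k + 1) / ((real k + y) * (real k + 1 - y))) / pi - pi * (\<Sum>k<N. 2 * real k + 1) / (12 * (real N)\<^sup>2))"
    by (simp only: sum_distrib_left[symmetric] sum_subtractf sum_divide_distrib[symmetric])
  also have "pi * (\<Sum>k<N. 2 * real k + 1) / (12 * (real N)\<^sup>2) = pi / 12"
    using N unfolding sum_odd by simp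
  finally show ?thesis by (simp add: s_def)
qed


text \<open>With u = y (1 - y) the left side is 4u (2k + 1) / (k (k + 1) + u), which does not
  decrease in u; the right side is its value at u = 1/4, that is, at y = 1/2.\<close>

lemma odd_quotient_le:
  fixes y :: real
  assumes y: "0 < y" "y < 1"
  shows "4 * y * (1 - y) * ((2 * real k + 1) / ((real k + y) * (real k + 1 - y))) \<le> 4 / (2 * real k + 1)"
proof -
  define u where "u = y * (1 - y)"
  have u: "0 < u" "u \<le> 1 / 4"
  proof -
    show "0 < u" using y by (simp add: u_def)
    have "0 \<le> (y - 1 / 2)\<^sup>2" by simp
    then show "u \<le> 1 / 4" by (simp add: u_def power2_eq_square algebra_simps)
  qed
  have d: "(real k + y) * (real k + 1 - y) = real k * (real k + 1) + u"
    by (simp add: u_def algebra_simps)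
  have pos: "0 < real k * (real k + 1) + u" using u by (simp add: add_nonneg_pos)
  have "u * (4 * (real k * (real k + 1))) \<le> (1 / 4) * (4 * (real k * (real k + 1)))"
    using u by (intro mult_right_mono) auto
  then have "4 * u * (2 * real k + 1) * (2 * real k + 1) \<le> 4 * (real k * (real k + 1) + u)"
    by (simp add: algebra_simps)
  then have "4 * u * (2 * real k + 1) / (real k * (real k + 1) + u) \<le> 4 / (2 * real k + 1)"
    using pos by (simp add: field_simps)
  then show ?thesis by (simp add: d u_def mult.assoc)
qed

text \<open>Under the factor 4y (1 - y) the correction pi/12 shrinks away from y = 1/2. The term k =
  1 shrinks by more and pays for this loss; numerically, pi^2/3 \<le> 128/27.\<close>

lemma odd_quotient_1_le:
  fixes y :: real
  assumes y: "0 < y" "y < 1"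
  shows "4 * y * (1 - y) * (3 / ((1 + y) * (2 - y)) / pi - pi / 12) \<le> 4 / 3 / pi - pi / 12"
proof -
  define u where "u = y * (1 - y)"
  have u: "0 < u" "u \<le> 1 / 4"
  proof -
    show "0 < u" using y by (simp add: u_def)
    have "0 \<le> (y - 1 / 2)\<^sup>2" by simp
    then show "u \<le> 1 / 4" by (simp add: u_def power2_eq_square algebra_simps)
  qed
  have d: "(1 + y) * (2 - y) = 2 + u" by (simp add: u_def algebra_simps)
  have "4 / 3 - 12 * u / (2 + u) = (32 / 3) * (1 / 4 - u) / (2 + u)"
    using u by (simp add: field_simps)
  also have "\<dots> \<ge> (32 / 3) * (1 / 4 - u) / (9 / 4)"
    using u by (intro divide_left_mono) auto
  finally have 1: "(128 / 27) * (1 / 4 - u) \<le> 4 / 3 - 12 * u / (2 + u)" by simp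
  have "pi * pi \<le> 3.2 * 3.2" using pi_approx pi_gt_zero by (intro mult_mono) auto
  then have "pi\<^sup>2 / 3 \<le> 128 / 27" by (simp add: power2_eq_square)
  then have "pi\<^sup>2 / 3 * (1 / 4 - u) \<le> (128 / 27) * (1 / 4 - u)"
    using u by (intro mult_right_mono) auto
  moreover have "pi\<^sup>2 / 3 * (1 / 4 - u) = pi\<^sup>2 / 12 - pi\<^sup>2 / 3 * u"
    by (simp only: right_diff_distrib)
  ultimately have "12 * u / (2 + u) - pi\<^sup>2 / 3 * u \<le> 4 / 3 - pi\<^sup>2 / 12"
    using 1 by linarith
  then have "(12 * u / (2 + u) - pi\<^sup>2 / 3 * u) / pi \<le> (4 / 3 - pi\<^sup>2 / 12) / pi"
    by (intro divide_right_mono) auto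
  moreover have "(12 * u / (2 + u) - pi\<^sup>2 / 3 * u) / pi = 4 * u * (3 / (2 + u) / pi - pi / 12)"
    by (simp add: diff_divide_distrib right_diff_distrib power2_eq_square)
  moreover have "(4 / 3 - pi\<^sup>2 / 12) / pi = 4 / 3 / pi - pi / 12"
    by (simp add: diff_divide_distrib power2_eq_square)
  ultimately show ?thesis by (simp add: d u_def mult.assoc)
qed

text \<open>The term \<open>pi / 12\<close> collects the corrections \<open>- x / 3\<close> of \<open>cot_le\<close>; without it the bound
  would be too weak for small \<open>N\<close>.\<close>

definition lebesgue_bound :: "nat \<Rightarrow> real" where
  "lebesgue_bound N = (if N = 1 then 4 / pi else (\<Sum>k<N. 4 / (2 * real k + 1)) / pi - pi / 12)"

text \<open>Replacing sin(pi y) by 4y (1 - y) makes the term k = 0 exactly 4/pi, but puts the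
  correction pi/12 under the same factor; it is restored in full with the help of the term k = 1.
  For N = 1 there is no such term and the correction is dropped, which gives the special value
  4/pi.\<close>

lemma period_sum_le_lebesgue_bound:
  fixes y :: real
  assumes N: "N \<ge> 1" and y: "0 < y" "y < 1"
  shows "(\<Sum>k<N. \<bar>trig_kernel N ((real k + y) * pi / real N)\<bar> + \<bar>trig_kernel N ((real k + 1 - y) * pi / real N)\<bar>)
    \<le> lebesgue_bound N"
proof -
  define S where "S = 4 * y * (1 - y)"
  define f where "f k = (2 * real k + 1) / ((real k + y) * (real k + 1 - y))" for k
  have S: "0 < S" using y by (simp add: S_def)
  have f0: "0 < f k" for k using y by (simp add: f_def)
  have f: "S * f k \<le> 4 / (2 * real k + 1)" for k
    using odd_quotient_le[OF y] by (simp add: S_def f_def)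
  have f_0: "S * f 0 = 4" using y by (simp add: S_def f_def)
  have "4 \<le> f 0"
  proof -
    have "0 \<le> (y - 1 / 2)\<^sup>2" by simp
    then have "y * (1 - y) \<le> 1 / 4" by (simp add: power2_eq_square algebra_simps)
    then show ?thesis using y by (simp add: f_def field_simps)
  qed
  also have "f 0 \<le> (\<Sum>k<N. f k)"
    using N f0 by (intro member_le_sum) (auto intro: less_imp_le)
  finally have "4 / pi \<le> (\<Sum>k<N. f k) / pi" by (intro divide_right_mono) auto
  moreover have "pi / 12 \<le> 4 / pi"
  proof -
    have "pi * pi \<le> 3.2 * 3.2" using pi_approx pi_gt_zero by (intro mult_mono) auto
    then show ?thesis by (simp add: field_simps)
  qed
  \<comment> \<open>Nonnegativity of the bracket allows the sine in front of it to be
    enlarged.\<close>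
  ultimately have br: "0 \<le> (\<Sum>k<N. f k) / pi - pi / 12" by linarith
  have "(\<Sum>k<N. \<bar>trig_kernel N ((real k + y) * pi / real N)\<bar> + \<bar>trig_kernel N ((real k + 1 - y) * pi / real N)\<bar>)
      \<le> sin (pi * y) * ((\<Sum>k<N. f k) / pi - pi / 12)"
    using period_sum_le[OF N y] by (simp add: f_def)
  also have "\<dots> \<le> S * ((\<Sum>k<N. f k) / pi - pi / 12)"
    using br sin_pi_le[of y] y by (intro mult_right_mono) (auto simp: S_def)
  also have "\<dots> \<le> lebesgue_bound N"
  proof (cases "N = 1")
    case True
    have "S * (f 0 / pi - pi / 12) \<le> S * (f 0 / pi)"
      using S by (intro mult_left_mono) auto
    then show ?thesis using True f_0 by (simp add: lebesgue_bound_def)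
  next
    case False
    then obtain M where M: "N = Suc (Suc M)"
      using N by (metis One_nat_def Suc_le_D not0_implies_Suc)
    have split: "(\<Sum>k<N. g k) = g 0 + g 1 + (\<Sum>k<M. g (k + 2))" for g :: "nat \<Rightarrow> real"
      unfolding M by (simp only: sum.lessThan_Suc_shift) simp
    have "S * ((\<Sum>k<N. f k) / pi - pi / 12) = S * f 0 / pi + S * (f 1 / pi - pi / 12) + (\<Sum>k<M. S * f (k + 2)) / pi"
      unfolding split by (simp add: sum_distrib_left[symmetric] algebra_simps add_divide_distrib)
    also have "\<dots> \<le> 4 / pi + (4 / 3 / pi - pi / 12) + (\<Sum>k<M. 4 / (2 * real (k + 2) + 1)) / pi"
    proof (intro add_mono divide_right_mono sum_mono f)
      show "S * (f 1 / pi - pi / 12) \<le> 4 / 3 / pi - pi / 12"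
        using odd_quotient_1_le[OF y] by (simp add: S_def f_def)
    qed (simp_all add: f_0)
    also have "\<dots> = lebesgue_bound N"
      using M unfolding lebesgue_bound_def split by (simp add: add_divide_distrib)
    finally show ?thesis .
  qed
  finally show ?thesis .
qed

lemma lebesgue_bound_1: "lebesgue_bound 1 \<le> 1.28"
  using pi_approx by (simp add: lebesgue_bound_def field_simps)

text \<open>The increment 4/((2n + 1) pi) is at most that of sqrt(N + 1/12), so only N = 2 has to be
  evaluated. There the bound is about 1.436, with square slightly above 2: this is what the 1/12
  pays for.\<close>

lemma lebesgue_bound_power2_le:
  assumes "N \<ge> 2"
  shows "0 \<le> lebesgue_bound N" "(lebesgue_bound N)\<^sup>2 \<le> real N + 1 / 12"
proof -
  have nn: "0 \<le> lebesgue_bound N" if "N \<ge> 2" for N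
  proof -
    have "4 / (2 * real 0 + 1) \<le> (\<Sum>k<N. 4 / (2 * real k + 1))"
      using that by (intro member_le_sum) auto
    then have "4 / pi \<le> (\<Sum>k<N. 4 / (2 * real k + 1)) / pi"
      by (intro divide_right_mono) auto
    moreover have "pi / 12 \<le> 1" "1 \<le> 4 / pi" using pi_approx by (simp_all add: field_simps)
    moreover have "lebesgue_bound N = (\<Sum>k<N. 4 / (2 * real k + 1)) / pi - pi / 12"
      using that by (simp add: lebesgue_bound_def)
    ultimately show ?thesis by linarith
  qed
  then show "0 \<le> lebesgue_bound N" using assms by simp
  have "lebesgue_bound N \<le> sqrt (real N + 1 / 12)"
    using assms
  proof (induction N rule: nat_induct_at_least)
    case base
    have "lebesgue_bound 2 = 16 / 3 / pi - pi / 12"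
      by (simp add: lebesgue_bound_def numeral_2_eq_2)
    also have "\<dots> \<le> 16 / 3 / 3.14 - 3.14 / 12"
      using pi_approx by (intro diff_mono divide_left_mono divide_right_mono) auto
    also have "\<dots> \<le> 1.442" by simp
    also have "\<dots> \<le> sqrt (real 2 + 1 / 12)"
      by (rule real_le_rsqrt) (simp add: power2_eq_square)
    finally show ?case .
  next
    case (Suc n)
    define a where "a = real n + 1 / 12"
    have a: "2 \<le> a" using Suc(1) by (simp add: a_def)
    have "lebesgue_bound (Suc n) = lebesgue_bound n + 4 / (2 * real n + 1) / pi"
      using Suc(1) by (simp add: lebesgue_bound_def add_divide_distrib)
    also have "4 / (2 * real n + 1) / pi \<le> sqrt (a + 1) - sqrt a"
    proof -
      \<comment> \<open>The tangent of the square root at 9/4, close to a for n = 2.\<close>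
      have sq: "sqrt x \<le> (x + 9 / 4) / 3" if "0 \<le> x" for x
      proof (rule real_le_lsqrt)
        have "0 \<le> (x - 9 / 4)\<^sup>2" by simp
        then show "x \<le> ((x + 9 / 4) / 3)\<^sup>2" by (simp add: power2_eq_square field_simps)
      qed (use that in auto)
      have le: "sqrt (a + 1) + sqrt a \<le> 3 * (2 * real n + 1) / 4"
        using sq[of "a + 1"] sq[of a] a Suc(1) by (simp add: a_def)
      have pos: "0 < sqrt (a + 1) + sqrt a" using a by (intro add_pos_pos) auto
      have "4 / (2 * real n + 1) / pi \<le> 4 / (2 * real n + 1) / 3"
        using pi_gt3 by (intro divide_left_mono) auto
      also have "\<dots> = 1 / (3 * (2 * real n + 1) / 4)" by simp
      also have "\<dots> \<le> 1 / (sqrt (a + 1) + sqrt a)"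
        using le pos by (intro divide_left_mono) auto
      also have "\<dots> = sqrt (a + 1) - sqrt a"
      proof -
        have "(sqrt (a + 1) - sqrt a) * (sqrt (a + 1) + sqrt a) = 1"
          using a by (simp add: algebra_simps)
        then show ?thesis using pos by (simp add: field_simps)
      qed
      finally show ?thesis .
    qed
    finally show ?case using Suc(2) by (simp add: a_def add_ac)
  qed
  then have "(lebesgue_bound N)\<^sup>2 \<le> (sqrt (real N + 1 / 12))\<^sup>2"
    using nn[OF assms] by (intro power_mono)
  then show "(lebesgue_bound N)\<^sup>2 \<le> real N + 1 / 12" by simp
qed

section \<open>Interpolation weights and aliasing\<close>

text \<open>The factor of the k-th nodal value in the one-variable interpolant at x, that is, the
  cardinal polynomial of this node.\<close>

definition interp_weight :: "nat \<Rightarrow> nat \<Rightarrow> real \<Rightarrow> real" where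
  "interp_weight N k x = cheb_half N k * (\<Sum>j\<le>N. cheb_double N j / real N *
     (cos (real j * pi * (real k / real N)) * cheb_T j x))"

lemma interp_weight_cos:
  "interp_weight N k (cos \<theta>) = cheb_half N k *
     (trig_kernel N (\<theta> - pi * real k / real N) + trig_kernel N (\<theta> + pi * real k / real N))"
proof -
  define \<theta>' where "\<theta>' = pi * real k / real N"
  have "cheb_double N j / real N * (cos (real j * pi * (real k / real N)) * cheb_T j (cos \<theta>)) =
      (cheb_double N j * cos (real j * (\<theta> - \<theta>')) + cheb_double N j * cos (real j * (\<theta> + \<theta>'))) / (2 * real N)" for j
  proof -
    have 1: "real j * pi * (real k / real N) = real j * \<theta>'" by (simp add: \<theta>'_def)
    have 2: "cos (real j * \<theta>') * cos (real j * \<theta>) = (cos (real j * (\<theta> - \<theta>')) + cos (real j * (\<theta> + \<theta>'))) / 2"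
      by (simp add: cos_diff cos_add right_diff_distrib distrib_left)
    show ?thesis unfolding 1 cheb_T_cos 2 by (simp add: add_divide_distrib distrib_left)
  qed
  then show ?thesis
    by (simp add: interp_weight_def trig_kernel_def \<theta>'_def sum.distrib add_divide_distrib sum_divide_distrib)
qed

lemma sum_int_period:
  fixes f :: "int \<Rightarrow> real"
  assumes "\<And>i. f (i + p) = f i" "p \<ge> 0"
  shows "(\<Sum>i\<in>{a..<a + p}. f i) = (\<Sum>i\<in>{b..<b + p}. f i)"
proof -
  have step: "(\<Sum>i\<in>{a + 1..<a + 1 + p}. f i) = (\<Sum>i\<in>{a..<a + p}. f i)" for a
  proof (cases "p = 0")
    case False
    then have "{a..<a + p} = insert a {a + 1..<a + p}" "{a + 1..<a + 1 + p} = insert (a + p) {a + 1..<a + p}"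
      using assms(2) by auto
    then show ?thesis using assms(1)[of a] by simp
  qed simp
  have "(\<Sum>i\<in>{a + int n..<a + int n + p}. f i) = (\<Sum>i\<in>{a..<a + p}. f i)" for a n
  proof (induction n)
    case (Suc n)
    then show ?case using step[of "a + int n"] by (simp add: add_ac)
  qed simp
  from this[of a "nat (b - a)"] this[of b "nat (a - b)"] show ?thesis
    by (cases "a \<le> b") auto
qed

text \<open>The indices j - k and j + k with k \<le> N run once through a period 2N: k = 0 gives one
  index twice, k = N gives two indices that agree modulo 2N, and the halves in
  \<open>cheb_half\<close> correct both. The period is then moved to -N, ..., N - 1, which removes
  j, and k is paired with -k - 1.\<close>

lemma sum_int_symmetric:
  fixes f :: "int \<Rightarrow> real"
  assumes "N \<ge> 1" and "\<And>i. f (i + 2 * int N) = f i"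
  shows "(\<Sum>k\<le>N. cheb_half N k * (f (j - int k) + f (j + int k))) = (\<Sum>k<N. f (int k) + f (- int k - 1))"
proof -
  obtain M where M: "N = Suc M" using assms(1) by (cases N) auto
  have "(\<Sum>k\<le>Suc m. cheb_half (Suc m) k * (f (j - int k) + f (j + int k))) =
      (\<Sum>i\<in>{j - int m..<j + int m + 1}. f i) + (f (j - int (Suc m)) + f (j + int (Suc m))) / 2" for m
  proof -
    have "(\<Sum>k\<le>m. cheb_half (Suc m) k * (f (j - int k) + f (j + int k))) = (\<Sum>i\<in>{j - int m..<j + int m + 1}. f i)"
    proof -
      have "(\<Sum>k\<le>n. cheb_half (Suc m) k * (f (j - int k) + f (j + int k))) = (\<Sum>i\<in>{j - int n..<j + int n + 1}. f i)"
        if "n \<le> m" for n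
        using that
      proof (induction n)
        case 0
        have "{j..<j + 1} = {j}" by auto
        then show ?case by (simp add: cheb_half_def)
      next
        case (Suc n)
        have "{j - int (Suc n)..<j + int (Suc n) + 1} =
            insert (j - int (Suc n)) (insert (j + int (Suc n)) {j - int n..<j + int n + 1})"
          by auto
        then show ?case using Suc by (simp add: cheb_half_def)
      qed
      then show ?thesis by simp
    qed
    then show ?thesis by (simp add: cheb_half_def)
  qed
  from this[of M] have "(\<Sum>k\<le>N. cheb_half N k * (f (j - int k) + f (j + int k))) =
      (\<Sum>i\<in>{j - int M..<j + int M + 1}. f i) + (f (j - int N) + f (j + int N)) / 2"
    using M by simp
  also have "f (j - int N) = f (j + int N)"
    using assms(2)[of "j - int N"] by (simp add: algebra_simps)
  also have "(\<Sum>i\<in>{j - int M..<j + int M + 1}. f i) + (f (j + int N) + f (j + int N)) / 2 =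
      (\<Sum>i\<in>insert (j + int N) {j - int M..<j + int M + 1}. f i)"
    using M by simp
  also have "insert (j + int N) {j - int M..<j + int M + 1} = {j - int M..<(j - int M) + 2 * int N}"
    using M by auto
  also have "(\<Sum>i\<in>{j - int M..<(j - int M) + 2 * int N}. f i) = (\<Sum>i\<in>{- int N..<- int N + 2 * int N}. f i)"
    by (rule sum_int_period) (use assms(2) in auto)
  also have "\<dots> = (\<Sum>i\<in>{- int N..<int N}. f i)" by simp
  also have "\<dots> = (\<Sum>k<N. f (int k) + f (- int k - 1))"
  proof (induction N)
    case (Suc n)
    have "{- int (Suc n)..<int (Suc n)} = insert (int n) (insert (- int n - 1) {- int n..<int n})"
      by auto
    then show ?case using Suc by simp
  qed simp
  finally show ?thesis .
qed

text \<open>Write \<theta> = (j + y) pi/N with an integer j and 0 \<le> y < 1. Periodicity removes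
  j, evenness of the kernel turns the negative indices into the points k + 1 - y, and y > 0 because
  cos \<theta> is not a node.\<close>

lemma sum_abs_interp_weight_le:
  assumes N: "N \<ge> 1" and \<theta>: "sin (real N * \<theta>) \<noteq> 0"
  shows "(\<Sum>k\<le>N. \<bar>interp_weight N k (cos \<theta>)\<bar>) \<le> lebesgue_bound N"
proof -
  define j where "j = \<lfloor>\<theta> * real N / pi\<rfloor>"
  define y where "y = \<theta> * real N / pi - of_int j"
  have y01: "0 \<le> y" "y < 1" unfolding y_def j_def by linarith+
  have th: "\<theta> = (of_int j + y) * pi / real N" using N by (simp add: y_def)
  have "y \<noteq> 0"
  proof
    assume "y = 0"
    then have "real N * \<theta> = of_int j * pi" using N th by simp
    then show False using \<theta> sin_zero_iff_int2 by blast
  qed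
  with y01 have y: "0 < y" "y < 1" by auto
  define f where "f i = \<bar>trig_kernel N ((of_int i + y) * pi / real N)\<bar>" for i :: int
  have per: "f (i + 2 * int N) = f i" for i
  proof -
    have "(of_int (i + 2 * int N) + y) * pi / real N = (of_int i + y) * pi / real N + 2 * pi"
      using N by (simp add: field_simps)
    then show ?thesis by (simp only: f_def trig_kernel_periodic)
  qed
  have "\<bar>interp_weight N k (cos \<theta>)\<bar> \<le> cheb_half N k * (f (j - int k) + f (j + int k))" for k
  proof -
    have "\<theta> - pi * real k / real N = (of_int (j - int k) + y) * pi / real N"
      "\<theta> + pi * real k / real N = (of_int (j + int k) + y) * pi / real N"
      using N unfolding th by (simp_all add: field_simps)
    moreover have "0 \<le> cheb_half N k" by (simp add: cheb_half_def)
    ultimately show ?thesis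
      unfolding interp_weight_cos f_def by (simp only: abs_mult abs_of_nonneg) (intro mult_left_mono abs_triangle_ineq)
  qed
  then have "(\<Sum>k\<le>N. \<bar>interp_weight N k (cos \<theta>)\<bar>) \<le> (\<Sum>k\<le>N. cheb_half N k * (f (j - int k) + f (j + int k)))"
    by (intro sum_mono)
  also have "\<dots> = (\<Sum>k<N. f (int k) + f (- int k - 1))"
    by (rule sum_int_symmetric[OF N, where f = f]) (rule per)
  also have "\<dots> = (\<Sum>k<N. \<bar>trig_kernel N ((real k + y) * pi / real N)\<bar> + \<bar>trig_kernel N ((real k + 1 - y) * pi / real N)\<bar>)"
  proof (intro sum.cong refl arg_cong2[of _ _ _ _ "(+)"])
    fix k
    have "(of_int (- int k - 1) + y) * pi / real N = - ((real k + 1 - y) * pi / real N)"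
    proof -
      have "of_int (- int k - 1) + y = - (real k + 1 - y)" by simp
      then show ?thesis by (simp only: mult_minus_left minus_divide_left)
    qed
    then show "f (- int k - 1) = \<bar>trig_kernel N ((real k + 1 - y) * pi / real N)\<bar>"
      by (simp only: f_def trig_kernel_minus)
  qed (simp add: f_def)
  also have "\<dots> \<le> lebesgue_bound N"
    by (rule period_sum_le_lebesgue_bound[OF N y])
  finally show ?thesis .
qed

text \<open>The interpolant of the n-th Chebyshev polynomial, evaluated at cos \<theta>.\<close>

definition aliased_cos :: "nat \<Rightarrow> real \<Rightarrow> nat \<Rightarrow> real" where
  "aliased_cos N \<theta> n = (\<Sum>k\<le>N. interp_weight N k (cos \<theta>) * cos (real n * (pi * real k / real N)))"

text \<open>Frequency and node enter the cosine symmetrically, and \<open>cheb_half\<close> is half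
  of \<open>cheb_double\<close>. So the sum is N times the kernel at \<phi> = m pi/N; there sin(N
  \<phi>) = 0, and the kernel vanishes unless sin(\<phi>/2) does.\<close>

lemma sum_cheb_half_cos:
  assumes N: "N \<ge> 1"
  shows "(\<Sum>k\<le>N. cheb_half N k * cos (real m * (pi * real k / real N))) = (if 2 * N dvd m then real N else 0)"
proof -
  define \<phi> where "\<phi> = real m * pi / real N"
  have "(\<Sum>k\<le>N. cheb_half N k * cos (real m * (pi * real k / real N))) = real N * trig_kernel N \<phi>"
  proof -
    have "cheb_half N k * cos (real m * (pi * real k / real N)) = cheb_double N k * cos (real k * \<phi>) / 2" if "k \<le> N" for k
      using that by (auto simp: cheb_half_def cheb_double_def \<phi>_def mult_ac)
    then have "(\<Sum>k\<le>N. cheb_half N k * cos (real m * (pi * real k / real N))) =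
        (\<Sum>k\<le>N. cheb_double N k * cos (real k * \<phi>) / 2)"
      by (intro sum.cong) auto
    then show ?thesis
      using N by (simp add: trig_kernel_def sum_divide_distrib[symmetric])
  qed
  also have "real N * trig_kernel N \<phi> = (if 2 * N dvd m then real N else 0)"
  proof (cases "2 * N dvd m")
    case True
    then obtain c where "m = 2 * N * c" by (auto simp: dvd_def)
    then have "\<phi> = 2 * real c * pi" using N by (simp add: \<phi>_def)
    then have "cos (real j * \<phi>) = 1" for j
      using cos_2npi[of "j * c"] by (simp add: mult_ac)
    moreover have "(\<Sum>j\<le>N. cheb_double N j) = 2 * real N"
      using N
    proof (induction N rule: nat_induct_at_least)
      case base
      show ?case by (simp add: cheb_double_def)
    next
      case (Suc n)
      then obtain p where "n = Suc p" by (cases n) auto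
      then show ?case using Suc trig_kernel_Suc_sum[of p "\<lambda>_. 1"] by simp
    qed
    ultimately show ?thesis using True N by (simp add: trig_kernel_def)
  next
    case False
    have "sin (\<phi> / 2) \<noteq> 0"
    proof
      assume "sin (\<phi> / 2) = 0"
      then obtain i :: int where i: "\<phi> / 2 = of_int i * pi" using sin_zero_iff_int2 by blast
      then have "real m = of_int (2 * int N * i)"
        using N by (simp add: \<phi>_def field_simps)
      then have "int m = 2 * int N * i" by linarith
      then have "int (2 * N) dvd int m" by simp
      then show False using False by (simp only: int_dvd_int_iff)
    qed
    moreover have "sin (real N * \<phi>) = 0"
      using N by (simp add: \<phi>_def mult.commute[of "real m"] sin_npi2 mult.commute)
    ultimately show ?thesis
      using trig_kernel_closed[OF N, of \<phi>] False N by simp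
  qed
  finally show ?thesis .
qed

lemma aliased_cos_le:
  assumes N: "N \<ge> 1" and n: "n \<le> N"
  shows "aliased_cos N \<theta> n = cos (real n * \<theta>)"
proof -
  define c where "c i k = cos (real i * (pi * real k / real N))" for i k :: nat
  have orth: "(\<Sum>k\<le>N. cheb_half N k * (c j k * c n k)) = (if j = n then real N / cheb_double N j else 0)" if j: "j \<le> N" for j
  proof -
    have prod: "c j k * c n k = (c (nat \<bar>int j - int n\<bar>) k + c (j + n) k) / 2" for k
    proof -
      define \<psi> where "\<psi> = pi * real k / real N"
      have "cos (real (nat \<bar>int j - int n\<bar>) * \<psi>) = cos ((real j - real n) * \<psi>)"
      proof (cases "n \<le> j")
        case True then show ?thesis by (simp add: of_nat_diff)
      next
        case False
        then have "real (nat \<bar>int j - int n\<bar>) * \<psi> = - ((real j - real n) * \<psi>)"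
          by (simp add: algebra_simps)
        then show ?thesis by (simp only: cos_minus)
      qed
      then show ?thesis
        by (simp add: c_def \<psi>_def[symmetric] left_diff_distrib distrib_right cos_diff cos_add)
    qed
    have "(\<Sum>k\<le>N. cheb_half N k * (c j k * c n k)) =
        ((\<Sum>k\<le>N. cheb_half N k * c (nat \<bar>int j - int n\<bar>) k) + (\<Sum>k\<le>N. cheb_half N k * c (j + n) k)) / 2"
      unfolding prod by (simp add: sum.distrib[symmetric] sum_divide_distrib distrib_left)
    also have "\<dots> = ((if 2 * N dvd nat \<bar>int j - int n\<bar> then real N else 0) + (if 2 * N dvd j + n then real N else 0)) / 2"
      unfolding c_def sum_cheb_half_cos[OF N] ..
    also have "2 * N dvd nat \<bar>int j - int n\<bar> \<longleftrightarrow> j = n"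
    proof -
      define d where "d = nat \<bar>int j - int n\<bar>"
      have "d \<le> N" using j n by (simp add: d_def)
      then have "2 * N dvd d \<longleftrightarrow> d = 0" using N by (auto dest: dvd_imp_le)
      then show ?thesis by (auto simp: d_def)
    qed
    \<comment> \<open>At the end frequencies both divisibilities hold and the sum doubles; this is
      why \<open>cheb_double\<close> is 1 there.\<close>
    also have "2 * N dvd j + n \<longleftrightarrow> j = n \<and> (j = 0 \<or> j = N)"
      using j n N by (auto dest!: dvd_imp_le simp flip: mult_2)
    finally show ?thesis using j by (auto simp: cheb_double_def)
  qed
  have "aliased_cos N \<theta> n = (\<Sum>k\<le>N. \<Sum>j\<le>N. cheb_double N j / real N * cos (real j * \<theta>) * (cheb_half N k * (c j k * c n k)))"
    unfolding aliased_cos_def interp_weight_def cheb_T_cos c_def sum_distrib_left sum_distrib_right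
    by (intro sum.cong refl) (simp add: mult_ac)
  also have "\<dots> = (\<Sum>j\<le>N. cheb_double N j / real N * cos (real j * \<theta>) * (\<Sum>k\<le>N. cheb_half N k * (c j k * c n k)))"
    unfolding sum_distrib_left by (rule sum.swap)
  also have "\<dots> = (\<Sum>j\<le>N. if j = n then cos (real j * \<theta>) else 0)"
    using N by (intro sum.cong refl) (auto simp: orth cheb_double_def)
  also have "\<dots> = cos (real n * \<theta>)" using n by simp
  finally show ?thesis .
qed

lemma aliased_cos_periodic: "N \<ge> 1 \<Longrightarrow> aliased_cos N \<theta> (n + 2 * N) = aliased_cos N \<theta> n"
proof -
  assume N: "N \<ge> 1"
  have "cos (real (n + 2 * N) * (pi * real k / real N)) = cos (real n * (pi * real k / real N))" for k
  proof -
    have "real (n + 2 * N) * (pi * real k / real N) = real n * (pi * real k / real N) + 2 * real k * pi"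
      using N by (simp add: field_simps)
    then show ?thesis by (simp only: cos_add cos_2npi sin_2npi)
  qed
  then show ?thesis by (simp add: aliased_cos_def)
qed

lemma aliased_cos_reflect:
  assumes "N \<ge> 1" "n \<le> 2 * N"
  shows "aliased_cos N \<theta> (2 * N - n) = aliased_cos N \<theta> n"
proof -
  have "cos (real (2 * N - n) * (pi * real k / real N)) = cos (real n * (pi * real k / real N))" for k
  proof -
    have "real (2 * N - n) * (pi * real k / real N) = 2 * real k * pi - real n * (pi * real k / real N)"
      using assms by (simp add: of_nat_diff field_simps)
    then show ?thesis by (simp only: cos_diff cos_2npi sin_2npi)
  qed
  then show ?thesis by (simp add: aliased_cos_def)
qed

text \<open>Indexed from N, the last frequency that is reproduced exactly.\<close>

definition alias_error :: "nat \<Rightarrow> real \<Rightarrow> nat \<Rightarrow> real" where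
  "alias_error N \<theta> m = cos (real (N + m) * \<theta>) - aliased_cos N \<theta> (N + m)"

text \<open>The frequency N + m is aliased to |N - m|, and the difference of the two cosines is a
  product of sines.\<close>

lemma alias_error_init:
  assumes N: "N \<ge> 1" and m: "m < 2 * N"
  shows "alias_error N \<theta> m = - 2 * sin (real N * \<theta>) * sin (real m * \<theta>)"
proof -
  have "aliased_cos N \<theta> (N + m) = cos ((real N - real m) * \<theta>)"
  proof (cases "m \<le> N")
    case True
    have "aliased_cos N \<theta> (N + m) = aliased_cos N \<theta> (2 * N - (N + m))"
      using True N by (intro aliased_cos_reflect[symmetric]) auto
    also have "2 * N - (N + m) = N - m" by simp
    finally show ?thesis using True N by (simp add: aliased_cos_le of_nat_diff)
  next
    case False
    have "N + m = (m - N) + 2 * N" using False by simp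
    then have "aliased_cos N \<theta> (N + m) = aliased_cos N \<theta> (m - N)"
      using aliased_cos_periodic[OF N] by metis
    also have "\<dots> = cos (- ((real N - real m) * \<theta>))"
      using False m N by (simp add: aliased_cos_le of_nat_diff algebra_simps)
    finally show ?thesis by (simp only: cos_minus)
  qed
  then show ?thesis
    by (simp add: alias_error_def distrib_right left_diff_distrib cos_add cos_diff)
qed

text \<open>Aliasing has period 2N, so the interpolants cancel. Together with the initial values
  this is the recursion of \<open>aliasing_energy_eq\<close> with \<sigma> = -2 sin(N
  \<theta>).\<close>

lemma alias_error_step:
  assumes N: "N \<ge> 1"
  shows "alias_error N \<theta> (m + 2 * N) = alias_error N \<theta> m + (- 2 * sin (real N * \<theta>)) * sin (real (m + 2 * N) * \<theta>)"
proof -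
  define \<psi> where "\<psi> = real (m + 2 * N) * \<theta>"
  have "cos (real (N + (m + 2 * N)) * \<theta>) = cos (\<psi> + real N * \<theta>)" "cos (real (N + m) * \<theta>) = cos (\<psi> - real N * \<theta>)"
    by (simp_all add: \<psi>_def algebra_simps)
  then have "alias_error N \<theta> (m + 2 * N) - alias_error N \<theta> m = cos (\<psi> + real N * \<theta>) - cos (\<psi> - real N * \<theta>)"
    using aliased_cos_periodic[OF N, of \<theta> "N + m"] by (simp only: alias_error_def add.assoc)
  also have "\<dots> = (- 2 * sin (real N * \<theta>)) * sin \<psi>"
    by (simp add: cos_add cos_diff)
  finally show ?thesis by (simp only: \<psi>_def)
qed

text \<open>The bound is uniform in m, which makes the weighted energy series converge.\<close>

lemma abs_alias_error_le:
  "\<bar>alias_error N \<theta> m\<bar> \<le> 1 + (\<Sum>k\<le>N. \<bar>interp_weight N k (cos \<theta>)\<bar>)"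
proof -
  have "\<bar>aliased_cos N \<theta> n\<bar> \<le> (\<Sum>k\<le>N. \<bar>interp_weight N k (cos \<theta>)\<bar>)" for n
    unfolding aliased_cos_def
    by (rule order_trans[OF sum_abs sum_mono]) (simp add: abs_mult mult_left_le)
  then show ?thesis
    unfolding alias_error_def by (intro order_trans[OF abs_triangle_ineq4 add_mono]) auto
qed

section \<open>Numerical inequalities\<close>

text \<open>The square is 4 r^N times the energy bound 4r/(1 - r^2); the factor 4 is the square of
  the weight 2 of the coefficients.\<close>

definition err_const :: "nat \<Rightarrow> real \<Rightarrow> real" where
  "err_const N r = 4 * sqrt (r ^ (N + 1) / (1 - r\<^sup>2))"

text \<open>The difference of the two sides vanishes at 1 and has the derivative (x - 1)^2 / (x (x +
  1)^2).\<close>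

lemma ln_le_rational:
  fixes r :: real
  assumes "0 < r" "r \<le> 1"
  shows "ln r \<le> 2 * (r - 1) / (r + 1)"
proof -
  define f where "f r = ln r - 2 * (r - 1) / (r + 1)" for r :: real
  have "f r \<le> f 1"
  proof (rule DERIV_nonneg_imp_nondecreasing[where f = f])
    fix x assume x: "r \<le> x" "x \<le> 1"
    with assms have "0 < x" by linarith
    have "(f has_real_derivative (1 / x - (2 * (x + 1) - 2 * (x - 1)) / ((x + 1) * (x + 1)))) (at x)"
      unfolding f_def using \<open>0 < x\<close> by (auto intro!: derivative_eq_intros)
    moreover have "4 / ((x + 1) * (x + 1)) \<le> 1 / x"
    proof -
      have "0 \<le> (x - 1)\<^sup>2" by simp
      then have "4 * x \<le> (x + 1) * (x + 1)" by (simp add: power2_eq_square algebra_simps)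
      then show ?thesis using \<open>0 < x\<close> by (simp add: divide_le_eq le_divide_eq)
    qed
    ultimately show "\<exists>y. (f has_real_derivative y) (at x) \<and> 0 \<le> y"
      by (intro exI conjI) auto
  qed (use assms in auto)
  then show ?thesis by (simp add: f_def)
qed

lemma exp_1_ge: "exp 1 \<ge> (2.71 :: real)"
proof -
  have "(145 / 128 :: real) \<le> exp (1 / 8)"
    using exp_lower_Taylor_quadratic[of "1 / 8"] by (simp add: power2_eq_square)
  then have "(145 / 128 :: real) ^ 8 \<le> exp (1 / 8) ^ 8" by (intro power_mono) auto
  also have "exp (1 / 8) ^ 8 = exp (1 :: real)" by (simp flip: exp_of_nat_mult)
  finally show ?thesis by (simp add: power_divide)
qed

text \<open>This is the inequality 1 + \<open>err_const\<close> \<le> A after division by A, where t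
  = (1 - r)/(1 + r) and r^(N + 1) has been replaced by an exponential bound.\<close>

lemma interp_norm_numeric:
  fixes t :: real
  assumes t: "0 < t" "t < 1"
  shows "sqrt (t / (1 + t)) + 2 * sqrt (1 + t) * exp (- (1 + 23 / 12 * t)) \<le> 1"
proof -
  \<comment> \<open>17/12 = 23/12 - 1/2, where the 1/2 is spent on sqrt(1 + t) \<le>
    e^(t/2).\<close>
  define x where "x = 17 / 12 * t"
  have x0: "0 \<le> x" using t by (simp add: x_def)
  \<comment> \<open>The tangent of the square root at (9/20)^2, near the point where the left side
    of the claim is largest.\<close>
  have sq: "sqrt s \<le> (s / (9 / 20) + 9 / 20) / 2" if "0 \<le> s" for s :: real
  proof (rule real_le_lsqrt)
    have "0 \<le> (s / (9 / 20) - 9 / 20)\<^sup>2" by simp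
    then show "s \<le> ((s / (9 / 20) + 9 / 20) / 2)\<^sup>2"
      by (simp add: power2_eq_square field_simps)
  qed (use that in auto)
  have "sqrt (t / (1 + t)) \<le> (t / (1 + t) / (9 / 20) + 9 / 20) / 2"
    by (rule sq) (use t in simp)
  also have "\<dots> = 1 - (31 / 40 * (1 + t) - 10 / 9 * t) / (1 + t)"
    using t by (simp add: field_simps)
  finally have 1: "sqrt (t / (1 + t)) \<le> 1 - (31 / 40 * (1 + t) - 10 / 9 * t) / (1 + t)" .
  have "sqrt (1 + t) \<le> exp (t / 2)"
  proof (rule real_le_lsqrt)
    have "1 + t \<le> exp t" by (rule exp_ge_add_one_self)
    also have "exp t = (exp (t / 2))\<^sup>2" by (simp flip: exp_of_nat_mult)
    finally show "1 + t \<le> (exp (t / 2))\<^sup>2" .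
  qed (use t in auto)
  then have "2 * sqrt (1 + t) * exp (- (1 + 23 / 12 * t)) \<le> 2 * exp (t / 2) * exp (- (1 + 23 / 12 * t))"
    by (intro mult_right_mono) auto
  also have "\<dots> = 2 / (exp 1 * exp x)"
  proof -
    have "2 * exp (t / 2) * exp (- (1 + 23 / 12 * t)) = 2 * exp (t / 2 + - (1 + 23 / 12 * t))"
      by (simp only: mult.assoc exp_add)
    also have "t / 2 + - (1 + 23 / 12 * t) = - (1 + x)" by (simp add: x_def)
    also have "2 * exp (- (1 + x)) = 2 / (exp 1 * exp x)"
      by (simp only: exp_minus exp_add divide_inverse)
    finally show ?thesis .
  qed
  also have "\<dots> \<le> 2 / (2.71 * (1 + x + x\<^sup>2 / 2))"
    using exp_1_ge exp_lower_Taylor_quadratic[OF x0] x0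
    by (intro divide_left_mono mult_mono mult_pos_pos) (auto simp: add_pos_nonneg)
  also have "\<dots> \<le> (31 / 40 * (1 + t) - 10 / 9 * t) / (1 + t)"
  proof -
    have "2 * (1 + t) \<le> (31 / 40 * (1 + t) - 10 / 9 * t) * (2.71 * (1 + x + x\<^sup>2 / 2))"
    proof -
      \<comment> \<open>Expanded, the claim is a cubic inequality in t; with these relations it is
        linear in the monomials.\<close>
      have t23: "t * t \<le> t" "t * (t * t) \<le> t * t" "0 \<le> t * t"
        using t by (auto simp: mult_left_le)
      show ?thesis
        unfolding x_def by (simp add: field_simps power2_eq_square) (use t t23 in linarith)
    qed
    moreover have "0 < 2.71 * (1 + x + x\<^sup>2 / 2)" using x0 by (simp add: add_pos_nonneg)
    ultimately show ?thesis using t by (simp add: divide_le_eq le_divide_eq pos_le_divide_eq field_simps)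
  qed
  finally show ?thesis using 1 by linarith
qed

text \<open>By hypothesis N + 1/12, the bound for the squared Lebesgue constant, exceeds A^2, so N
  is large. The substitution t = (1 - r)/(1 + r) turns the estimate of the logarithm into ln r \<le>
  -2t and makes 1 - r and 1 - r^2 simple fractions.\<close>

lemma one_plus_err_const_le:
  assumes r: "0 < r" "r < 1" and N: "2 < (1 - r) * (real N + 1 / 12)"
  shows "1 + err_const N r \<le> sqrt (2 / (1 - r))"
proof -
  define t where "t = (1 - r) / (1 + r)"
  have t: "0 < t" "t < 1" using r by (simp_all add: t_def)
  have rt: "1 - r = 2 * t / (1 + t)" and r2: "1 - r\<^sup>2 = 4 * t / (1 + t)\<^sup>2"
    using r by (simp_all add: t_def field_simps power2_eq_square)
  have "2 < 2 * t / (1 + t) * (real N + 1 / 12)" using N by (simp add: rt)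
  \<comment> \<open>Adding 11/12 t to both sides gives t (N + 1) > 1 + 23/12 t, the source of the
    constant 23/12.\<close>
  then have Nt: "1 + t < t * (real N + 1 / 12)"
    using t by (simp add: field_simps)
  have "r ^ (N + 1) = exp (real (N + 1) * ln r)"
    by (simp only: exp_of_nat_mult exp_ln[OF r(1)])
  also have "\<dots> \<le> exp (real (N + 1) * (- 2 * t))"
  proof -
    have "ln r \<le> - 2 * t" using ln_le_rational[of r] r by (simp add: t_def field_simps)
    then show ?thesis by (intro iffD2[OF exp_le_cancel_iff] mult_left_mono) auto
  qed
  also have "\<dots> \<le> exp (2 * (- (1 + 23 / 12 * t)))"
    using Nt by (simp add: algebra_simps)
  also have "\<dots> = (exp (- (1 + 23 / 12 * t)))\<^sup>2"
    by (simp flip: exp_of_nat_mult)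
  finally have rN: "r ^ (N + 1) \<le> (exp (- (1 + 23 / 12 * t)))\<^sup>2" .
  have "err_const N r = 4 * (sqrt (r ^ (N + 1)) / sqrt (4 * t / (1 + t)\<^sup>2))"
    by (simp only: err_const_def r2 real_sqrt_divide)
  also have "\<dots> \<le> 4 * (exp (- (1 + 23 / 12 * t)) / sqrt (4 * t / (1 + t)\<^sup>2))"
    using rN t by (intro mult_left_mono divide_right_mono real_le_lsqrt) auto
  also have "sqrt (4 * t / (1 + t)\<^sup>2) = 2 * sqrt t / (1 + t)"
    using t by (simp add: real_sqrt_divide real_sqrt_mult)
  also have "4 * (exp (- (1 + 23 / 12 * t)) / (2 * sqrt t / (1 + t))) =
      sqrt ((1 + t) / t) * (2 * sqrt (1 + t) * exp (- (1 + 23 / 12 * t)))"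
  proof -
    define w where "w = sqrt (1 + t)"
    have "1 + t = w * w" using t by (simp add: w_def)
    moreover have "4 * (E / (2 * s / (w * w))) = w / s * (2 * w * E)" if "0 < s" for E s :: real
      using that by (simp add: field_simps)
    ultimately show ?thesis using t by (simp add: real_sqrt_divide w_def[symmetric])
  qed
  finally have e: "err_const N r \<le> sqrt ((1 + t) / t) * (2 * sqrt (1 + t) * exp (- (1 + 23 / 12 * t)))" .
  have "sqrt ((1 + t) / t) * sqrt (t / (1 + t)) = 1"
    using t by (simp add: real_sqrt_mult[symmetric])
  with e have "1 + err_const N r \<le> sqrt ((1 + t) / t) * (sqrt (t / (1 + t)) + 2 * sqrt (1 + t) * exp (- (1 + 23 / 12 * t)))"
    by (simp add: distrib_left)
  also have "\<dots> \<le> sqrt ((1 + t) / t) * 1"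
    using interp_norm_numeric[OF t] t by (intro mult_left_mono) auto
  also have "sqrt ((1 + t) / t) * 1 = sqrt (2 / (1 - r))"
  proof -
    have "2 / (1 - r) = (1 + t) / t" unfolding rt using t by (simp add: field_simps)
    then show ?thesis by simp
  qed
  finally show ?thesis .
qed

lemma lebesgue_bound_nonneg: "N \<ge> 1 \<Longrightarrow> 0 \<le> lebesgue_bound N"
  using lebesgue_bound_power2_le(1)[of N] by (cases "N = 1") (auto simp: lebesgue_bound_def)

lemma min_interp_norm_le:
  assumes r: "0 < r" "r < 1" and N: "N \<ge> 1"
  shows "min (lebesgue_bound N) (1 + err_const N r) \<le> sqrt (2 / (1 - r))"
proof (cases "2 < (1 - r) * (real N + 1 / 12)")
  case True
  then show ?thesis using one_plus_err_const_le[OF r] by (simp add: min.coboundedI2)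
next
  case False
  have "(lebesgue_bound N)\<^sup>2 \<le> 2 / (1 - r)"
  proof (cases "N = 1")
    case True
    have "(lebesgue_bound N)\<^sup>2 \<le> 1.28\<^sup>2"
      using True lebesgue_bound_1 lebesgue_bound_nonneg[of 1] by (intro power_mono) auto
    also have "\<dots> \<le> 2 / (1 - r)" using r by (simp add: field_simps power2_eq_square)
    finally show ?thesis .
  next
    case False
    then have "(lebesgue_bound N)\<^sup>2 \<le> real N + 1 / 12" using N by (intro lebesgue_bound_power2_le) auto
    also have "\<dots> \<le> 2 / (1 - r)" using \<open>\<not> 2 < _\<close> r by (simp add: field_simps)
    finally show ?thesis .
  qed
  then have "lebesgue_bound N \<le> sqrt (2 / (1 - r))" by (rule real_le_rsqrt)
  then show ?thesis by simp
qed

text \<open>By Bernoulli's inequality r^N > 1/2 forces r \<ge> N/(N + 1), and r/(1 - r^2) is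
  increasing. So the square of the right side is at least 8N (N + 1)/(2N + 1) > 4N, while for N
  \<ge> 2 the square of the left side is at most 2 + 2 (N + 1/12).\<close>

lemma one_plus_lebesgue_bound_le:
  assumes r: "0 < r" "r < 1" and N: "N \<ge> 1" and rN: "1 / 2 < r ^ N"
  shows "1 + lebesgue_bound N \<le> err_const N r"
proof -
  define a where "a = real N / (real N + 1)"
  have "1 + real N * (1 / r - 1) \<le> (1 + (1 / r - 1)) ^ N"
    using r by (intro Bernoulli_inequality) auto
  also have "\<dots> = 1 / r ^ N" by (simp add: power_one_over)
  also have "\<dots> < 2" using rN r by (simp add: field_simps)
  finally have "real N * (1 - r) < r" using r by (simp add: field_simps)
  then have a: "a \<le> r" using N by (simp add: a_def field_simps)
  have a01: "0 < a" "a < 1" using N by (simp_all add: a_def)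
  have pos: "0 < 1 - r\<^sup>2" "0 < 1 - a\<^sup>2" using r a01 by (simp_all add: power_less_one_iff abs_square_less_1)
  have "a * (1 - r\<^sup>2) \<le> r * (1 - a\<^sup>2)"
    using a a01 pos by (intro mult_mono diff_left_mono power_mono) auto
  then have "a / (1 - a\<^sup>2) \<le> r / (1 - r\<^sup>2)"
    using pos by (simp add: field_simps)
  also have "a / (1 - a\<^sup>2) = real N * (real N + 1) / (2 * real N + 1)"
  proof -
    have "1 - a\<^sup>2 = (2 * real N + 1) / (real N + 1)\<^sup>2"
    proof -
      have "1 - a\<^sup>2 = ((real N + 1)\<^sup>2 - (real N)\<^sup>2) / (real N + 1)\<^sup>2"
        by (simp add: a_def power_divide diff_divide_distrib)
      also have "(real N + 1)\<^sup>2 - (real N)\<^sup>2 = 2 * real N + 1"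
        by (simp add: power2_eq_square algebra_simps)
      finally show ?thesis .
    qed
    then show ?thesis by (simp add: a_def power2_eq_square)
  qed
  finally have "8 * (real N * (real N + 1) / (2 * real N + 1)) \<le> 8 * (r / (1 - r\<^sup>2))"
    by (rule mult_left_mono) simp
  also have "\<dots> \<le> 16 * (r ^ (N + 1) / (1 - r\<^sup>2))"
  proof -
    have "1 / 2 * r \<le> r ^ N * r" using rN r by (intro mult_right_mono) auto
    then have "(1 / 2 * r) / (1 - r\<^sup>2) \<le> r ^ (N + 1) / (1 - r\<^sup>2)"
      using pos by (intro divide_right_mono) (auto simp: mult.commute)
    then have "16 * ((1 / 2 * r) / (1 - r\<^sup>2)) \<le> 16 * (r ^ (N + 1) / (1 - r\<^sup>2))"
      by (rule mult_left_mono) simp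
    moreover have "16 * ((1 / 2 * r) / m) = 8 * (r / m)" for m :: real by simp
    ultimately show ?thesis by (simp only:)
  qed
  finally have 1: "8 * (real N * (real N + 1) / (2 * real N + 1)) \<le> 16 * (r ^ (N + 1) / (1 - r\<^sup>2))" .
  have 2: "(1 + lebesgue_bound N)\<^sup>2 \<le> 8 * (real N * (real N + 1) / (2 * real N + 1))"
  proof (cases "N = 1")
    case True
    \<comment> \<open>Here 4N = 4 would be too small: 2.28^2 = 5.1984 is compared with the exact
      value 16/3.\<close>
    have "(1 + lebesgue_bound N)\<^sup>2 \<le> 2.28\<^sup>2"
      using True lebesgue_bound_1 lebesgue_bound_nonneg[of 1] by (intro power_mono) auto
    then show ?thesis using True by (simp add: power2_eq_square)
  next
    case False
    have "0 \<le> (1 - lebesgue_bound N)\<^sup>2" by simp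
    then have "(1 + lebesgue_bound N)\<^sup>2 \<le> 2 + 2 * (lebesgue_bound N)\<^sup>2"
      by (simp add: power2_eq_square algebra_simps)
    also have "\<dots> \<le> 2 + 2 * (real N + 1 / 12)"
      using False N lebesgue_bound_power2_le(2)[of N] by auto
    also have "\<dots> \<le> 4 * real N" using False N by auto
    also have "\<dots> = 8 * (real N * (real N + 1) / (2 * real N + 2))"
      by (simp add: field_simps)
    also have "\<dots> \<le> 8 * (real N * (real N + 1) / (2 * real N + 1))"
      by (intro mult_left_mono divide_left_mono) auto
    finally show ?thesis .
  qed
  from 1 2 have "1 + lebesgue_bound N \<le> sqrt (16 * (r ^ (N + 1) / (1 - r\<^sup>2)))"
    by (intro real_le_rsqrt) linarith
  moreover have "sqrt 16 = 4" by (rule real_sqrt_unique) auto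
  ultimately show ?thesis by (simp only: err_const_def real_sqrt_mult)
qed

section \<open>Interpolation in one variable\<close>

text \<open>sin(N \<theta>) = 0 means that cos \<theta> is a node, where interpolation is exact. The
  nodes are excluded in the estimate of the Lebesgue constant and are treated here.\<close>

lemma alias_error_0: "N \<ge> 1 \<Longrightarrow> sin (real N * \<theta>) = 0 \<Longrightarrow> alias_error N \<theta> m = 0"
proof (induction m rule: less_induct)
  case (less m)
  show ?case
  proof (cases "m < 2 * N")
    case True
    then show ?thesis using less by (simp add: alias_error_init)
  next
    case False
    then show ?thesis
      using less alias_error_step[of N \<theta> "m - 2 * N"] by simp
  qed
qed

lemma alias_error_energy_le:
  fixes r \<theta> :: real
  assumes r: "0 < r" "r < 1" and N: "N \<ge> 1" and y: "r ^ (2 * N) \<le> 1 / 4"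
  shows "(\<Sum>m<n. r ^ m * (alias_error N \<theta> m)\<^sup>2) \<le> 4 * r / (1 - r\<^sup>2)"
proof -
  define h where "h = alias_error N \<theta>"
  have y0: "0 < r ^ (2 * N)" using r by simp
  have h0: "h m = (- 2 * sin (real N * \<theta>)) * sin (real m * \<theta>)" if "m < 2 * N" for m
    using alias_error_init[OF N that] by (simp add: h_def)
  have h1: "h (m + 2 * N) = h m + (- 2 * sin (real N * \<theta>)) * sin (real (m + 2 * N) * \<theta>)" for m
    using alias_error_step[OF N] by (simp add: h_def)
  note eq = aliasing_energy_eq[where h = h, OF r N h0 h1 abs_alias_error_le[of N \<theta>, folded h_def]]
  have "(1 - r ^ (2 * N)) * (\<Sum>m. r ^ m * (h m)\<^sup>2) \<le> (1 - r ^ (2 * N)) * (4 * r / (1 - r\<^sup>2))"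
    using eq(2) aliasing_kernel_le[OF r y0 y, of N \<theta>] by (simp add: power_mult_distrib)
  then have "(\<Sum>m. r ^ m * (h m)\<^sup>2) \<le> 4 * r / (1 - r\<^sup>2)"
    by (rule mult_left_le_imp_le) (use y in simp)
  moreover have "(\<Sum>m<n. r ^ m * (h m)\<^sup>2) \<le> (\<Sum>m. r ^ m * (h m)\<^sup>2)"
    using r by (intro sum_le_suminf eq(1)) auto
  ultimately show ?thesis by (simp add: h_def)
qed

text \<open>G \<theta> stands for g(cos \<theta>), and complex analysis enters only through the
  series and the Bessel inequality. The norm of I is bounded both by the Lebesgue constant and by
  one plus the error, so the error comes first.\<close>

lemma interp_bounds_of_series:
  fixes G :: "real \<Rightarrow> complex" and u :: "nat \<Rightarrow> complex" and R V \<theta> :: real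
  assumes R: "R > 1" and N: "N \<ge> 1" and V: "0 \<le> V"
    and bessel: "\<And>m. (\<Sum>n<m. (norm (u n))\<^sup>2) \<le> V\<^sup>2"
    and series: "\<And>\<theta>. (\<lambda>n. of_real (cheb_weight n * cos (real n * \<theta>) / R ^ n) * u n) sums G \<theta>"
    and bound: "\<And>\<theta>. norm (G \<theta>) \<le> V"
  defines "r \<equiv> 1 / R\<^sup>2"
    and "I \<equiv> (\<Sum>k\<le>N. of_real (interp_weight N k (cos \<theta>)) * G (pi * real k / real N))"
  shows "norm (G \<theta> - I) \<le> err_const N r * V" and "norm I \<le> sqrt (2 / (1 - r)) * V"
proof -
  have r: "0 < r" "r < 1" using R by (simp_all add: r_def)
  have err0: "0 \<le> err_const N r"
    using r by (auto simp: err_const_def power_le_one intro!: divide_nonneg_nonneg)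
  have sqrt1: "1 \<le> sqrt (2 / (1 - r))"
    using r by (intro real_le_rsqrt) (simp add: field_simps)
  define g where "g n = cos (real n * \<theta>) - aliased_cos N \<theta> n" for n
  define a where "a n = cheb_weight n * g n / R ^ n" for n
  have a_sums: "(\<lambda>n. of_real (a n) * u n) sums (G \<theta> - I)"
  proof -
    have "(\<lambda>n. of_real (cheb_weight n * cos (real n * \<theta>) / R ^ n) * u n -
        (\<Sum>k\<le>N. of_real (interp_weight N k (cos \<theta>)) *
          (of_real (cheb_weight n * cos (real n * (pi * real k / real N)) / R ^ n) * u n))) sums (G \<theta> - I)"
      unfolding I_def by (intro sums_diff sums_sum sums_mult series)
    moreover have "of_real (cheb_weight n * cos (real n * \<theta>) / R ^ n) * u n -
        (\<Sum>k\<le>N. of_real (interp_weight N k (cos \<theta>)) *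
          (of_real (cheb_weight n * cos (real n * (pi * real k / real N)) / R ^ n) * u n)) = of_real (a n) * u n" for n
    proof -
      have "(\<Sum>k\<le>N. of_real (interp_weight N k (cos \<theta>)) *
          (of_real (cheb_weight n * cos (real n * (pi * real k / real N)) / R ^ n) * u n)) =
          of_real (cheb_weight n * aliased_cos N \<theta> n / R ^ n) * u n"
        by (simp add: aliased_cos_def sum_distrib_left sum_distrib_right sum_divide_distrib mult_ac)
      then show ?thesis by (simp add: a_def g_def algebra_simps diff_divide_distrib)
    qed
    ultimately show ?thesis by simp
  qed
  have g_le: "g n = 0" if "n \<le> N" for n
    using aliased_cos_le[OF N that] by (simp add: g_def)
  have g_add: "g (N + m) = alias_error N \<theta> m" for m
    by (simp add: g_def alias_error_def)
  have node: "G \<theta> = I" if "sin (real N * \<theta>) = 0"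
  proof -
    have "a n = 0" for n
    proof (cases "n \<le> N")
      case False
      then have "g n = 0" using g_add[of "n - N"] alias_error_0[OF N that] by simp
      then show ?thesis by (simp add: a_def)
    qed (simp add: a_def g_le)
    then have "(\<lambda>n. 0) sums (G \<theta> - I)" using a_sums by simp
    then have "G \<theta> - I = 0" using sums_unique2 sums_zero by blast
    then show ?thesis by simp
  qed
  have lebesgue: "norm I \<le> lebesgue_bound N * V" if "sin (real N * \<theta>) \<noteq> 0"
  proof -
    have "norm I \<le> (\<Sum>k\<le>N. \<bar>interp_weight N k (cos \<theta>)\<bar> * V)"
      unfolding I_def by (rule sum_norm_le) (auto simp: norm_mult intro!: mult_left_mono bound)
    also have "\<dots> \<le> lebesgue_bound N * V"
      unfolding sum_distrib_right[symmetric]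
      by (intro mult_right_mono sum_abs_interp_weight_le N that V)
    finally show ?thesis .
  qed
  have small: "norm (G \<theta> - I) \<le> err_const N r * V" if y: "r ^ (2 * N) \<le> 1 / 4"
  proof -
    \<comment> \<open>The factor R^(-2n) = r^n at n = N + i splits into r^N r^i, and the frequencies
      below N drop out.\<close>
    have sq: "(\<Sum>n<m. (a n)\<^sup>2) \<le> (err_const N r)\<^sup>2" for m
    proof -
      have a2: "(a (N + i))\<^sup>2 = 4 * r ^ N * (r ^ i * (alias_error N \<theta> i)\<^sup>2)" for i
        using N by (simp add: a_def g_add cheb_weight_def r_def power_divide power_mult_distrib power_add
            power_one_over mult_ac flip: power_mult)
      have "(\<Sum>n<m. (a n)\<^sup>2) \<le> (\<Sum>n<N + m. (a n)\<^sup>2)"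
        by (intro sum_mono2) auto
      also have "\<dots> = (\<Sum>n<N. (a n)\<^sup>2) + (\<Sum>i<m. (a (N + i))\<^sup>2)"
        by (induction m) (simp_all add: add.assoc)
      also have "(\<Sum>n<N. (a n)\<^sup>2) = 0"
        by (simp add: a_def g_le)
      also have "(\<Sum>i<m. (a (N + i))\<^sup>2) = 4 * r ^ N * (\<Sum>i<m. r ^ i * (alias_error N \<theta> i)\<^sup>2)"
        unfolding a2 by (rule sum_distrib_left[symmetric])
      also have "\<dots> \<le> 4 * r ^ N * (4 * r / (1 - r\<^sup>2))"
        using r alias_error_energy_le[OF r N y] by (intro mult_left_mono) auto
      also have "\<dots> = (err_const N r)\<^sup>2"
        using r by (simp add: err_const_def power_mult_distrib power_le_one mult_ac)
      finally show ?thesis by simp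
    qed
    have part: "norm (\<Sum>n<m. of_real (a n) * u n) \<le> err_const N r * V" for m
    proof -
      have "norm (\<Sum>n<m. of_real (a n) * u n) \<le> (\<Sum>n<m. \<bar>a n\<bar> * norm (u n))"
        by (rule sum_norm_le) (simp add: norm_mult)
      also have "\<dots> \<le> err_const N r * V"
      proof (rule power2_le_imp_le)
        have "(\<Sum>n<m. \<bar>a n\<bar> * norm (u n))\<^sup>2 \<le> (\<Sum>n<m. \<bar>a n\<bar>\<^sup>2) * (\<Sum>n<m. (norm (u n))\<^sup>2)"
          by (rule Cauchy_Schwarz_ineq_sum)
        also have "\<dots> \<le> (err_const N r)\<^sup>2 * V\<^sup>2"
          using sq[of m] bessel[of m] by (intro mult_mono) (auto intro: sum_nonneg)
        finally show "(\<Sum>n<m. \<bar>a n\<bar> * norm (u n))\<^sup>2 \<le> (err_const N r * V)\<^sup>2"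
          by (simp add: power_mult_distrib)
      qed (use err0 V in simp)
      finally show ?thesis .
    qed
    have "(\<lambda>m. norm (\<Sum>n<m. of_real (a n) * u n)) \<longlonglongrightarrow> norm (G \<theta> - I)"
      using a_sums unfolding sums_def by (rule tendsto_norm)
    then show ?thesis
      by (rule LIMSEQ_le_const2) (use part in auto)
  qed
  show err: "norm (G \<theta> - I) \<le> err_const N r * V"
  proof (cases "r ^ (2 * N) \<le> 1 / 4 \<or> sin (real N * \<theta>) = 0")
    case True
    then show ?thesis using small node err0 V by auto
  next
    case False
    \<comment> \<open>In this case the energy estimate does not apply, but the trivial bound by one
      plus the Lebesgue constant is already below the claim.\<close>
    have "1 / 2 < r ^ N"
    proof (rule power2_less_imp_less)
      show "(1 / 2)\<^sup>2 < (r ^ N)\<^sup>2"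
        using False by (simp add: power2_eq_square mult_2 power_add)
    qed (use r in simp)
    from one_plus_lebesgue_bound_le[OF r N this]
    have "V + lebesgue_bound N * V \<le> err_const N r * V"
      using V mult_right_mono by (fastforce simp: distrib_right)
    moreover have "norm (G \<theta> - I) \<le> V + lebesgue_bound N * V"
      using False lebesgue bound by (intro order_trans[OF norm_triangle_ineq4 add_mono]) auto
    ultimately show ?thesis by linarith
  qed
  show "norm I \<le> sqrt (2 / (1 - r)) * V"
  proof (cases "sin (real N * \<theta>) = 0")
    case True
    then have "norm I \<le> 1 * V" using node bound[of \<theta>] by simp
    also have "\<dots> \<le> sqrt (2 / (1 - r)) * V" using sqrt1 V by (rule mult_right_mono)
    finally show ?thesis .
  next
    case False
    have "norm I \<le> norm (G \<theta>) + norm (G \<theta> - I)"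
      using norm_triangle_ineq4[of "G \<theta>" "G \<theta> - I"] by simp
    then have "norm I \<le> (1 + err_const N r) * V"
      using bound[of \<theta>] err by (simp add: distrib_right)
    then have "norm I \<le> min (lebesgue_bound N) (1 + err_const N r) * V"
      using lebesgue[OF False] by (simp add: min_def)
    also have "\<dots> \<le> sqrt (2 / (1 - r)) * V"
      using min_interp_norm_le[OF r N] V by (intro mult_right_mono)
    finally show ?thesis .
  qed
qed

definition cheb_interp1 :: "nat \<Rightarrow> (complex \<Rightarrow> complex) \<Rightarrow> real \<Rightarrow> complex" where
  "cheb_interp1 N g x =
     (\<Sum>k\<le>N. of_real (interp_weight N k x) * g (of_real (cos (pi * real k / real N))))"

text \<open>There are no values of g on the boundary ellipse, since g lives on the open region. The
  series is taken on a smaller ellipse with R < \<rho>, and R tends to \<rho> in both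
  bounds.\<close>

lemma cheb_interp1_bounds:
  assumes \<rho>: "\<rho> > 1" and N: "N \<ge> 1" and g: "g holomorphic_on bernstein_std \<rho>"
    and V: "\<And>z. z \<in> bernstein_std \<rho> \<Longrightarrow> norm (g z) \<le> V" and x: "\<bar>x\<bar> \<le> 1"
  shows "norm (g (of_real x) - cheb_interp1 N g x) \<le> err_const N (1 / \<rho>\<^sup>2) * V"
    and "norm (cheb_interp1 N g x) \<le> sqrt (2 / (1 - 1 / \<rho>\<^sup>2)) * V"
proof -
  have V0: "0 \<le> V"
    using V[OF of_real_mem_bernstein_std[OF \<rho> x]] norm_ge_zero order_trans by blast
  define \<theta> where "\<theta> = arccos x"
  have \<theta>: "cos \<theta> = x" using x by (simp add: \<theta>_def)
  have cos_mem: "cos (of_real \<phi>) \<in> bernstein_std \<rho>" for \<phi>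
    using of_real_mem_bernstein_std[OF \<rho>, of "cos \<phi>"] by (simp add: cos_of_real)
  have R_bounds: "norm (g (of_real x) - cheb_interp1 N g x) \<le> err_const N (1 / R\<^sup>2) * V \<and>
      norm (cheb_interp1 N g x) \<le> sqrt (2 / (1 - 1 / R\<^sup>2)) * V" if R: "1 < R" "R < \<rho>" for R
  proof -
    define u where "u = fourier_coeff (\<lambda>t. g (ellipse_path R t))"
    have mem: "ellipse_path R t \<in> bernstein_std \<rho>" for t
      by (rule ellipse_path_mem_bernstein_std[OF R])
    have "continuous_on {0..1} (\<lambda>t. g (ellipse_path R t))"
      using R mem by (intro continuous_on_compose2[OF holomorphic_on_imp_continuous_on[OF g]] continuous_intros) auto
    then have bessel: "(\<Sum>n<m. (norm (u n))\<^sup>2) \<le> V\<^sup>2" for m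
      unfolding u_def using V[OF mem] by (rule bessel_inequality)
    have series: "(\<lambda>n. of_real (cheb_weight n * cos (real n * \<phi>) / R ^ n) * u n) sums g (cos (of_real \<phi>))" for \<phi>
      unfolding u_def using \<rho>
      by (intro chebyshev_series[OF open_bernstein_std convex_bernstein_std g R(1) mem cos_mem])
    note b = interp_bounds_of_series[OF R(1) N V0 bessel series V[OF cos_mem], of \<theta>]
    have "(\<Sum>k\<le>N. of_real (interp_weight N k (cos \<theta>)) * g (cos (of_real (pi * real k / real N)))) = cheb_interp1 N g x"
      unfolding cheb_interp1_def \<theta> by (simp only: cos_of_real)
    with b show ?thesis by (simp add: cos_of_real \<theta> del: of_real_mult of_real_divide)
  qed
  have \<rho>2: "1 < \<rho>\<^sup>2" using \<rho> by simp
  have ev: "eventually (\<lambda>R. 1 < R \<and> R < \<rho>) (at_left \<rho>)"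
    using \<rho> by (intro eventually_at_leftI[of 1]) auto
  have "1 / \<rho>\<^sup>2 < 1" using \<rho>2 by (metis divide_less_eq_1_pos less_trans zero_less_one)
  moreover from this have "(1 / \<rho>\<^sup>2)\<^sup>2 < 1"
    unfolding abs_square_less_1 using \<rho>2 by simp
  ultimately have pos: "1 - (1 / \<rho>\<^sup>2)\<^sup>2 \<noteq> 0" "1 - 1 / \<rho>\<^sup>2 \<noteq> 0" "\<rho>\<^sup>2 \<noteq> 0"
    using \<rho>2 by linarith+
  have t1: "((\<lambda>R. err_const N (1 / R\<^sup>2) * V) \<longlongrightarrow> err_const N (1 / \<rho>\<^sup>2) * V) (at_left \<rho>)"
    unfolding err_const_def using pos by (intro tendsto_intros) auto
  have t2: "((\<lambda>R. sqrt (2 / (1 - 1 / R\<^sup>2)) * V) \<longlongrightarrow> sqrt (2 / (1 - 1 / \<rho>\<^sup>2)) * V) (at_left \<rho>)"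
    using pos by (intro tendsto_intros) auto
  show "norm (g (of_real x) - cheb_interp1 N g x) \<le> err_const N (1 / \<rho>\<^sup>2) * V"
    by (rule tendsto_lowerbound[OF t1]) (use ev R_bounds in \<open>auto elim!: eventually_mono\<close>)
  show "norm (cheb_interp1 N g x) \<le> sqrt (2 / (1 - 1 / \<rho>\<^sup>2)) * V"
    by (rule tendsto_lowerbound[OF t2]) (use ev R_bounds in \<open>auto elim!: eventually_mono\<close>)
qed

section \<open>Tensorization\<close>

text \<open>Interpolation in the coordinates from A only; the others remain complex, so that the
  result can be a holomorphic function of them. Points are functions, which makes
  \<open>v(a := \<zeta>)\<close> a slice.\<close>

definition tensor_interp ::
    "('d \<Rightarrow> nat) \<Rightarrow> 'd set \<Rightarrow> (('d \<Rightarrow> complex) \<Rightarrow> complex) \<Rightarrow> ('d \<Rightarrow> complex) \<Rightarrow> complex" where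
  "tensor_interp N A g v =
     (\<Sum>k\<in>PiE A (\<lambda>i. {..N i}). of_real (\<Prod>i\<in>A. interp_weight (N i) (k i) (Re (v i))) *
        g (\<lambda>i. if i \<in> A then of_real (cos (pi * real (k i) / real (N i))) else v i))"

lemma tensor_interp_empty [simp]: "tensor_interp N {} g v = g v"
  by (simp add: tensor_interp_def)

lemma tensor_interp_insert:
  assumes "finite A" "a \<notin> A"
  shows "tensor_interp N (insert a A) g v =
    cheb_interp1 (N a) (\<lambda>\<zeta>. tensor_interp N A g (v(a := \<zeta>))) (Re (v a))"
proof -
  define B where "B = (\<lambda>i. {..N i})"
  define c where "c i n = complex_of_real (cos (pi * real n / real (N i)))" for i n
  define f where "f k = of_real (\<Prod>i\<in>insert a A. interp_weight (N i) (k i) (Re (v i))) *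
      g (\<lambda>i. if i \<in> insert a A then c i (k i) else v i)" for k
  have "tensor_interp N (insert a A) g v = (\<Sum>k\<in>PiE (insert a A) B. f k)"
    by (simp only: tensor_interp_def B_def f_def c_def)
  also have "\<dots> = (\<Sum>(n, k)\<in>B a \<times> PiE A B. f (k(a := n)))"
    unfolding PiE_insert_eq using inj_combinator[OF assms(2), of B]
    by (subst sum.reindex) (simp_all add: case_prod_unfold o_def)
  also have "\<dots> = (\<Sum>n\<in>B a. \<Sum>k\<in>PiE A B. f (k(a := n)))"
    by (rule sum.cartesian_product[symmetric])
  also have "\<dots> = (\<Sum>n\<in>B a. of_real (interp_weight (N a) n (Re (v a))) * tensor_interp N A g (v(a := c a n)))"
  proof (intro sum.cong refl)
    fix n
    have fk: "f (k(a := n)) = of_real (interp_weight (N a) n (Re (v a))) *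
        (of_real (\<Prod>i\<in>A. interp_weight (N i) (k i) (Re ((v(a := c a n)) i))) *
          g (\<lambda>i. if i \<in> A then c i (k i) else (v(a := c a n)) i))" for k
    proof -
      have "(\<Prod>i\<in>insert a A. interp_weight (N i) ((k(a := n)) i) (Re (v i))) =
          interp_weight (N a) n (Re (v a)) * (\<Prod>i\<in>A. interp_weight (N i) (k i) (Re ((v(a := c a n)) i)))"
        using assms by (auto intro!: prod.cong)
      moreover have "(\<lambda>i. if i \<in> insert a A then c i ((k(a := n)) i) else v i) =
          (\<lambda>i. if i \<in> A then c i (k i) else (v(a := c a n)) i)"
        using assms by (auto simp: fun_eq_iff)
      ultimately show ?thesis by (simp only: f_def of_real_mult mult.assoc)
    qed
    show "(\<Sum>k\<in>PiE A B. f (k(a := n))) =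
        of_real (interp_weight (N a) n (Re (v a))) * tensor_interp N A g (v(a := c a n))"
      unfolding fk sum_distrib_left[symmetric] by (simp only: tensor_interp_def B_def c_def)
  qed
  also have "\<dots> = cheb_interp1 (N a) (\<lambda>\<zeta>. tensor_interp N A g (v(a := \<zeta>))) (Re (v a))"
    by (simp add: cheb_interp1_def B_def c_def)
  finally show ?thesis .
qed

lemma cheb_interp1_diff:
  "cheb_interp1 N g x - cheb_interp1 N h x = cheb_interp1 N (\<lambda>z. g z - h z) x"
  by (simp add: cheb_interp1_def sum_subtractf right_diff_distrib)

fun tensor_bound :: "('d \<Rightarrow> real) \<Rightarrow> ('d \<Rightarrow> real) \<Rightarrow> 'd list \<Rightarrow> real" where
  "tensor_bound e M [] = 0"
| "tensor_bound e M (a # as) = e a + M a * tensor_bound e M as"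

text \<open>Telescoping \<open>1 - I\<^sub>a I = (1 - I\<^sub>a) + I\<^sub>a (1 - I)\<close>: the
  operator \<open>I\<^sub>a\<close> is applied to a function of one complex variable that is
  bounded on the whole ellipse by the error in the remaining coordinates.\<close>

lemma tensor_interp_error:
  fixes S :: "'d \<Rightarrow> complex set"
  assumes one: "\<And>i \<phi> W x. \<phi> holomorphic_on S i \<Longrightarrow> (\<And>z. z \<in> S i \<Longrightarrow> norm (\<phi> z) \<le> W) \<Longrightarrow> \<bar>x\<bar> \<le> 1 \<Longrightarrow>
      norm (\<phi> (of_real x) - cheb_interp1 (N i) \<phi> x) \<le> e i * W \<and> norm (cheb_interp1 (N i) \<phi> x) \<le> M i * W"
    and real: "\<And>i x. \<bar>x\<bar> \<le> 1 \<Longrightarrow> of_real x \<in> S i"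
    and hol: "\<And>v i. (\<And>j. v j \<in> S j) \<Longrightarrow> (\<lambda>\<zeta>. g (v(i := \<zeta>))) holomorphic_on S i"
    and bound: "\<And>v. (\<And>j. v j \<in> S j) \<Longrightarrow> norm (g v) \<le> V"
  shows "distinct as \<Longrightarrow> (\<And>j. v j \<in> S j) \<Longrightarrow> (\<And>i. i \<in> set as \<Longrightarrow> v i = of_real (Re (v i)) \<and> \<bar>Re (v i)\<bar> \<le> 1) \<Longrightarrow>
    norm (g v - tensor_interp N (set as) g v) \<le> V * tensor_bound e M as"
proof (induction as arbitrary: v)
  case (Cons a as)
  define x where "x = Re (v a)"
  define \<phi> where "\<phi> \<zeta> = g (v(a := \<zeta>))" for \<zeta>
  define \<psi> where "\<psi> \<zeta> = tensor_interp N (set as) g (v(a := \<zeta>))" for \<zeta>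
  have a: "a \<notin> set as" using Cons.prems(1) by simp
  have x: "v a = of_real x" "\<bar>x\<bar> \<le> 1" using Cons.prems(3)[of a] by (auto simp: x_def)
  have upd: "(v(a := \<zeta>)) j \<in> S j" if "\<zeta> \<in> S a" for \<zeta> j
    using that Cons.prems(2) by simp
  have \<phi>: "\<phi> holomorphic_on S a"
    unfolding \<phi>_def by (rule hol[OF Cons.prems(2)])
  \<comment> \<open>\<open>Re\<close> is taken only at coordinates in \<open>as\<close>, so the
    weights do not depend on \<zeta>, and \<psi> is a finite combination of slices of g.\<close>
  have \<psi>: "\<psi> holomorphic_on S a"
  proof -
    have "(\<lambda>\<zeta>. \<Sum>k\<in>PiE (set as) (\<lambda>i. {..N i}). of_real (\<Prod>i\<in>set as. interp_weight (N i) (k i) (Re (v i))) *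
        g ((\<lambda>i. if i \<in> set as then of_real (cos (pi * real (k i) / real (N i))) else v i)(a := \<zeta>))) holomorphic_on S a"
      using Cons.prems(2) real
      by (intro holomorphic_on_sum holomorphic_on_mult holomorphic_on_const hol) auto
    moreover have "(\<lambda>i. if i \<in> set as then of_real (cos (pi * real (k i) / real (N i))) else v i)(a := \<zeta>) =
        (\<lambda>i. if i \<in> set as then of_real (cos (pi * real (k i) / real (N i))) else (v(a := \<zeta>)) i)" for k \<zeta>
      using a by (auto simp: fun_eq_iff)
    moreover have "(\<Prod>i\<in>set as. interp_weight (N i) (k i) (Re (v i))) =
        (\<Prod>i\<in>set as. interp_weight (N i) (k i) (Re ((v(a := \<zeta>)) i)))" for k \<zeta>
      using a by (intro prod.cong) auto
    ultimately show ?thesis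
      unfolding \<psi>_def tensor_interp_def by (simp only:)
  qed
  have diff: "norm (\<phi> \<zeta> - \<psi> \<zeta>) \<le> V * tensor_bound e M as" if "\<zeta> \<in> S a" for \<zeta>
    unfolding \<phi>_def \<psi>_def using Cons.prems a that by (intro Cons.IH) auto
  have "g v - tensor_interp N (set (a # as)) g v = (\<phi> (of_real x) - cheb_interp1 (N a) \<phi> x) +
      cheb_interp1 (N a) (\<lambda>\<zeta>. \<phi> \<zeta> - \<psi> \<zeta>) x"
  proof -
    have "g v = \<phi> (of_real x)" unfolding \<phi>_def x(1)[symmetric] by simp
    moreover have "tensor_interp N (set (a # as)) g v = cheb_interp1 (N a) \<psi> x"
      using tensor_interp_insert[OF _ a] by (simp add: \<psi>_def[abs_def] x_def)
    ultimately show ?thesis by (simp flip: cheb_interp1_diff)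
  qed
  also have "norm \<dots> \<le> e a * V + M a * (V * tensor_bound e M as)"
    using one[OF \<phi> _ x(2), of V] one[OF holomorphic_on_diff[OF \<phi> \<psi>] diff x(2)] bound upd
    by (intro norm_triangle_mono) (auto simp: \<phi>_def)
  finally show ?case by (simp add: algebra_simps)
qed simp

lemma tensor_bound_eq_sum:
  "tensor_bound e M as = (\<Sum>k<length as. e (as ! k) * (\<Prod>j<k. M (as ! j)))"
proof (induction as)
  case (Cons a as)
  then show ?case
    by (simp add: sum.lessThan_Suc_shift prod.lessThan_Suc_shift sum_distrib_left mult_ac del: sum.lessThan_Suc prod.lessThan_Suc)
qed simp

lemma tensor_bound_order:
  "tensor_bound e M (map \<sigma> [1..<Suc D]) = (\<Sum>k = 1..D. e (\<sigma> k) * (\<Prod>j = 1..k - 1. M (\<sigma> j)))"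
proof -
  have "tensor_bound e M (map \<sigma> [1..<Suc D]) = (\<Sum>k<D. e (\<sigma> (Suc k)) * (\<Prod>j<k. M (\<sigma> (Suc j))))"
    unfolding tensor_bound_eq_sum by (intro sum.cong arg_cong2[of _ _ _ _ "(*)"] prod.cong)
      (auto simp del: upt_Suc)
  also have "\<dots> = (\<Sum>k = 1..D. e (\<sigma> k) * (\<Prod>j = 1..k - 1. M (\<sigma> j)))"
    by (simp add: sum.atLeast1_atMost_eq prod.atLeast1_atMost_eq)
  finally show ?thesis .
qed

lemma cauchy_schwarz_2:
  fixes a b c d :: real
  shows "a * b + c * d \<le> sqrt (a\<^sup>2 + c\<^sup>2) * sqrt (b\<^sup>2 + d\<^sup>2)"
proof -
  have "0 \<le> (a * d - c * b)\<^sup>2" by simp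
  then have "(a * b + c * d)\<^sup>2 \<le> (a\<^sup>2 + c\<^sup>2) * (b\<^sup>2 + d\<^sup>2)"
    by (simp add: power2_eq_square algebra_simps)
  then show ?thesis by (simp add: real_le_rsqrt real_sqrt_mult[symmetric])
qed

text \<open>The -1 under the root makes the induction close: Cauchy-Schwarz for the pairs (t_a, sqrt
  T) and (sqrt(P_a - 1), sqrt(P_a (X - 1))) produces (P_a - 1) + P_a (X - 1) = P_a X - 1.\<close>

lemma tensor_bound_le_sqrt:
  assumes e: "\<And>i. 0 \<le> e i \<and> e i \<le> 2 * t i * sqrt (P i - 1)" and t: "\<And>i. 0 \<le> t i" and P: "\<And>i. 1 \<le> P i"
  shows "distinct as \<Longrightarrow> tensor_bound e (\<lambda>i. sqrt (P i)) as \<le>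
    2 * sqrt (\<Sum>i\<in>set as. (t i)\<^sup>2) * sqrt ((\<Prod>i\<in>set as. P i) - 1)"
proof (induction as)
  case (Cons a as)
  define T X where "T = (\<Sum>i\<in>set as. (t i)\<^sup>2)" and "X = (\<Prod>i\<in>set as. P i)"
  have T: "0 \<le> T" unfolding T_def by (intro sum_nonneg) auto
  have X: "1 \<le> X" unfolding X_def using P by (intro prod_ge_1)
  have P0: "0 \<le> P a" using P[of a] by linarith
  have "tensor_bound e (\<lambda>i. sqrt (P i)) (a # as) \<le> 2 * t a * sqrt (P a - 1) + sqrt (P a) * (2 * sqrt T * sqrt (X - 1))"
    using Cons e[of a] P0 by (auto simp: T_def X_def intro!: add_mono mult_left_mono)
  also have "\<dots> = 2 * (t a * sqrt (P a - 1) + sqrt T * (sqrt (P a) * sqrt (X - 1)))"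
    by (simp add: algebra_simps)
  also have "\<dots> \<le> 2 * (sqrt ((t a)\<^sup>2 + (sqrt T)\<^sup>2) * sqrt ((sqrt (P a - 1))\<^sup>2 + (sqrt (P a) * sqrt (X - 1))\<^sup>2))"
    by (intro mult_left_mono cauchy_schwarz_2) simp
  also have "(sqrt (P a - 1))\<^sup>2 + (sqrt (P a) * sqrt (X - 1))\<^sup>2 = P a * X - 1"
    using P[of a] X P0 by (simp add: power_mult_distrib algebra_simps)
  finally show ?case using Cons.prems T by (simp add: T_def X_def)
qed simp

section \<open>The tensor interpolant in terms of one-variable weights\<close>

lemma cheb_idx_eq: "cheb_idx N = PiE UNIV (\<lambda>i. {..N i})"
  by (auto simp: cheb_idx_def PiE_UNIV_domain)

text \<open>After exchanging the sums over coefficients and nodes, the sum over multi-indices j of a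
  product factorizes into one-variable sums, which are the weights.\<close>

lemma cheb_interp_std_eq:
  "cheb_interp_std N f x = (\<Sum>k\<in>cheb_idx N. (\<Prod>i\<in>UNIV. interp_weight (N i) (k i) (x $ i)) * f (cheb_node N k))"
proof -
  have "cheb_interp_std N f x = (\<Sum>j\<in>cheb_idx N. \<Sum>k\<in>cheb_idx N.
      (\<Prod>i\<in>UNIV. cheb_half (N i) (k i)) * f (cheb_node N k) *
      (\<Prod>i\<in>UNIV. cheb_double (N i) (j i) / real (N i) * (cos (real (j i) * pi * (real (k i) / real (N i))) * cheb_T (j i) (x $ i))))"
    unfolding cheb_interp_std_def cheb_coeff_def cheb_half_def cheb_double_def sum_distrib_left sum_distrib_right prod.distrib
    by (intro sum.cong refl) (simp add: mult_ac)
  also have "\<dots> = (\<Sum>k\<in>cheb_idx N. (\<Prod>i\<in>UNIV. cheb_half (N i) (k i)) * f (cheb_node N k) *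
      (\<Sum>j\<in>cheb_idx N. \<Prod>i\<in>UNIV. cheb_double (N i) (j i) / real (N i) * (cos (real (j i) * pi * (real (k i) / real (N i))) * cheb_T (j i) (x $ i))))"
    unfolding sum_distrib_left by (rule sum.swap)
  also have "\<dots> = (\<Sum>k\<in>cheb_idx N. (\<Prod>i\<in>UNIV. interp_weight (N i) (k i) (x $ i)) * f (cheb_node N k))"
  proof (intro sum.cong refl)
    fix k
    have "(\<Sum>j\<in>cheb_idx N. \<Prod>i\<in>UNIV. cheb_double (N i) (j i) / real (N i) * (cos (real (j i) * pi * (real (k i) / real (N i))) * cheb_T (j i) (x $ i))) =
        (\<Prod>i\<in>UNIV. \<Sum>j\<le>N i. cheb_double (N i) j / real (N i) * (cos (real j * pi * (real (k i) / real (N i))) * cheb_T j (x $ i)))"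
      unfolding cheb_idx_eq by (subst prod_sum_PiE) auto
    then show "(\<Prod>i\<in>UNIV. cheb_half (N i) (k i)) * f (cheb_node N k) *
      (\<Sum>j\<in>cheb_idx N. \<Prod>i\<in>UNIV. cheb_double (N i) (j i) / real (N i) * (cos (real (j i) * pi * (real (k i) / real (N i))) * cheb_T (j i) (x $ i))) =
      (\<Prod>i\<in>UNIV. interp_weight (N i) (k i) (x $ i)) * f (cheb_node N k)"
      by (simp add: interp_weight_def prod.distrib mult_ac)
  qed
  finally show ?thesis .
qed

lemma tensor_interp_UNIV:
  fixes f :: "real ^ 'd::finite \<Rightarrow> real"
  assumes "\<And>k. g (\<lambda>i. of_real (cheb_node N k $ i)) = of_real (f (cheb_node N k))"
  shows "tensor_interp N UNIV g (\<lambda>i. of_real (x $ i)) = of_real (cheb_interp_std N f x)"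
  using assms by (simp add: tensor_interp_def cheb_interp_std_eq cheb_idx_eq cheb_node_def)

section \<open>Power series in several variables\<close>

text \<open>On a line parallel to the i-th axis every monomial containing another variable vanishes,
  while factors 0^0 count as 1. So only the powers of the i-th variable remain.\<close>

lemma monomial_sum_single_coord:
  fixes c :: "('d::finite \<Rightarrow> nat) \<Rightarrow> complex" and z :: "complex ^ 'd"
  assumes "((\<lambda>\<alpha>. c \<alpha> * (\<Prod>j\<in>UNIV. ((\<chi> j. if j = i then \<zeta> else z $ j) $ j - z $ j) ^ \<alpha> j)) has_sum s) UNIV"
  shows "(\<lambda>n. c (\<lambda>j. if j = i then n else 0) * (\<zeta> - z $ i) ^ n) sums s"
proof -
  define e :: "nat \<Rightarrow> 'd \<Rightarrow> nat" where "e n = (\<lambda>j. if j = i then n else 0)" for n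
  define T where "T \<alpha> = c \<alpha> * (\<Prod>j\<in>UNIV. ((\<chi> j. if j = i then \<zeta> else z $ j) $ j - z $ j) ^ \<alpha> j)" for \<alpha>
  have inj: "inj e" by (rule injI) (metis e_def)
  have zero: "T \<alpha> = 0" if "\<alpha> \<notin> range e" for \<alpha>
  proof -
    have "\<exists>j. j \<noteq> i \<and> \<alpha> j \<noteq> 0"
    proof (rule ccontr)
      assume "\<not> ?thesis"
      then have "\<alpha> = e (\<alpha> i)" by (auto simp: e_def fun_eq_iff)
      then show False using that by blast
    qed
    then have "(\<Prod>j\<in>UNIV. ((\<chi> j. if j = i then \<zeta> else z $ j) $ j - z $ j) ^ \<alpha> j) = 0"
      by (auto simp: prod_zero_iff)
    then show ?thesis by (simp add: T_def)
  qed
  have "(T has_sum s) UNIV" using assms by (simp add: T_def[abs_def])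
  then have "(T has_sum s) (range e)"
    by (rule has_sum_cong_neutral[THEN iffD1, rotated -1]) (use zero in auto)
  then have "((T \<circ> e) has_sum s) UNIV"
    using has_sum_reindex[OF inj, of T s] by simp
  moreover have "(T \<circ> e) n = c (e n) * (\<zeta> - z $ i) ^ n" for n
  proof -
    have "(\<Prod>j\<in>UNIV. ((\<chi> j. if j = i then \<zeta> else z $ j) $ j - z $ j) ^ e n j) =
        (\<Prod>j\<in>UNIV. if j = i then (\<zeta> - z $ i) ^ n else 1)"
      by (intro prod.cong) (auto simp: e_def)
    then show ?thesis by (simp add: T_def)
  qed
  ultimately have "((\<lambda>n. c (e n) * (\<zeta> - z $ i) ^ n) has_sum s) UNIV"
    by (simp add: o_def)
  then show ?thesis
    unfolding e_def by (rule has_sum_imp_sums)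
qed

lemma norm_vec_le_sum:
  fixes x :: "'a::real_normed_vector ^ 'd::finite"
  shows "norm x \<le> (\<Sum>j\<in>UNIV. norm (x $ j))"
  unfolding norm_vec_def by (rule L2_set_le_sum) simp

lemma multi_analytic_imp_slice_differentiable:
  fixes F :: "complex ^ 'd::finite \<Rightarrow> complex"
  assumes F: "multi_analytic_on F S" and z: "z \<in> S"
  shows "(\<lambda>\<zeta>. F (\<chi> j. if j = i then \<zeta> else z $ j)) field_differentiable (at (z $ i))"
proof -
  obtain e c where e: "e > 0" and c: "\<And>w. w \<in> ball z e \<Longrightarrow>
      ((\<lambda>\<alpha>. c \<alpha> * (\<Prod>j\<in>UNIV. (w $ j - z $ j) ^ \<alpha> j)) has_sum F w) UNIV"
    using F z unfolding multi_analytic_on_def by meson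
  have mem: "(\<chi> j. if j = i then \<zeta> else z $ j) \<in> ball z e" if "\<zeta> \<in> ball (z $ i) e" for \<zeta>
  proof -
    have "norm (z - (\<chi> j. if j = i then \<zeta> else z $ j)) \<le> (\<Sum>j\<in>UNIV. if j = i then norm (z $ i - \<zeta>) else 0)"
      by (rule order_trans[OF norm_vec_le_sum], intro sum_mono) auto
    then show ?thesis using that by (simp add: dist_norm)
  qed
  have "(\<lambda>\<zeta>. F (\<chi> j. if j = i then \<zeta> else z $ j)) holomorphic_on ball (z $ i) e"
  proof (rule power_series_holomorphic)
    fix \<zeta> assume "\<zeta> \<in> ball (z $ i) e"
    then show "(\<lambda>n. c (\<lambda>j. if j = i then n else 0) * (\<zeta> - z $ i) ^ n) sums F (\<chi> j. if j = i then \<zeta> else z $ j)"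
      by (intro monomial_sum_single_coord c mem)
  qed
  then show ?thesis
    using e by (simp add: holomorphic_on_imp_differentiable_at)
qed

text \<open>Absolute convergence at one point, displaced by \<delta> in every coordinate, gives a
  finite C = \<Sum> |c_\<alpha>| \<delta>^|\<alpha>|. If w differs from z by at most \<epsilon>
  \<delta> with \<epsilon> \<le> 1, each nonconstant monomial is at most \<epsilon> times its
  modulus at that point, and a Lipschitz estimate at z follows.\<close>

lemma multi_analytic_imp_isCont:
  fixes F :: "complex ^ 'd::finite \<Rightarrow> complex"
  assumes F: "multi_analytic_on F S" and z: "z \<in> S"
  shows "isCont F z"
proof -
  obtain e c where e: "e > 0" and c: "\<And>w. w \<in> ball z e \<Longrightarrow>
      ((\<lambda>\<alpha>. c \<alpha> * (\<Prod>j\<in>UNIV. (w $ j - z $ j) ^ \<alpha> j)) has_sum F w) UNIV"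
    using F z unfolding multi_analytic_on_def by meson
  define \<delta> where "\<delta> = e / (2 * real CARD('d))"
  have \<delta>: "\<delta> > 0" using e by (simp add: \<delta>_def)
  define w0 where "w0 = (\<chi> j. z $ j + of_real \<delta>)"
  have "norm (w0 - z) \<le> (\<Sum>j\<in>UNIV. norm ((w0 - z) $ j))"
    by (rule norm_vec_le_sum)
  also have "\<dots> = real CARD('d) * \<delta>" using \<delta> by (simp add: w0_def)
  also have "\<dots> < e" using e by (simp add: \<delta>_def)
  finally have "w0 \<in> ball z e" by (simp add: dist_norm norm_minus_commute)
  from c[OF this] have "(\<lambda>\<alpha>. c \<alpha> * (\<Prod>j\<in>UNIV. (w0 $ j - z $ j) ^ \<alpha> j)) summable_on UNIV"
    by (auto simp: summable_on_def)
  then have "(\<lambda>\<alpha>. norm (c \<alpha> * (\<Prod>j\<in>UNIV. (w0 $ j - z $ j) ^ \<alpha> j))) summable_on UNIV"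
    by (simp only: summable_on_iff_abs_summable_on_complex)
  moreover have "norm (c \<alpha> * (\<Prod>j\<in>UNIV. (w0 $ j - z $ j) ^ \<alpha> j)) = norm (c \<alpha>) * (\<Prod>j\<in>UNIV. \<delta> ^ \<alpha> j)" for \<alpha>
    using \<delta> by (simp add: w0_def norm_mult norm_power prod_norm[symmetric])
  ultimately have summ: "(\<lambda>\<alpha>. norm (c \<alpha>) * (\<Prod>j\<in>UNIV. \<delta> ^ \<alpha> j)) summable_on UNIV"
    by simp
  define C where "C = (\<Sum>\<^sub>\<infinity>\<alpha>. norm (c \<alpha>) * (\<Prod>j\<in>UNIV. \<delta> ^ \<alpha> j))"
  have lip: "norm (F w - F z) \<le> C * (norm (w - z) / \<delta>)" if w: "norm (w - z) < min \<delta> e" for w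
  proof -
    define \<epsilon> where "\<epsilon> = norm (w - z) / \<delta>"
    have \<epsilon>: "0 \<le> \<epsilon>" "\<epsilon> \<le> 1" using w \<delta> by (auto simp: \<epsilon>_def)
    have wb: "w \<in> ball z e" and zb: "z \<in> ball z e" using w e by (auto simp: dist_norm norm_minus_commute)
    have "((\<lambda>\<alpha>. c \<alpha> * (\<Prod>j\<in>UNIV. (w $ j - z $ j) ^ \<alpha> j) - c \<alpha> * (\<Prod>j\<in>UNIV. (z $ j - z $ j) ^ \<alpha> j)) has_sum (F w - F z)) UNIV"
    proof -
      have "((\<lambda>\<alpha>. - (c \<alpha> * (\<Prod>j\<in>UNIV. (z $ j - z $ j) ^ \<alpha> j))) has_sum - F z) UNIV"
        unfolding has_sum_uminus minus_minus by (rule c[OF zb])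
      from has_sum_add[OF c[OF wb] this] show ?thesis by simp
    qed
    moreover have "((\<lambda>\<alpha>. norm (c \<alpha>) * (\<Prod>j\<in>UNIV. \<delta> ^ \<alpha> j) * \<epsilon>) has_sum (C * \<epsilon>)) UNIV"
      unfolding C_def by (intro has_sum_cmult_left has_sum_infsum summ)
    ultimately show ?thesis
      unfolding \<epsilon>_def[symmetric]
    proof (rule norm_infsum_le)
      fix \<alpha> :: "'d \<Rightarrow> nat"
      show "norm (c \<alpha> * (\<Prod>j\<in>UNIV. (w $ j - z $ j) ^ \<alpha> j) - c \<alpha> * (\<Prod>j\<in>UNIV. (z $ j - z $ j) ^ \<alpha> j)) \<le>
          norm (c \<alpha>) * (\<Prod>j\<in>UNIV. \<delta> ^ \<alpha> j) * \<epsilon>"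
      proof (cases "\<alpha> = (\<lambda>_. 0)")
        case True
        then show ?thesis using \<epsilon> by simp
      next
        case False
        then obtain i where i: "\<alpha> i \<noteq> 0" by (auto simp: fun_eq_iff)
        then have zero: "(\<Prod>j\<in>UNIV. (z $ j - z $ j) ^ \<alpha> j) = 0"
          by (auto simp: prod_zero_iff)
        have "norm (\<Prod>j\<in>UNIV. (w $ j - z $ j) ^ \<alpha> j) \<le> (\<Prod>j\<in>UNIV. \<delta> ^ \<alpha> j) * \<epsilon>"
        proof -
          have comp: "norm (w $ j - z $ j) \<le> \<epsilon> * \<delta>" for j
            using Finite_Cartesian_Product.norm_nth_le[of "w - z" j] \<delta> by (simp add: \<epsilon>_def)
          have "norm (\<Prod>j\<in>UNIV. (w $ j - z $ j) ^ \<alpha> j) = (\<Prod>j\<in>UNIV. norm (w $ j - z $ j) ^ \<alpha> j)"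
            by (simp add: prod_norm[symmetric] norm_power)
          also have "\<dots> \<le> (\<Prod>j\<in>UNIV. (\<epsilon> * \<delta>) ^ \<alpha> j)"
            using comp by (intro prod_mono conjI power_mono) auto
          also have "\<dots> = (\<Prod>j\<in>UNIV. \<delta> ^ \<alpha> j) * (\<Prod>j\<in>UNIV. \<epsilon> ^ \<alpha> j)"
            by (simp add: power_mult_distrib prod.distrib)
          also have "(\<Prod>j\<in>UNIV. \<epsilon> ^ \<alpha> j) \<le> \<epsilon>"
          proof -
            have "(\<Prod>j\<in>UNIV. \<epsilon> ^ \<alpha> j) = \<epsilon> ^ \<alpha> i * (\<Prod>j\<in>UNIV - {i}. \<epsilon> ^ \<alpha> j)"
              by (rule prod.remove) auto
            also have "\<dots> \<le> \<epsilon> * 1"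
              using \<epsilon> i power_decreasing[of 1 "\<alpha> i" \<epsilon>]
              by (intro mult_mono prod_le_1 prod_nonneg) (auto simp: power_le_one)
            finally show ?thesis by simp
          qed
          finally show ?thesis using \<delta> by (simp add: mult_left_mono prod_nonneg)
        qed
        then show ?thesis
          unfolding zero mult_zero_right diff_zero norm_mult mult.assoc by (rule mult_left_mono) simp
      qed
    qed
  qed
  have "((\<lambda>w. C * (norm (w - z) / \<delta>)) \<longlongrightarrow> C * (norm (z - z) / \<delta>)) (at z)"
    using \<delta> by (intro tendsto_intros) auto
  then have "((\<lambda>w. C * (norm (w - z) / \<delta>)) \<longlongrightarrow> 0) (at z)" by simp
  moreover have "eventually (\<lambda>w. norm (F w - F z) \<le> C * (norm (w - z) / \<delta>)) (at z)"
  proof -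
    have "eventually (\<lambda>w. dist w z < min \<delta> e) (at z)"
      using \<delta> e by (auto simp: eventually_at intro!: exI[of _ "min \<delta> e"])
    then show ?thesis by eventually_elim (rule lip, simp add: dist_norm)
  qed
  ultimately have "((\<lambda>w. F w - F z) \<longlongrightarrow> 0) (at z)"
    by (rule Lim_null_comparison[rotated])
  then show ?thesis by (simp add: isCont_def LIM_zero_iff)
qed

section \<open>The error bounds in several variables\<close>

lemma tau_of_real: "tau l u (of_real x) = of_real (tau l u x)"
  unfolding tau_def by (simp only: of_real_add of_real_mult of_real_diff of_real_1 of_real_eq_id id_apply)

lemma tau_field_differentiable: "tau l u field_differentiable (at (z::complex))"
  unfolding tau_def[abs_def] by (intro derivative_intros)

lemma inv_tau_vec:
  fixes l u :: "real ^ 'd"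
  assumes "\<forall>i. l $ i < u $ i"
  shows "inv (tau_vec l u) = (\<lambda>y. \<chi> i. 1 - 2 * (u $ i - y $ i) / (u $ i - l $ i))"
proof (rule inv_equality)
  have ne: "u $ i - l $ i \<noteq> 0" for i using assms by (metis less_irrefl right_minus_eq)
  show "(\<chi> i. 1 - 2 * (u $ i - tau_vec l u x $ i) / (u $ i - l $ i)) = x" for x
    using ne by (simp add: vec_eq_iff tau_vec_def tau_def field_simps)
  show "tau_vec l u (\<chi> i. 1 - 2 * (u $ i - y $ i) / (u $ i - l $ i)) = y" for y
    using ne by (simp add: vec_eq_iff tau_vec_def tau_def field_simps)
qed

lemma inv_tau_vec_cbox:
  fixes l u y :: "real ^ 'd"
  assumes lu: "\<forall>i. l $ i < u $ i" and y: "y \<in> cbox l u"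
  shows "tau_vec l u (inv (tau_vec l u) y) = y" and "\<bar>inv (tau_vec l u) y $ i\<bar> \<le> 1"
proof -
  have ne: "u $ i - l $ i \<noteq> 0" for i using lu by (metis less_irrefl right_minus_eq)
  show "tau_vec l u (inv (tau_vec l u) y) = y"
    unfolding inv_tau_vec[OF lu] using ne by (simp add: vec_eq_iff tau_vec_def tau_def field_simps)
  have "l $ i \<le> y $ i" "y $ i \<le> u $ i" using y by (simp_all add: mem_box_cart)
  then have "0 \<le> (u $ i - y $ i) / (u $ i - l $ i)" "(u $ i - y $ i) / (u $ i - l $ i) \<le> 1"
    using lu[rule_format, of i] by (simp_all add: divide_le_eq)
  then show "\<bar>inv (tau_vec l u) y $ i\<bar> \<le> 1"
    unfolding inv_tau_vec[OF lu] vec_lambda_beta times_divide_eq_right[symmetric] abs_le_iff by linarith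
qed

lemma tau_vec_cbox:
  fixes l u x :: "real ^ 'd"
  assumes lu: "\<forall>i. l $ i < u $ i" and x: "\<And>i. \<bar>x $ i\<bar> \<le> 1"
  shows "tau_vec l u x \<in> cbox l u"
proof -
  have "l $ i \<le> tau (l $ i) (u $ i) (x $ i) \<and> tau (l $ i) (u $ i) (x $ i) \<le> u $ i" for i
  proof -
    define p where "p = (u $ i - l $ i) * ((1 - x $ i) / 2)"
    have eq: "tau (l $ i) (u $ i) (x $ i) = u $ i - p"
      by (simp add: p_def tau_def field_simps)
    have x2: "0 \<le> (1 - x $ i) / 2" "(1 - x $ i) / 2 \<le> 1" using x[of i] by auto
    have "0 \<le> p"
      unfolding p_def using lu[rule_format, of i] x2 by (intro mult_nonneg_nonneg) auto
    moreover have "p \<le> (u $ i - l $ i) * 1"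
      unfolding p_def using lu[rule_format, of i] x2 by (intro mult_left_mono) auto
    ultimately show ?thesis by (simp add: eq)
  qed
  then show ?thesis by (simp add: mem_box_cart tau_vec_def)
qed

lemma continuous_on_cheb_T: "continuous_on A (\<lambda>x::real. cheb_T n x)"
proof (induction n rule: induct_nat_012)
  case (ge2 n)
  then show ?case by (simp del: of_nat_Suc) (intro continuous_intros)
qed (auto intro: continuous_intros)

lemma continuous_on_cheb_interp:
  fixes l u :: "real ^ 'd::finite"
  assumes "\<forall>i. l $ i < u $ i"
  shows "continuous_on A (cheb_interp l u N f)"
proof -
  have ne: "u $ i - l $ i \<noteq> 0" for i using assms by (metis less_irrefl right_minus_eq)
  have w: "continuous_on A (\<lambda>y. interp_weight N k (h y))" if "continuous_on A h" for N k h
    unfolding interp_weight_def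
    by (intro continuous_intros continuous_on_compose2[OF continuous_on_cheb_T[of UNIV] that]) auto
  show ?thesis
    unfolding cheb_interp_def o_def cheb_interp_std_eq inv_tau_vec[OF assms]
    using ne by (auto intro!: continuous_intros w)
qed

section \<open>The one-variable constants against the two bounds\<close>

lemma err_const_le_a:
  assumes "\<rho> > 1"
  shows "err_const N (1 / \<rho>\<^sup>2) \<le> 4 * (\<rho> powi (- int N) / (\<rho> - 1))"
proof -
  define q where "q = 1 / \<rho>"
  have q: "0 < q" "q < 1" using assms by (simp_all add: q_def)
  have q4: "q ^ 4 < 1" using q by (simp add: power_less_one_iff)
  \<comment> \<open>Estimating the root of 1 - q^4 from below by 1 - q recovers the classical error,
    the sum of a geometric series of coefficient bounds.\<close>
  have "(1 - q)\<^sup>2 \<le> 1 * (1 - q)"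
    unfolding power2_eq_square using q by (intro mult_right_mono) auto
  also have "\<dots> \<le> 1 - (q\<^sup>2)\<^sup>2"
    using q power_decreasing[of 1 4 q] by simp
  finally have "1 - q \<le> sqrt (1 - (q\<^sup>2)\<^sup>2)" by (rule real_le_rsqrt)
  have "err_const N (1 / \<rho>\<^sup>2) = 4 * (q ^ (N + 1) / sqrt (1 - (q\<^sup>2)\<^sup>2))"
  proof -
    have "(q\<^sup>2) ^ (N + 1) = (q ^ (N + 1))\<^sup>2" by (simp only: power_mult[symmetric] mult.commute)
    then show ?thesis
      using q by (simp add: err_const_def real_sqrt_divide q_def power_one_over[symmetric])
  qed
  also have "\<dots> \<le> 4 * (q ^ (N + 1) / (1 - q))"
    using \<open>1 - q \<le> _\<close> q q4 by (intro mult_left_mono divide_left_mono mult_pos_pos) auto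
  also have "q ^ (N + 1) / (1 - q) = \<rho> powi (- int N) / (\<rho> - 1)"
  proof -
    have "\<rho> powi (- int N) = q ^ N" by (simp add: power_int_minus q_def power_inverse inverse_eq_divide power_one_over)
    moreover have "1 - q = (\<rho> - 1) * q" using assms by (simp add: q_def field_simps)
    ultimately show ?thesis using q by simp
  qed
  finally show ?thesis .
qed

text \<open>Since 2/(1 - r) - 1 = (1 + r)/(1 - r), the claim amounts to 4r \<le> (1 + r)^2.\<close>

lemma err_const_le_b:
  assumes r: "0 < r" "r < 1" "r = q\<^sup>2" "0 \<le> q"
  shows "err_const N r \<le> 2 * q ^ N * sqrt (2 / (1 - r) - 1)"
proof -
  have "4 * (r ^ (N + 1) / (1 - r\<^sup>2)) \<le> r ^ N * (2 / (1 - r) - 1)"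
  proof -
    have "0 \<le> (1 - r)\<^sup>2" by simp
    then have "4 * r \<le> (1 + r) * (1 + r)" by (simp add: power2_eq_square algebra_simps)
    then have "4 * r / ((1 - r) * (1 + r)) \<le> (1 + r) * (1 + r) / ((1 - r) * (1 + r))"
      using r by (intro divide_right_mono) auto
    also have "\<dots> = (1 + r) / (1 - r)" using r(1,2) by simp
    also have "\<dots> = 2 / (1 - r) - 1" using r(1,2) by (simp add: field_simps)
    finally have "r ^ N * (4 * r / ((1 - r) * (1 + r))) \<le> r ^ N * (2 / (1 - r) - 1)"
      using r by (intro mult_left_mono) auto
    moreover have "(1 - r) * (1 + r) = 1 - r\<^sup>2" by (simp add: power2_eq_square algebra_simps)
    ultimately show ?thesis by (simp add: mult_ac)
  qed
  then have "sqrt (4 * (r ^ (N + 1) / (1 - r\<^sup>2))) \<le> sqrt (r ^ N * (2 / (1 - r) - 1))"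
    by (rule real_sqrt_le_mono)
  moreover have "sqrt (r ^ N) = q ^ N"
  proof (rule real_sqrt_unique)
    show "(q ^ N)\<^sup>2 = r ^ N" unfolding r(3) by (simp only: power_mult[symmetric] mult.commute)
  qed (use r(4) in simp)
  moreover have "sqrt 4 = (2 :: real)" by (rule real_sqrt_unique) auto
  ultimately show ?thesis by (simp only: err_const_def real_sqrt_mult)
qed

lemma sqrt_le_interp_norm:
  assumes "\<rho> > 1"
  shows "sqrt (2 / (1 - 1 / \<rho>\<^sup>2)) \<le> 2 / (1 - 1 / \<rho>)"
proof (rule real_le_lsqrt)
  define q where "q = 1 / \<rho>"
  have q: "0 < q" "q < 1" using assms by (simp_all add: q_def)
  have "2 / ((1 - q) * (1 + q)) \<le> 4 / ((1 - q) * (1 - q))"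
  proof -
    have "2 * ((1 - q) * (1 - q)) \<le> 4 * ((1 - q) * (1 + q))"
      using q by (simp add: algebra_simps) (smt (verit) mult_less_cancel_right2)
    then show ?thesis using q by (simp add: divide_le_eq le_divide_eq mult_ac)
  qed
  moreover have "(1 - q) * (1 + q) = 1 - 1 / \<rho>\<^sup>2"
    by (simp add: q_def power2_eq_square algebra_simps)
  ultimately show "2 / (1 - 1 / \<rho>\<^sup>2) \<le> (2 / (1 - 1 / \<rho>))\<^sup>2"
    by (simp add: q_def power2_eq_square)
qed (use assms in auto)

lemma coord_orders_finite: "finite (coord_orders :: (nat \<Rightarrow> 'd::finite) set)"
  unfolding coord_orders_def by (rule finite_subset[of _ "{1..CARD('d)} \<rightarrow>\<^sub>E UNIV"]) (auto intro: finite_PiE)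

lemma coord_orders_nonempty: "(coord_orders :: (nat \<Rightarrow> 'd::finite) set) \<noteq> {}"
proof -
  obtain h where h: "bij_betw h {1..CARD('d)} (UNIV :: 'd set)"
    using ex_bij_betw_nat_finite_1[of "UNIV :: 'd set"] by auto
  have "bij_betw (restrict h {1..CARD('d)}) {1..CARD('d)} UNIV"
    using h by (subst bij_betw_cong[of _ _ h]) auto
  then have "restrict h {1..CARD('d)} \<in> coord_orders"
    by (simp add: coord_orders_def)
  then show ?thesis by blast
qed

lemma coord_orders_list:
  assumes "\<sigma> \<in> (coord_orders :: (nat \<Rightarrow> 'd::finite) set)"
  shows "distinct (map \<sigma> [1..<Suc CARD('d)])" and "set (map \<sigma> [1..<Suc CARD('d)]) = UNIV"
proof -
  have b: "bij_betw \<sigma> {1..CARD('d)} UNIV" using assms by (simp add: coord_orders_def)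
  have s: "set [1..<Suc CARD('d)] = {1..CARD('d)}" by auto
  show "distinct (map \<sigma> [1..<Suc CARD('d)])"
    unfolding distinct_map s using b by (simp add: bij_betw_def del: upt_Suc)
  show "set (map \<sigma> [1..<Suc CARD('d)]) = UNIV"
    unfolding set_map s using b by (simp add: bij_betw_def)
qed

text \<open>The norms 2/(1 - 1/\<rho>) produce 2^(k-1) over the product in the denominator. The term
  k = 1 is absorbed by the first sum of \<open>bound_a\<close>, the others by the second one,
  because (k - 1) + 2^(k-1) - 1 \<ge> 1 for k \<ge> 2.\<close>

lemma tensor_bound_le_bound_a:
  fixes \<rho> :: "real ^ 'd::finite"
  assumes \<rho>: "\<forall>i. \<rho> $ i > 1" and V: "0 \<le> V"
    and all: "\<And>\<sigma>. \<sigma> \<in> coord_orders \<Longrightarrow> X \<le> V * tensor_bound (\<lambda>i. 4 * (\<rho> $ i powi (- int (N i)) / (\<rho> $ i - 1)))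
      (\<lambda>i. 2 / (1 - 1 / \<rho> $ i)) (map \<sigma> [1..<Suc CARD('d)])"
  shows "X \<le> bound_a V \<rho> N"
  unfolding bound_a_def
proof (subst Min_ge_iff, goal_cases)
  case 3
  show ?case
  proof (rule ballI, clarify)
    fix \<sigma> :: "nat \<Rightarrow> 'd" assume \<sigma>: "\<sigma> \<in> coord_orders"
    define E where "E k = \<rho> $ \<sigma> k powi (- int (N (\<sigma> k))) / (\<rho> $ \<sigma> k - 1)" for k
    define P where "P k = (\<Prod>j = 1..k - 1. 1 - 1 / (\<rho> $ \<sigma> j))" for k
    define D where "D = CARD('d)"
    have D: "1 \<le> D" by (simp add: D_def Suc_le_eq)
    have E: "0 \<le> E k" for k
      using \<rho>[rule_format, of "\<sigma> k"] by (simp add: E_def)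
    have P: "0 < P k" for k
    proof -
      have "1 / \<rho> $ i < 1" for i using \<rho>[rule_format, of i] by simp
      then show ?thesis unfolding P_def by (intro prod_pos) auto
    qed
    have M: "(\<Prod>j = 1..k - 1. 2 / (1 - 1 / \<rho> $ \<sigma> j)) = 2 ^ (k - 1) / P k" for k
      by (simp add: P_def prod_dividef)
    have "X \<le> V * (\<Sum>k = 1..D. 4 * E k * (2 ^ (k - 1) / P k))"
      using all[OF \<sigma>] unfolding tensor_bound_order E_def[symmetric] M D_def[symmetric] .
    also have "\<dots> = V * (4 * E 1) + (\<Sum>k = 2..D. 4 * V * E k * 2 ^ (k - 1) * (1 / P k))"
    proof -
      have "{1..D} = insert 1 {2..D}" using D by auto
      then show ?thesis by (simp add: P_def sum_distrib_left algebra_simps)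
    qed
    also have "\<dots> \<le> (\<Sum>i = 1..D. 4 * V * E i) + (\<Sum>k = 2..D. 4 * V * E k * 2 ^ (k - 1) * (((real k - 1) + 2 ^ (k - 1) - 1) / P k))"
    proof (intro add_mono sum_mono)
      have "4 * V * E 1 \<le> (\<Sum>i = 1..D. 4 * V * E i)"
        using D V E by (intro member_le_sum) auto
      then show "V * (4 * E 1) \<le> (\<Sum>i = 1..D. 4 * V * E i)" by simp
      fix k assume k: "k \<in> {2..D}"
      have "(1::real) \<le> 2 ^ (k - 1)" by simp
      moreover have "1 \<le> real k - 1" using k by simp
      ultimately have "1 \<le> (real k - 1) + 2 ^ (k - 1) - 1" by linarith
      then have "1 / P k \<le> ((real k - 1) + 2 ^ (k - 1) - 1) / P k"
        by (rule divide_right_mono[OF _ less_imp_le[OF P]])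
      then show "4 * V * E k * 2 ^ (k - 1) * (1 / P k) \<le> 4 * V * E k * 2 ^ (k - 1) * (((real k - 1) + 2 ^ (k - 1) - 1) / P k)"
        using V E[of k] by (intro mult_left_mono) auto
    qed
    finally show "X \<le> (\<Sum>i = 1..CARD('d). 4 * V * (\<rho> $ \<sigma> i powi (- int (N (\<sigma> i))) / (\<rho> $ \<sigma> i - 1))) +
        (\<Sum>k = 2..CARD('d). 4 * V * (\<rho> $ \<sigma> k powi (- int (N (\<sigma> k))) / (\<rho> $ \<sigma> k - 1)) *
           2 ^ (k - 1) * (((real k - 1) + 2 ^ (k - 1) - 1) / (\<Prod>j = 1..k - 1. 1 - 1 / (\<rho> $ \<sigma> j))))"
      by (simp only: E_def P_def D_def)
  qed
qed (use coord_orders_finite coord_orders_nonempty in auto)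

text \<open>Dropping the -1 under the root leaves \<Prod> 2/(1 - r_j), and the root of its factor
  2^D gives the exponent D/2 in \<open>bound_b\<close>.\<close>

lemma tensor_bound_le_bound_b:
  fixes \<rho> :: "real ^ 'd::finite"
  assumes \<rho>: "\<forall>i. \<rho> $ i > 1" and V: "0 \<le> V" and as: "distinct as" "set as = UNIV"
  shows "V * tensor_bound (\<lambda>i. err_const (N i) (1 / (\<rho> $ i)\<^sup>2)) (\<lambda>i. sqrt (2 / (1 - 1 / (\<rho> $ i)\<^sup>2))) as \<le> bound_b V \<rho> N"
proof -
  define P where "P i = 2 / (1 - 1 / (\<rho> $ i)\<^sup>2)" for i
  define t where "t i = (1 / \<rho> $ i) ^ N i" for i
  define Q where "Q = (\<Prod>j\<in>UNIV. 1 / (1 - \<rho> $ j powi (- 2)))"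
  have r: "0 < 1 / (\<rho> $ i)\<^sup>2" "1 / (\<rho> $ i)\<^sup>2 < 1" "1 / (\<rho> $ i)\<^sup>2 = (1 / \<rho> $ i)\<^sup>2" "0 \<le> 1 / \<rho> $ i" for i
  proof -
    have "1 < (\<rho> $ i)\<^sup>2" "0 < \<rho> $ i" using \<rho>[rule_format, of i] by auto
    then show "0 < 1 / (\<rho> $ i)\<^sup>2" "1 / (\<rho> $ i)\<^sup>2 < 1" "1 / (\<rho> $ i)\<^sup>2 = (1 / \<rho> $ i)\<^sup>2" "0 \<le> 1 / \<rho> $ i"
      by (auto simp: power_one_over divide_less_eq)
  qed
  have P1: "1 \<le> P i" for i
    using r(1,2)[of i] by (simp add: P_def le_divide_eq)
  have "tensor_bound (\<lambda>i. err_const (N i) (1 / (\<rho> $ i)\<^sup>2)) (\<lambda>i. sqrt (P i)) as \<le>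
      2 * sqrt (\<Sum>i\<in>set as. (t i)\<^sup>2) * sqrt ((\<Prod>i\<in>set as. P i) - 1)"
  proof (rule tensor_bound_le_sqrt)
    show "0 \<le> err_const (N i) (1 / (\<rho> $ i)\<^sup>2) \<and> err_const (N i) (1 / (\<rho> $ i)\<^sup>2) \<le> 2 * t i * sqrt (P i - 1)" for i
    proof
      show "0 \<le> err_const (N i) (1 / (\<rho> $ i)\<^sup>2)"
        using r(1,2)[of i] unfolding err_const_def
        by (intro mult_nonneg_nonneg real_sqrt_ge_zero divide_nonneg_nonneg) (auto simp: power_le_one)
      show "err_const (N i) (1 / (\<rho> $ i)\<^sup>2) \<le> 2 * t i * sqrt (P i - 1)"
        unfolding t_def P_def by (rule err_const_le_b[OF r])
    qed
    show "0 \<le> t i" for i using r(4)[of i] by (simp add: t_def)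
  qed (use P1 as in auto)
  also have "\<dots> \<le> 2 * sqrt (\<Sum>i\<in>set as. (t i)\<^sup>2) * sqrt (\<Prod>i\<in>set as. P i)"
    by (intro mult_left_mono real_sqrt_le_mono) (auto intro: sum_nonneg)
  also have "(\<Prod>i\<in>set as. P i) = 2 ^ CARD('d) * Q"
  proof -
    have "P i = 2 * (1 / (1 - \<rho> $ i powi (- 2)))" for i
      by (simp add: P_def power_int_minus inverse_eq_divide)
    then show ?thesis unfolding as(2) Q_def by (simp only: prod.distrib) simp
  qed
  also have "2 * sqrt (\<Sum>i\<in>set as. (t i)\<^sup>2) * sqrt (2 ^ CARD('d) * Q) =
      2 powr (real CARD('d) / 2 + 1) * sqrt (\<Sum>i\<in>UNIV. \<rho> $ i powi (- 2 * int (N i)) * Q)"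
  proof -
    have "(t i)\<^sup>2 = \<rho> $ i powi (- 2 * int (N i))" for i
    proof -
      have "\<rho> $ i powi (- 2 * int (N i)) = \<rho> $ i powi (- int (2 * N i))" by simp
      also have "\<dots> = 1 / (\<rho> $ i) ^ (2 * N i)"
        unfolding power_int_minus power_int_of_nat by (simp add: inverse_eq_divide)
      finally show ?thesis
        by (simp add: t_def power_one_over power_mult[symmetric] mult.commute)
    qed
    moreover have "sqrt (2 ^ CARD('d)) = 2 powr (real CARD('d) / 2)"
      by (simp add: powr_half_sqrt[symmetric] powr_realpow[symmetric] powr_powr)
    ultimately show ?thesis
      by (simp add: as(2) real_sqrt_mult sum_distrib_right[symmetric] powr_add)
  qed
  finally have "V * tensor_bound (\<lambda>i. err_const (N i) (1 / (\<rho> $ i)\<^sup>2)) (\<lambda>i. sqrt (P i)) as \<le>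
      V * (2 powr (real CARD('d) / 2 + 1) * sqrt (\<Sum>i\<in>UNIV. \<rho> $ i powi (- 2 * int (N i)) * Q))"
    using V by (rule mult_left_mono)
  then show ?thesis by (simp add: bound_b_def P_def Q_def mult_ac)
qed

text \<open>The maximum is expressed through a point where it is attained; such a point exists
  because f inherits continuity from its analytic extension.\<close>

theorem theorem2p1:
  fixes f :: "real ^ 'd::finite \<Rightarrow> real"
    and F :: "complex ^ 'd \<Rightarrow> complex"
    and l u \<rho> :: "real ^ 'd"
    and N :: "'d \<Rightarrow> nat"
    and V :: real
  assumes "\<forall>i. l $ i < u $ i"
    and "\<forall>i. N i \<ge> 1"
    and "\<forall>i. \<rho> $ i > 1"
    and "multi_analytic_on F (gen_bernstein l u \<rho>)"
    and "\<forall>x\<in>cbox l u. F (\<chi> i. complex_of_real (x $ i)) = complex_of_real (f x)"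
    and "\<forall>z\<in>gen_bernstein l u \<rho>. cmod (F z) \<le> V"
  shows "\<exists>x\<in>cbox l u.
    (\<forall>y\<in>cbox l u. \<bar>f y - cheb_interp l u N f y\<bar> \<le> \<bar>f x - cheb_interp l u N f x\<bar>) \<and>
    \<bar>f x - cheb_interp l u N f x\<bar> \<le> min (bound_a V \<rho> N) (bound_b V \<rho> N)"
proof -
  note lu = assms(1) and N = assms(2) and \<rho> = assms(3) and F = assms(4) and Ff = assms(5) and FV = assms(6)
  define S where "S i = bernstein_std (\<rho> $ i)" for i
  define g where "g v = F (\<chi> i. tau (l $ i) (u $ i) (v i))" for v :: "'d \<Rightarrow> complex"
  have mem: "(\<chi> i. tau (l $ i) (u $ i) (v i)) \<in> gen_bernstein l u \<rho>" if "\<And>j. v j \<in> S j" for v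
    using that by (simp add: gen_bernstein_def bernstein_def S_def)
  have real: "of_real x \<in> S i" if "\<bar>x\<bar> \<le> 1" for i x
    unfolding S_def by (intro of_real_mem_bernstein_std that) (use \<rho> in auto)
  have bound: "cmod (g v) \<le> V" if "\<And>j. v j \<in> S j" for v
    unfolding g_def using FV mem[OF that] by blast
  have V: "0 \<le> V"
    using bound[of "\<lambda>_. 0"] real[of 0] by (simp add: order_trans[OF norm_ge_zero])
  have hol: "(\<lambda>\<zeta>. g (v(i := \<zeta>))) holomorphic_on S i" if v: "\<And>j. v j \<in> S j" for v i
    unfolding holomorphic_on_def
  proof
    fix \<zeta>\<^sub>0 assume \<zeta>\<^sub>0: "\<zeta>\<^sub>0 \<in> S i"
    define z where "z = (\<chi> j. tau (l $ j) (u $ j) ((v(i := \<zeta>\<^sub>0)) j))"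
    have "z \<in> gen_bernstein l u \<rho>"
      unfolding z_def using \<zeta>\<^sub>0 v by (intro mem) auto
    then have "(\<lambda>\<zeta>. F (\<chi> j. if j = i then \<zeta> else z $ j)) field_differentiable (at (tau (l $ i) (u $ i) \<zeta>\<^sub>0))"
      using multi_analytic_imp_slice_differentiable[OF F, of z i] by (simp add: z_def)
    from field_differentiable_compose[OF tau_field_differentiable this]
    have "((\<lambda>\<zeta>. F (\<chi> j. if j = i then \<zeta> else z $ j)) \<circ> tau (l $ i) (u $ i)) field_differentiable (at \<zeta>\<^sub>0)" .
    moreover have "((\<lambda>\<zeta>. F (\<chi> j. if j = i then \<zeta> else z $ j)) \<circ> tau (l $ i) (u $ i)) = (\<lambda>\<zeta>. g (v(i := \<zeta>)))"
      by (auto simp: g_def z_def fun_eq_iff intro!: arg_cong[of _ _ F] simp: vec_eq_iff)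
    ultimately show "(\<lambda>\<zeta>. g (v(i := \<zeta>))) field_differentiable (at \<zeta>\<^sub>0 within S i)"
      by (simp add: field_differentiable_at_within)
  qed
  have embed: "(\<chi> i. tau (l $ i) (u $ i) (of_real (x $ i))) = (\<chi> i. complex_of_real (tau_vec l u x $ i))" for x :: "real ^ 'd"
    by (simp add: tau_vec_def tau_of_real)
  have g_real: "g (\<lambda>i. of_real (x $ i)) = of_real ((f \<circ> tau_vec l u) x)" if "\<And>i. \<bar>x $ i\<bar> \<le> 1" for x :: "real ^ 'd"
    using Ff tau_vec_cbox[OF lu that] by (simp add: g_def embed)
  \<comment> \<open>e and M are left open because the first bound uses cruder values than the
    second.\<close>
  have key: "\<bar>f y - cheb_interp l u N f y\<bar> \<le> V * tensor_bound e M as"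
    if y: "y \<in> cbox l u" and as: "distinct as" "set as = UNIV"
      and e: "\<And>i. err_const (N i) (1 / (\<rho> $ i)\<^sup>2) \<le> e i" and M: "\<And>i. sqrt (2 / (1 - 1 / (\<rho> $ i)\<^sup>2)) \<le> M i"
    for y e M as
  proof -
    define x where "x = inv (tau_vec l u) y"
    define v where "v = (\<lambda>i. complex_of_real (x $ i))"
    have x: "tau_vec l u x = y" "\<bar>x $ i\<bar> \<le> 1" for i
      using inv_tau_vec_cbox[OF lu y] by (auto simp: x_def)
    have "cmod (g v - tensor_interp N (set as) g v) \<le> V * tensor_bound e M as"
    proof (rule tensor_interp_error[where S = S])
      fix i \<phi> W x
      assume \<phi>: "\<phi> holomorphic_on S i" "\<And>z. z \<in> S i \<Longrightarrow> cmod (\<phi> z) \<le> W" and x: "\<bar>x::real\<bar> \<le> 1"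
      have "0 \<le> W" using \<phi>(2)[OF real[OF x]] norm_ge_zero order_trans by blast
      note b = cheb_interp1_bounds[OF _ _ \<phi>[unfolded S_def] x, of "N i"]
      show "cmod (\<phi> (of_real x) - cheb_interp1 (N i) \<phi> x) \<le> e i * W \<and> cmod (cheb_interp1 (N i) \<phi> x) \<le> M i * W"
        using b \<rho> N mult_right_mono[OF e \<open>0 \<le> W\<close>, of i] mult_right_mono[OF M \<open>0 \<le> W\<close>, of i]
        by (auto intro: order_trans)
    qed (use real hol bound as x in \<open>auto simp: v_def\<close>)
    moreover have "g v = of_real (f y)"
      unfolding v_def using g_real[OF x(2)] x(1) by simp
    moreover have "tensor_interp N (set as) g v = of_real (cheb_interp l u N f y)"
      unfolding as(2) v_def cheb_interp_def o_def x_def[symmetric]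
    proof (rule tensor_interp_UNIV)
      fix k
      have "\<bar>cheb_node N k $ i\<bar> \<le> 1" for i by (simp add: cheb_node_def)
      from g_real[OF this]
      show "g (\<lambda>i. of_real (cheb_node N k $ i)) = of_real (f (tau_vec l u (cheb_node N k)))"
        by (simp only: o_def)
    qed
    ultimately show ?thesis
      by (simp flip: of_real_diff)
  qed
  have a: "\<bar>f y - cheb_interp l u N f y\<bar> \<le> bound_a V \<rho> N" if "y \<in> cbox l u" for y
  proof (rule tensor_bound_le_bound_a[OF \<rho> V])
    fix \<sigma> :: "nat \<Rightarrow> 'd" assume "\<sigma> \<in> coord_orders"
    note list = coord_orders_list[OF this]
    show "\<bar>f y - cheb_interp l u N f y\<bar> \<le> V * tensor_bound (\<lambda>i. 4 * (\<rho> $ i powi (- int (N i)) / (\<rho> $ i - 1)))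
        (\<lambda>i. 2 / (1 - 1 / \<rho> $ i)) (map \<sigma> [1..<Suc CARD('d)])"
      by (rule key[OF that list]) (use \<rho> err_const_le_a sqrt_le_interp_norm in auto)
  qed
  have b: "\<bar>f y - cheb_interp l u N f y\<bar> \<le> bound_b V \<rho> N" if "y \<in> cbox l u" for y
  proof -
    \<comment> \<open>The second bound is symmetric in the coordinates, so any enumeration of them
      serves.\<close>
    obtain as where as: "distinct as" "set as = (UNIV :: 'd set)"
      using finite_distinct_list[of "UNIV :: 'd set"] by auto
    show ?thesis
      by (rule order_trans[OF key[OF that as order_refl order_refl] tensor_bound_le_bound_b[OF \<rho> V as]])
  qed
  have cont: "continuous_on (cbox l u) (\<lambda>y. \<bar>f y - cheb_interp l u N f y\<bar>)"
  proof -
    have F_cont: "continuous_on (gen_bernstein l u \<rho>) F"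
      using multi_analytic_imp_isCont[OF F] by (intro continuous_at_imp_continuous_on) blast
    have e_cont: "continuous_on (cbox l u) (\<lambda>y. \<chi> i. complex_of_real (y $ i))"
      by (rule continuous_on_vec_lambda) (intro continuous_intros)
    have sub: "(\<lambda>y. \<chi> i. complex_of_real (y $ i)) ` cbox l u \<subseteq> gen_bernstein l u \<rho>"
    proof clarify
      fix y assume y: "y \<in> cbox l u"
      have "(\<chi> i. tau (l $ i) (u $ i) (of_real (inv (tau_vec l u) y $ i))) \<in> gen_bernstein l u \<rho>"
        by (intro mem real inv_tau_vec_cbox(2)[OF lu y])
      then show "(\<chi> i. complex_of_real (y $ i)) \<in> gen_bernstein l u \<rho>"
        unfolding embed inv_tau_vec_cbox(1)[OF lu y] .
    qed
    have "continuous_on (cbox l u) (\<lambda>y. Re (F (\<chi> i. complex_of_real (y $ i))))"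
      by (rule continuous_on_Re[OF continuous_on_compose2[OF F_cont e_cont sub]])
    then have "continuous_on (cbox l u) f"
      using Ff by (simp cong: continuous_on_cong)
    then show ?thesis
      by (intro continuous_intros continuous_on_cheb_interp[OF lu])
  qed
  have "l \<in> cbox l u" using lu by (auto simp: mem_box_cart less_imp_le)
  then have "cbox l u \<noteq> {}" by blast
  from continuous_attains_sup[OF compact_cbox this cont]
  obtain x where "x \<in> cbox l u" "\<forall>y\<in>cbox l u. \<bar>f y - cheb_interp l u N f y\<bar> \<le> \<bar>f x - cheb_interp l u N f x\<bar>"
    by blast
  then show ?thesis using a b by (auto intro!: bexI[of _ x])
qed

end
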